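(* For integers $0\le d\le n-1$, $$G(n;d)=\min_{\substack{\ell_1+\cdots+\ell_{d+1}=n\\ \ell_j\ge 1}}\big(G(\ell_1)+\cdots+G(\ell_{d+1})\big).$$ For $0\le d\le n-2$, $$\widetilde G(n;d)\ge \min\Big(G(n;d+1),\ \min_{\substack{\ell_1+\cdots+\ell_{d+1}=n\\ \ell_j\ge 1}}\big(\widetilde G(\ell_1)+\cdots+\widetilde G(\ell_{d+1})\big)\Big).$$ In particular, for all $d+1\le n\le 2d+2$ one has $G(n;d)=(d+1)/12$, and if $n\ge 2d+3$ then $G(n;d)\ge d/12+1/9$. Further, if $d+2\le n\le 2d+4$ then $\widetilde G(n;d)\ge (d+2)/12$, while if $n\ge 2d+5$ then $\widetilde G(n;d)\ge d/12+7/36$.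
   Context: Let $\psi(x)=1/2-\{x\}$ where $\{x\}=x-\lfloor x\rfloor$. A list $\mathfrak a=[a_1,\ldots,a_n]$ is a finite list of non-zero integers (permutations of the entries are regarded as the same list); its length is $\ell(\mathfrak a)=n$ and its sum is $s(\mathfrak a)=a_1+\cdots+a_n$. A list is degenerate if it contains both $a$ and $-a$ for some integer $a$. To a list associate $\mathfrak a(x)=\sum_{j=1}^n\psi(a_jx)$ and its norm $N(\mathfrak a)=\int_0^1\mathfrak a(x)^2\,dx$. A list is identified with the point $(a_1,\ldots,a_n)\in\mathbb{R}^n$. $G(n)=\inf\{N(\mathfrak a):\ \mathfrak a \text{ non-degenerate},\ \ell(\mathfrak a)=n\}$. For $d<n$, $$G(n;d)=\sup_{V_1,\ldots,V_r}\inf\{N(\mathfrak a):\ \mathfrak a\text{ non-degenerate},\ \ell(\mathfrak a)=n,\ \mathfrak a\notin V_1\cup\cdots\cup V_r\},$$ the supremum over all finite collections of vector subspaces of $\mathbb{R}^n$ of dimension at most $d$; $G(n;d)=\infty$ if $d\ge n$, and $G(n;0)=G(n)$. For $n>d$, $\widetilde G(n;d)$ is defined in the same way as $G(n;d)$ but with the infimum taken only over non-degenerate lists with $s(\mathfrak a)=0$; $\widetilde G(n)=\widetilde G(n;0)$ (an infimum over an empty set is $+\infty$). *)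

theory Defs
  imports "HOL-Analysis.Analysis" "HOL-Analysis.Finite_Function_Topology"
begin

definition psi :: "real \<Rightarrow> real" where
  "psi x = 1 / 2 - frac x"

text \<open>
  A list of non-zero integers is an \<^typ>\<open>int list\<close>. Sum, norm and degeneracy are invariant
  under permuting the entries. The order only matters for the associated point of real n-space,
  and there each ordering is treated as a separate candidate; since a finite collection of
  subspaces may be enlarged by all its images under permutations of the coordinates, the
  suprema below are the same as for lists up to permutation.
\<close>

definition list_fun :: "int list \<Rightarrow> real \<Rightarrow> real" where
  "list_fun as x = (\<Sum>a\<leftarrow>as. psi (of_int a * x))"

definition list_norm :: "int list \<Rightarrow> real" where
  "list_norm as = integral {0..1} (\<lambda>x. (list_fun as x)\<^sup>2)"

definition degenerate :: "int list \<Rightarrow> bool" where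
  "degenerate as \<longleftrightarrow> (\<exists>a. a \<in> set as \<and> - a \<in> set as)"

definition nondegenerate_lists :: "nat \<Rightarrow> int list set" where
  "nondegenerate_lists n = {as. length as = n \<and> (\<forall>a\<in>set as. a \<noteq> 0) \<and> \<not> degenerate as}"

text \<open>
  Real n-space for a variable natural number n: the finitely supported functions
  whose support is contained in the first n indices.
\<close>

definition real_space :: "nat \<Rightarrow> (nat \<Rightarrow>\<^sub>0 real) set" where
  "real_space n = {v. Poly_Mapping.keys v \<subseteq> {..<n}}"

definition list_point :: "int list \<Rightarrow> (nat \<Rightarrow>\<^sub>0 real)" where
  "list_point as = Poly_Mapping.nth (map real_of_int as)"

definition subspaces_upto :: "nat \<Rightarrow> nat \<Rightarrow> (nat \<Rightarrow>\<^sub>0 real) set set" where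
  "subspaces_upto n d = {V. subspace V \<and> V \<subseteq> real_space n \<and> dim V \<le> d}"

definition G :: "nat \<Rightarrow> ereal" where
  "G n = (INF as\<in>nondegenerate_lists n. ereal (list_norm as))"

definition G_dim :: "nat \<Rightarrow> nat \<Rightarrow> ereal" where
  "G_dim n d =
    (if d < n then
       (SUP \<V>\<in>{\<V>. finite \<V> \<and> \<V> \<subseteq> subspaces_upto n d}.
          INF as\<in>{as \<in> nondegenerate_lists n. list_point as \<notin> \<Union>\<V>}. ereal (list_norm as))
     else \<infinity>)"

text \<open>
  Only meaningful for \<open>d < n\<close>. (Otherwise the formula gives \<open>\<infinity>\<close>, as the whole space is allowed
  as a subspace.)
\<close>

definition Gt_dim :: "nat \<Rightarrow> nat \<Rightarrow> ereal" where
  "Gt_dim n d =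
    (SUP \<V>\<in>{\<V>. finite \<V> \<and> \<V> \<subseteq> subspaces_upto n d}.
       INF as\<in>{as \<in> nondegenerate_lists n. sum_list as = 0 \<and> list_point as \<notin> \<Union>\<V>}.
         ereal (list_norm as))"

definition Gt :: "nat \<Rightarrow> ereal" where
  "Gt n = Gt_dim n 0"

definition compositions :: "nat \<Rightarrow> nat \<Rightarrow> nat list set" where
  "compositions n k = {ls. length ls = k \<and> sum_list ls = n \<and> (\<forall>l\<in>set ls. 1 \<le> l)}"


text \<open>
  The minima over compositions in the statement are minima over finite non-empty sets.
\<close>

lemma finite_compositions: "finite (compositions n k)"
proof (rule finite_subset)
  show "compositions n k \<subseteq> {ls. set ls \<subseteq> {..n} \<and> length ls = k}"
    by (auto simp: compositions_def member_le_sum_list)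
  show "finite {ls. set ls \<subseteq> {..n} \<and> length ls = k}"
    by (rule finite_lists_length_eq) simp
qed

lemma compositions_nonempty:
  assumes "d < n"
  shows "compositions n (d + 1) \<noteq> {}"
proof -
  have "(n - d) # replicate d 1 \<in> compositions n (d + 1)"
    using assms by (auto simp: compositions_def sum_list_replicate)
  then show ?thesis by blast
qed

lemma lookup_scaleR_real:
  "Poly_Mapping.lookup (r *\<^sub>R v) i = r * Poly_Mapping.lookup v i" for v :: "'a \<Rightarrow>\<^sub>0 real"
proof -
  have "finite {i. r * Poly_Mapping.lookup v i \<noteq> 0}"
    by (rule finite_subset[of _ "Poly_Mapping.keys v"]) (auto simp: in_keys_iff)
  then show ?thesis
    by (simp add: scaleR_poly_mapping_def)
qed

lemma real_space_span:
  "real_space n = span ((\<lambda>i. Poly_Mapping.single i 1) ` {..<n})"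
proof
  show "real_space n \<subseteq> span ((\<lambda>i. Poly_Mapping.single i (1::real)) ` {..<n})"
  proof
    fix v assume v: "v \<in> real_space n"
    have "v = (\<Sum>i<n. Poly_Mapping.lookup v i *\<^sub>R Poly_Mapping.single i 1)"
    proof (rule poly_mapping_eqI)
      fix k
      have "(\<Sum>i<n. Poly_Mapping.lookup v i *\<^sub>R (if k = i then 1 else 0))
            = Poly_Mapping.lookup v k"
      proof (cases "k < n")
        case False
        then have "k \<notin> Poly_Mapping.keys v"
          using v by (auto simp: real_space_def)
        with False show ?thesis by (auto simp: in_keys_iff intro!: sum.neutral)
      qed (simp add: if_distrib cong: if_cong)
      then show "Poly_Mapping.lookup v k
        = Poly_Mapping.lookup (\<Sum>i<n. Poly_Mapping.lookup v i *\<^sub>R Poly_Mapping.single i 1) k"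
        by (simp add: lookup_sum lookup_scaleR_real lookup_single when_def eq_commute)
    qed
    also have "\<dots> \<in> span ((\<lambda>i. Poly_Mapping.single i 1) ` {..<n})"
      by (intro span_sum span_scale span_base) auto
    finally show "v \<in> span ((\<lambda>i. Poly_Mapping.single i 1) ` {..<n})" .
  qed
  have "subspace (real_space n)"
    unfolding real_space_def subspace_def
    by (auto simp: in_keys_iff subset_iff lookup_add lookup_scaleR_real) (metis add.right_neutral)
  then show "span ((\<lambda>i. Poly_Mapping.single i 1) ` {..<n}) \<subseteq> real_space n"
    by (intro span_minimal) (auto simp: real_space_def)
qed

lemma dim_real_space: "dim (real_space n) = n"
proof -
  let ?e = "\<lambda>i. Poly_Mapping.single i (1::real)"
  have inj: "inj_on ?e {..<n}"
    by (rule inj_onI) (metis lookup_single_eq lookup_single_not_eq zero_neq_one)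
  have "independent (?e ` {..<n})"
  proof (rule independent_if_scalars_zero)
    fix f x assume 0: "(\<Sum>y\<in>?e ` {..<n}. f y *\<^sub>R y) = 0" and "x \<in> ?e ` {..<n}"
    then obtain k where k: "x = ?e k" "k < n" by auto
    have "0 = Poly_Mapping.lookup (\<Sum>i<n. f (?e i) *\<^sub>R ?e i) k"
      using 0 by (simp add: sum.reindex[OF inj])
    also have "\<dots> = (\<Sum>i<n. if i = k then f (?e i) else 0)"
      unfolding lookup_sum lookup_scaleR_real lookup_single when_def
      by (intro sum.cong) auto
    finally show "f x = 0" using k by (simp add: if_distrib cong: if_cong)
  qed simp
  then show ?thesis
    unfolding real_space_span using dim_span_eq_card_independent card_image[OF inj] by fastforce
qed

lemma subspaces_upto_0:
  assumes "V \<in> subspaces_upto n 0"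
  shows "V = {0}"
proof -
  have V: "subspace V" "V \<subseteq> real_space n" "dim V = 0"
    using assms by (auto simp: subspaces_upto_def)
  obtain B where B: "B \<subseteq> V" "independent B" "V \<subseteq> span B" "card B = dim V"
    using basis_exists by blast
  have "finite B"
    using independent_span_bound[of "(\<lambda>i. Poly_Mapping.single i (1::real)) ` {..<n}" B] B V
      real_space_span by auto
  then have "B = {}" using B V by simp
  then show ?thesis using B(3) V(1) subspace_0 by auto
qed

lemma G_dim_0:
  assumes "0 < n"
  shows "G_dim n 0 = G n"
proof -
  have "list_point as \<notin> \<Union>\<V>" if "as \<in> nondegenerate_lists n" "\<V> \<subseteq> subspaces_upto n 0" for as \<V>
  proof
    assume "list_point as \<in> \<Union>\<V>"
    then have "list_point as = 0" using that(2) subspaces_upto_0 by blast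
    then have "Poly_Mapping.lookup (list_point as) 0 = 0" by simp
    moreover have "length as = n" "\<forall>a\<in>set as. a \<noteq> 0"
      using that(1) by (auto simp: nondegenerate_lists_def)
    ultimately show False
      using assms by (auto simp: list_point_def nth_default_def split: if_splits)
  qed
  then have "{as \<in> nondegenerate_lists n. list_point as \<notin> \<Union>\<V>} = nondegenerate_lists n"
    if "\<V> \<subseteq> subspaces_upto n 0" for \<V>
    using that by blast
  then have "G_dim n 0 = (SUP \<V>\<in>{\<V>. finite \<V> \<and> \<V> \<subseteq> subspaces_upto n 0}. G n)"
    using assms by (auto simp: G_dim_def G_def intro!: SUP_cong)
  also have "\<dots> = G n"
    by (rule SUP_const) auto
  finally show ?thesis .
qed

end

theory Submission
  imports Defs "HOL-Number_Theory.Number_Theory"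
begin

text \<open>
  Since \<open>\<integral>\<psi>(a x) \<psi>(b x) dx = gcd(a, b)\<^sup>2 / (12 a b)\<close>, twelve times the norm of a list is a
  quadratic form \<open>Q\<close> on finitely supported integer vectors \<open>f\<close> on the positive integers.
  Entries are grouped into clusters whose pairwise ratios have small height. Entries in
  different clusters are almost orthogonal, so the norm is nearly the sum of the norms of the
  clusters, and for a bounded ratio height a list with at most \<open>d\<close> clusters lies in one of
  finitely many subspaces of dimension at most \<open>d\<close>. Conversely, scaling \<open>d + 1\<close> lists by
  \<open>1, T, \<dots>, T\<^sup>d\<close> makes them asymptotically orthogonal and avoids all given subspaces. If the
  sum of the list is zero and there are exactly \<open>d + 1\<close> clusters, then the sum over every
  cluster vanishes, as otherwise the sum condition would lower the dimension.

  For the numerical bounds, split \<open>f\<close> at a prime \<open>p\<close> by the exponent of \<open>p\<close>. With \<open>\<rho> = 1 / p\<close>,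
  if only two consecutive exponents occur, with parts \<open>x\<close> and \<open>y\<close>, then
  \<open>Q f = (1 - \<rho>) (Q x + Q y) + \<rho> Q (x + y)\<close>; otherwise, with lowest part \<open>x\<close> and highest part
  \<open>y\<close>, one has \<open>Q f = (1 - \<rho>\<^sup>2) (Q x + Q y) + Q w\<close> where \<open>p w\<close> is integral. By induction
  this gives \<open>Q \<ge> 1\<close>, determines the vectors of small norm, and bounds \<open>Q f\<close> from below when
  \<open>\<Sum> a f(a) = 0\<close>, because then \<open>p\<close> divides \<open>\<Sum> a x(a)\<close>, which excludes the small norms for \<open>x\<close>.
\<close>

section \<open>Inner products of sawtooth functions\<close>


text \<open>The kernel gcd(a, b)^2 / (a b) is the product over all primes p of p^(-|i - j|), where i
  and j are the exponents of p in a and b. This geometric decay is what makes the splitting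
  identities exact: projecting the lowest or highest level onto the others only involves the
  adjacent level, with factor 1/p.

  The obstacle is the zero-sum case. A list of length 4 attains norm 1/6, so no bound on Q alone
  gives 7/36 and the length has to be carried through the classification. Small vectors have weight
  1, 3 or q - 1 with q in {3, 5}, up to sign and a dilation factor. A prime p >= 5 coprime to the
  keys divides none of these, but 3 divides 3; so p = 3 needs an explicit enumeration, whereas for p
  = 2 the parity of one coefficient is enough.

  The constants are values of Q divided by 12: 1/9 comes from 4/3 = 2 (1 - 1/3), the least cost of
  an odd prime, and 7/36 from 7/3. The value 7/36 for a zero-sum cluster matters only when d = 0,
  since two or more such clusters already contribute (d + 1)/6.\<close>

lemma sum_add_div:
  fixes n :: int
  assumes "0 < b"
  shows "(\<Sum>j<b. (n + int j) div int b) = n"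
proof -
  \<comment> \<open>Hermite's identity: raising the argument by 1 slides the window of b consecutive
    integers, replacing m div b by (m + b) div b = m div b + 1.\<close>
  have step: "(\<Sum>j<b. (m + 1 + int j) div int b) = (\<Sum>j<b. (m + int j) div int b) + 1" for m :: int
  proof -
    have "(\<Sum>j<b. (m + 1 + int j) div int b) + m div int b = (\<Sum>j<Suc b. (m + int j) div int b)"
      by (simp add: sum.lessThan_Suc_shift algebra_simps del: sum.lessThan_Suc)
    also have "\<dots> = (\<Sum>j<b. (m + int j) div int b) + (m div int b + 1)"
      using assms by simp
    finally show ?thesis by simp
  qed
  show ?thesis
  proof (induction n rule: int_induct[where k = 0])
    case base
    show ?case by (intro sum.neutral) auto
  next
    case (step1 i)
    then show ?case using step[of i] by simp
  next
    case (step2 i)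
    then show ?case using step[of "i - 1"] by simp
  qed
qed

lemma psi_add_int [simp]: "psi (x + of_int k) = psi x" "psi (of_int k + x) = psi x"
  by (simp_all add: psi_def frac_def)

lemma psi_add_nat [simp]: "psi (x + real k) = psi x" "psi (real k + x) = psi x"
  using psi_add_int(1)[where x = x and k = "int k"] by (simp_all add: add.commute)

text \<open>The distribution relation of the sawtooth function; taking floors turns it into
  Hermite's identity \<open>sum_add_div\<close>.\<close>

lemma sum_psi_shift:
  assumes "0 < b"
  shows "(\<Sum>j<b. psi (y + real j / real b)) = psi (real b * y)"
proof -
  have fl: "\<lfloor>y + real j / real b\<rfloor> = (\<lfloor>real b * y\<rfloor> + int j) div int b" for j
  proof -
    have "y + real j / real b = (real b * y + real j) / real b"
      using assms by (simp add: field_simps)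
    also have "\<lfloor>\<dots>\<rfloor> = \<lfloor>real b * y + real j\<rfloor> div int b"
      using floor_divide_real_eq_div[of "int b" "real b * y + real j"] by simp
    also have "\<lfloor>real b * y + real j\<rfloor> = \<lfloor>real b * y\<rfloor> + int j"
      by (metis floor_add_int of_int_of_nat_eq)
    finally show ?thesis .
  qed
  have "(\<Sum>j<b. psi (y + real j / real b))
      = (\<Sum>j<b. 1 / 2 - y - real j / real b + of_int ((\<lfloor>real b * y\<rfloor> + int j) div int b))"
    by (simp add: psi_def frac_def fl algebra_simps)
  also have "\<dots> = real b * (1 / 2 - y) - (\<Sum>j<b. real j) / real b
      + of_int (\<Sum>j<b. (\<lfloor>real b * y\<rfloor> + int j) div int b)"
    by (simp add: sum.distrib sum_subtractf sum_divide_distrib algebra_simps)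
  also have "(\<Sum>j<b. real j) = real b * (real b - 1) / 2"
    by (induction b) (auto simp: algebra_simps add_divide_distrib)
  also have "real b * (1 / 2 - y) - real b * (real b - 1) / 2 / real b
      + of_int (\<Sum>j<b. (\<lfloor>real b * y\<rfloor> + int j) div int b) = psi (real b * y)"
    unfolding sum_add_div[OF assms] using assms by (simp add: psi_def frac_def field_simps)
  finally show ?thesis .
qed

text \<open>Multiplication by a permutes the residues modulo b, and \<open>psi\<close> has period
  1.\<close>

lemma sum_psi_shift_coprime:
  assumes "0 < b" "coprime a b"
  shows "(\<Sum>j<b. psi (y + real a * real j / real b)) = psi (real b * y)"
proof -
  have inj: "inj_on (\<lambda>j. a * j mod b) {..<b}"
  proof (rule inj_onI)
    fix i j assume ij: "i \<in> {..<b}" "j \<in> {..<b}" "a * i mod b = a * j mod b"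
    then have "[a * i = a * j] (mod b)" by (simp add: cong_def)
    then have "[i = j] (mod b)" using assms(2) cong_mult_lcancel_nat by blast
    then show "i = j" using ij by (simp add: cong_def)
  qed
  have img: "(\<lambda>j. a * j mod b) ` {..<b} = {..<b}"
    using assms inj by (intro card_subset_eq) (auto simp: card_image)
  have "psi (y + real a * real j / real b) = psi (y + real (a * j mod b) / real b)" for j
  proof -
    have e: "real a * real j = real b * real (a * j div b) + real (a * j mod b)"
      by (metis mult_div_mod_eq of_nat_mult of_nat_add)
    have "y + real a * real j / real b
        = y + real (a * j mod b) / real b + real (a * j div b)"
      unfolding e using assms by (simp add: add_divide_distrib)
    then show ?thesis by (simp only: psi_add_nat)
  qed
  then have "(\<Sum>j<b. psi (y + real a * real j / real b))
      = (\<Sum>j<b. psi (y + real (a * j mod b) / real b))" by simp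
  also have "\<dots> = (\<Sum>j<b. psi (y + real j / real b))"
    using sum.reindex[OF inj, of "\<lambda>j. psi (y + real j / real b)"] img by simp
  finally show ?thesis using sum_psi_shift assms(1) by simp
qed

text \<open>Substitution on each of the b subintervals of length 1/b. For periodic factors this
  averages over the shifts j/b, which the distribution relation evaluates.\<close>

lemma integral_unfold:
  fixes F :: "real \<Rightarrow> real"
  assumes "F integrable_on {0..1}" "0 < b"
  shows "integral {0..1} F = (\<Sum>j<b. integral {0..1} (\<lambda>y. F ((y + real j) / real b))) / real b"
proof -
  have int: "F integrable_on {c..d}" if "0 \<le> c" "d \<le> 1" for c d
    using assms(1) that integrable_subinterval_real by fastforce
  have piece: "integral {real j / real b..real (Suc j) / real b} F
      = integral {0..1} (\<lambda>y. F ((y + real j) / real b)) / real b" if "j < b" for j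
  proof -
    have "(F has_integral integral {real j / real b..real (Suc j) / real b} F)
        (cbox (real j / real b) (real (Suc j) / real b))"
      using int[of "real j / real b" "real (Suc j) / real b"] that assms(2)
      by (simp add: has_integral_integral)
    from has_integral_affinity'[OF this, of "1 / real b" "real j / real b"]
    have "((\<lambda>y. F ((y + real j) / real b)) has_integral
        real b * integral {real j / real b..real (Suc j) / real b} F) {0..1}"
      using assms(2) by (simp add: field_simps)
    then show ?thesis using assms(2) by (simp add: integral_unique field_simps)
  qed
  have "integral {0..real k / real b} F
      = (\<Sum>j<k. integral {real j / real b..real (Suc j) / real b} F)" if "k \<le> b" for k
    using that
  proof (induction k)
    case (Suc k)
    have "integral {0..real k / real b} F + integral {real k / real b..real (Suc k) / real b} F
        = integral {0..real (Suc k) / real b} F"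
      using Suc.prems assms(2) by (intro Henstock_Kurzweil_Integration.integral_combine int)
        (auto simp: field_simps)
    then show ?case using Suc by simp
  qed simp
  from this[of b] show ?thesis
    using assms(2) piece by (simp add: sum_divide_distrib)
qed

lemma psi_abs_le: "\<bar>psi x\<bar> \<le> 1 / 2"
  unfolding psi_def using frac_lt_1[of x] frac_ge_0[of x] by arith

lemma psi_borel [measurable]: "psi \<in> borel_measurable borel"
  unfolding psi_def frac_def by measurable

lemma integrable_psi_mult:
  "(\<lambda>x. psi (c * x) * psi (d * x)) integrable_on {0..1}"
proof (rule measurable_bounded_by_integrable_imp_integrable[where g = "\<lambda>_. 1"])
  show "(\<lambda>x. psi (c * x) * psi (d * x)) \<in> borel_measurable (lebesgue_on {0..1})"
    by (intro measurable_restrict_space1 measurable_completion) measurable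
  fix x
  have "\<bar>psi (c * x)\<bar> * \<bar>psi (d * x)\<bar> \<le> 1 / 2 * (1 / 2)"
    by (intro mult_mono psi_abs_le) auto
  then show "norm (psi (c * x) * psi (d * x)) \<le> 1" by (simp add: abs_mult)
qed auto

lemma integral_psi_square: "integral {0..1} (\<lambda>x. psi x * psi x) = 1 / 12"
proof -
  have "((\<lambda>x::real. (1 / 2 - x)\<^sup>2) has_integral
      (- ((1 / 2 - 1) ^ 3) / 3 - (- ((1 / 2 - 0) ^ 3) / 3))) {0..1}"
    by (intro fundamental_theorem_of_calculus)
      (auto intro!: derivative_eq_intros simp flip: has_real_derivative_iff_has_vector_derivative)
  then have "((\<lambda>x::real. (1 / 2 - x)\<^sup>2) has_integral 1 / 12) {0..1}"
    by (simp add: power3_eq_cube)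
  then have "((\<lambda>x. psi x * psi x) has_integral 1 / 12) {0..1}"
  proof (rule has_integral_spike_finite[of "{1}", rotated 2])
    fix x :: real assume "x \<in> {0..1} - {1}"
    then show "psi x * psi x = (1 / 2 - x)\<^sup>2"
      by (simp add: psi_def frac_eq[THEN iffD2] power2_eq_square)
  qed simp
  then show ?thesis by (rule integral_unique)
qed

definition gcd_ker :: "nat \<Rightarrow> nat \<Rightarrow> real" where
  "gcd_ker a b = (real (gcd a b))\<^sup>2 / (real a * real b)"

text \<open>Unfolding into b pieces turns \<open>psi (b x)\<close> into \<open>psi y\<close> on
  every piece, while the other factor, summed over shifts by multiples of a/b, collapses to
  \<open>psi (a y)\<close>. Doing this for b and then for a leaves the integral of the square of
  \<open>psi\<close>.\<close>

lemma integral_psi_coprime: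
  assumes "0 < a" "0 < b" "coprime a b"
  shows "integral {0..1} (\<lambda>x. psi (real a * x) * psi (real b * x)) = 1 / (12 * real a * real b)"
proof -
  have *: "integral {0..1} (\<lambda>x. psi (real a * x) * psi (real b * x))
      = integral {0..1} (\<lambda>x. psi (real a * x) * psi x) / real b"
    if "0 < b" "coprime a b" for a b
  proof -
    have e1: "psi (real b * ((y + real j) / real b)) = psi y" for y j
      using that(1) by simp
    have e2: "real a * ((y + real j) / real b) = real a / real b * y + real a * real j / real b"
      for y j
      by (simp add: algebra_simps add_divide_distrib)
    have "integral {0..1} (\<lambda>x. psi (real a * x) * psi (real b * x))
       = (\<Sum>j<b. integral {0..1}
          (\<lambda>y. psi (real a / real b * y + real a * real j / real b) * psi y)) / real b"
      using integral_unfold[OF integrable_psi_mult that(1), of "real a" "real b"]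
      by (simp only: e1 e2)
    also have "(\<Sum>j<b. integral {0..1}
          (\<lambda>y. psi (real a / real b * y + real a * real j / real b) * psi y))
        = integral {0..1} (\<lambda>y. \<Sum>j<b. psi (real a / real b * y + real a * real j / real b) * psi y)"
    proof (rule integral_sum[symmetric])
      fix j
      show "(\<lambda>y. psi (real a / real b * y + real a * real j / real b) * psi y) integrable_on {0..1}"
      proof (rule measurable_bounded_by_integrable_imp_integrable[where g = "\<lambda>_. 1"])
        show "(\<lambda>y. psi (real a / real b * y + real a * real j / real b) * psi y)
            \<in> borel_measurable (lebesgue_on {0..1})"
          by (intro measurable_restrict_space1 measurable_completion) measurable
        fix y
        have "\<bar>psi (real a / real b * y + real a * real j / real b)\<bar> * \<bar>psi y\<bar> \<le> 1 / 2 * (1 / 2)"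
          by (intro mult_mono psi_abs_le) auto
        then show "norm (psi (real a / real b * y + real a * real j / real b) * psi y) \<le> 1"
          by (simp add: abs_mult)
      qed auto
    qed simp
    also have "(\<lambda>y. \<Sum>j<b. psi (real a / real b * y + real a * real j / real b) * psi y)
        = (\<lambda>y. psi (real a * y) * psi y)"
      using that by (simp flip: sum_distrib_right add: sum_psi_shift_coprime)
    finally show ?thesis .
  qed
  have "integral {0..1} (\<lambda>x. psi (real a * x) * psi x)
      = integral {0..1} (\<lambda>x. psi x * psi x) / real a"
    using *[of a 1] assms by (simp add: mult.commute)
  then show ?thesis using *[of b a] assms by (simp add: integral_psi_square)
qed

text \<open>The gcd g is removed by unfolding into g pieces, on which the integrand is the same by
  periodicity.\<close>

lemma integral_psi_nat:
  assumes "0 < a" "0 < b"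
  shows "integral {0..1} (\<lambda>x. psi (real a * x) * psi (real b * x)) = gcd_ker a b / 12"
proof -
  obtain g a' b' where g: "a = a' * g" "b = b' * g" "coprime a' b'" "gcd a b = g"
    using gcd_coprime_exists[of a b] assms by (metis gcd_eq_0_iff less_numeral_extra(3))
  have pos: "0 < g" "0 < a'" "0 < b'" using assms g(1,2) by (metis gr0I mult_0 mult_0_right)+
  have e: "psi (real (c * g) * ((y + real j) / real g)) = psi (real c * y)" for c y j
  proof -
    have "real (c * g) * ((y + real j) / real g) = real c * y + real (c * j)"
      using pos by (simp add: field_simps)
    then show ?thesis by (simp only: psi_add_nat)
  qed
  have "integral {0..1} (\<lambda>x. psi (real a * x) * psi (real b * x))
      = (\<Sum>j<g. integral {0..1} (\<lambda>y. psi (real a' * y) * psi (real b' * y))) / real g"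
    using integral_unfold[OF integrable_psi_mult pos(1), of "real a" "real b"]
    by (simp only: g(1,2) e)
  also have "\<dots> = 1 / (12 * real a' * real b')"
    using pos g(3) by (simp add: integral_psi_coprime)
  also have "\<dots> = gcd_ker a b / 12"
    using pos by (simp add: gcd_ker_def g(4)) (simp add: g(1,2) power2_eq_square)
  finally show ?thesis .
qed

lemma psi_minus: "x \<notin> \<int> \<Longrightarrow> psi (- x) = - psi x"
  by (simp add: psi_def frac_neg)

definition gcd_ker_int :: "int \<Rightarrow> int \<Rightarrow> real" where
  "gcd_ker_int a b = (of_int (gcd a b))\<^sup>2 / (of_int a * of_int b)"

lemma gcd_ker_int_conv:
  "gcd_ker_int a b = of_int (sgn a) * of_int (sgn b) * gcd_ker (nat \<bar>a\<bar>) (nat \<bar>b\<bar>)"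
proof -
  have "real (gcd (nat \<bar>a\<bar>) (nat \<bar>b\<bar>)) = of_int (gcd a b)"
    by (metis gcd_int_def of_int_of_nat_eq)
  then show ?thesis
    unfolding gcd_ker_int_def gcd_ker_def
    by (cases a "0::int" rule: linorder_cases; cases b "0::int" rule: linorder_cases) simp_all
qed

lemma finite_int_multiples: "a \<noteq> 0 \<Longrightarrow> finite {x \<in> {0..1::real}. of_int a * x \<in> \<int>}"
proof -
  assume a: "a \<noteq> 0"
  have "{x \<in> {0..1::real}. of_int a * x \<in> \<int>} \<subseteq> (\<lambda>k. of_int k / of_int a) ` {-\<bar>a\<bar>..\<bar>a\<bar>}"
  proof
    fix x :: real assume "x \<in> {x \<in> {0..1::real}. of_int a * x \<in> \<int>}"
    then obtain k where k: "of_int a * x = of_int k" "0 \<le> x" "x \<le> 1" by (auto elim: Ints_cases)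
    have "\<bar>of_int k\<bar> \<le> (of_int \<bar>a\<bar> :: real)"
      unfolding k(1)[symmetric] abs_mult using k(2,3) by (simp add: mult_left_le)
    then have "\<bar>k\<bar> \<le> \<bar>a\<bar>" by linarith
    then show "x \<in> (\<lambda>k. of_int k / of_int a) ` {-\<bar>a\<bar>..\<bar>a\<bar>}"
      using k(1) a by (intro image_eqI[of _ _ k]) (auto simp: field_simps)
  qed
  then show ?thesis by (rule finite_subset) simp
qed

text \<open>Away from the integers \<open>psi\<close> is odd, so the signs factor out except on a
  finite set.\<close>

lemma integral_psi_int:
  assumes "a \<noteq> 0" "b \<noteq> 0"
  shows "integral {0..1} (\<lambda>x. psi (of_int a * x) * psi (of_int b * x)) = gcd_ker_int a b / 12"
proof -
  have conv: "psi (of_int c * x) = of_int (sgn c) * psi (real (nat \<bar>c\<bar>) * x)"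
    if "of_int c * x \<notin> \<int>" for c x
  proof (cases "c < 0")
    case True
    then show ?thesis using that psi_minus[of "of_int c * x"] by simp
  next
    case False
    then have "c > 0" using that by (cases "c = 0") auto
    then show ?thesis by simp
  qed
  have "integral {0..1} (\<lambda>x. psi (of_int a * x) * psi (of_int b * x))
      = integral {0..1} (\<lambda>x. of_int (sgn a * sgn b) *
          (psi (real (nat \<bar>a\<bar>) * x) * psi (real (nat \<bar>b\<bar>) * x)))"
  proof (rule integral_spike[of "{x \<in> {0..1}. of_int a * x \<in> \<int>} \<union> {x \<in> {0..1}. of_int b * x \<in> \<int>}"])
    show "negligible ({x \<in> {0..1::real}. of_int a * x \<in> \<int>} \<union> {x \<in> {0..1}. of_int b * x \<in> \<int>})"
      using finite_int_multiples assms by (intro negligible_finite) auto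
    fix x :: real
    assume "x \<in> {0..1} - ({x \<in> {0..1}. of_int a * x \<in> \<int>} \<union> {x \<in> {0..1}. of_int b * x \<in> \<int>})"
    then show "of_int (sgn a * sgn b) * (psi (real (nat \<bar>a\<bar>) * x) * psi (real (nat \<bar>b\<bar>) * x))
        = psi (of_int a * x) * psi (of_int b * x)"
      using conv[of a x] conv[of b x] by auto
  qed
  also have "\<dots> = of_int (sgn a * sgn b) * (gcd_ker (nat \<bar>a\<bar>) (nat \<bar>b\<bar>) / 12)"
    using assms integral_psi_nat[of "nat \<bar>a\<bar>" "nat \<bar>b\<bar>"] by (subst integral_mult_right) simp
  finally show ?thesis by (simp add: gcd_ker_int_conv)
qed

lemma list_norm_eq:
  assumes "\<forall>a\<in>set as. a \<noteq> 0"
  shows "list_norm as = (\<Sum>a\<leftarrow>as. \<Sum>b\<leftarrow>as. gcd_ker_int a b) / 12"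
proof -
  have "(list_fun as x)\<^sup>2
      = (\<Sum>i<length as. \<Sum>j<length as. psi (of_int (as ! i) * x) * psi (of_int (as ! j) * x))" for x
    unfolding list_fun_def
    by (simp add: power2_eq_square sum_list_sum_nth sum_product atLeast0LessThan)
  then have "list_norm as = integral {0..1}
      (\<lambda>x. \<Sum>i<length as. \<Sum>j<length as. psi (of_int (as ! i) * x) * psi (of_int (as ! j) * x))"
    by (simp add: list_norm_def)
  also have "\<dots> = (\<Sum>i<length as. \<Sum>j<length as. integral {0..1}
      (\<lambda>x. psi (of_int (as ! i) * x) * psi (of_int (as ! j) * x)))"
    by (simp add: integral_sum integrable_sum integrable_psi_mult)
  also have "\<dots> = (\<Sum>i<length as. \<Sum>j<length as. gcd_ker_int (as ! i) (as ! j) / 12)"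
    using assms by (intro sum.cong) (auto simp: integral_psi_int)
  finally show ?thesis
    by (simp add: sum_list_sum_nth atLeast0LessThan sum_divide_distrib)
qed

section \<open>Vectors and their decomposition at a prime\<close>


text \<open>Here a key is the absolute value of an entry and the value is its signed multiplicity.
  In the arguments about subspaces the same type holds points of real n-space, keyed by
  position.\<close>

type_synonym vec = "nat \<Rightarrow>\<^sub>0 real"

abbreviation "keys \<equiv> Poly_Mapping.keys"
abbreviation "lookup \<equiv> Poly_Mapping.lookup"
abbreviation "single \<equiv> Poly_Mapping.single"

definition lin :: "(nat \<Rightarrow> real) \<Rightarrow> vec \<Rightarrow> real" where
  "lin \<phi> f = (\<Sum>a\<in>keys f. lookup f a * \<phi> a)"

lemma lin_superset:
  assumes "finite A" "keys f \<subseteq> A"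
  shows "lin \<phi> f = (\<Sum>a\<in>A. lookup f a * \<phi> a)"
  unfolding lin_def using assms by (intro sum.mono_neutral_left) (auto simp: in_keys_iff)

lemma lin_0 [simp]: "lin \<phi> 0 = 0"
  by (simp add: lin_def)

lemma lin_add [simp]: "lin \<phi> (f + g) = lin \<phi> f + lin \<phi> g"
proof -
  have "keys (f + g) \<subseteq> keys f \<union> keys g" by (rule keys_add)
  then show ?thesis
    by (simp add: lin_superset[of "keys f \<union> keys g"] lookup_add sum.distrib algebra_simps)
qed

lemma lin_scale [simp]: "lin \<phi> (c *\<^sub>R f) = c * lin \<phi> f"
proof -
  have "keys (c *\<^sub>R f) \<subseteq> keys f" by (auto simp: in_keys_iff lookup_scaleR_real)
  then have "lin \<phi> (c *\<^sub>R f) = (\<Sum>a\<in>keys f. lookup (c *\<^sub>R f) a * \<phi> a)"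
    by (intro lin_superset) auto
  then show ?thesis by (simp add: lin_def lookup_scaleR_real sum_distrib_left algebra_simps)
qed

lemma lin_minus [simp]: "lin \<phi> (- f) = - lin \<phi> f"
  using lin_scale[of \<phi> "-1" f] by simp

lemma lin_diff [simp]: "lin \<phi> (f - g) = lin \<phi> f - lin \<phi> g"
  using lin_add[of \<phi> f "- g"] by simp

lemma lin_single [simp]: "lin \<phi> (single a c) = c * \<phi> a"
  by (simp add: lin_superset[of "{a}"])

lemma lin_fun [simp]:
  "lin (\<lambda>a. \<phi> a + \<eta> a) f = lin \<phi> f + lin \<eta> f"
  "lin (\<lambda>a. \<phi> a - \<eta> a) f = lin \<phi> f - lin \<eta> f"
  "lin (\<lambda>a. - \<phi> a) f = - lin \<phi> f"
  "lin (\<lambda>a. c * \<phi> a) f = c * lin \<phi> f"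
  "lin (\<lambda>a. \<phi> a / c) f = lin \<phi> f / c"
  "lin (\<lambda>a. 0) f = 0"
  by (simp_all add: lin_def algebra_simps sum.distrib sum_subtractf sum_negf
      sum_distrib_left sum_divide_distrib)

lemma lin_cong: "(\<And>a. a \<in> keys f \<Longrightarrow> \<phi> a = \<eta> a) \<Longrightarrow> lin \<phi> f = lin \<eta> f"
  by (auto simp: lin_def)

lemma lin_swap: "lin (\<lambda>a. lin (k a) g) f = lin (\<lambda>b. lin (\<lambda>a. k a b) f) g"
  unfolding lin_def by (simp add: sum_distrib_left, subst sum.swap) (simp add: algebra_simps)

section \<open>The quadratic form of the gcd kernel\<close>

definition gform :: "vec \<Rightarrow> vec \<Rightarrow> real" where
  "gform f g = lin (\<lambda>a. lin (gcd_ker a) g) f"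

lemma gcd_ker_commute: "gcd_ker a b = gcd_ker b a"
  by (simp add: gcd_ker_def gcd.commute mult.commute)

lemma gcd_ker_0 [simp]: "gcd_ker 0 b = 0" "gcd_ker b 0 = 0"
  by (simp_all add: gcd_ker_def)

lemma gcd_ker_self: "0 < a \<Longrightarrow> gcd_ker a a = 1"
  by (simp add: gcd_ker_def power2_eq_square)

lemma gform_commute: "gform f g = gform g f"
  unfolding gform_def by (subst lin_swap) (simp add: gcd_ker_commute)

lemma gform_linear [simp]:
  "gform (f + f') g = gform f g + gform f' g"
  "gform f (g + g') = gform f g + gform f g'"
  "gform (f - f') g = gform f g - gform f' g"
  "gform f (g - g') = gform f g - gform f g'"
  "gform (- f) g = - gform f g"
  "gform f (- g) = - gform f g"
  "gform (c *\<^sub>R f) g = c * gform f g"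
  "gform f (c *\<^sub>R g) = c * gform f g"
  "gform 0 g = 0" "gform f 0 = 0"
  by (simp_all add: gform_def)

lemma gform_single [simp]: "gform (single a c) (single b d) = c * d * gcd_ker a b"
  by (simp add: gform_def)

abbreviation Q :: "vec \<Rightarrow> real" where "Q f \<equiv> gform f f"

lemma Q_nonneg: "0 \<le> Q f"
proof -
  let ?A = "keys f - {0}"
  have "Q f = (\<Sum>a\<in>keys f. \<Sum>b\<in>keys f. lookup f a * lookup f b * gcd_ker a b)"
    by (simp add: gform_def lin_def sum_distrib_left algebra_simps)
  also have "\<dots> = (\<Sum>a\<in>?A. \<Sum>b\<in>?A. lookup f a * lookup f b * gcd_ker a b)"
    by (intro sum.mono_neutral_cong_right ballI) (auto intro!: sum.neutral)
  also have "\<dots> = 12 * (\<Sum>a\<in>?A. \<Sum>b\<in>?A. lookup f a * lookup f b *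
      integral {0..1} (\<lambda>x. psi (real a * x) * psi (real b * x)))"
    unfolding sum_distrib_left by (intro sum.cong refl) (auto simp: integral_psi_nat)
  also have "\<dots> = 12 * (\<Sum>a\<in>?A. \<Sum>b\<in>?A.
      integral {0..1} (\<lambda>x. lookup f a * lookup f b * (psi (real a * x) * psi (real b * x))))"
    by simp
  also have "\<dots> = 12 * integral {0..1} (\<lambda>x. \<Sum>a\<in>?A. \<Sum>b\<in>?A.
      lookup f a * lookup f b * (psi (real a * x) * psi (real b * x)))"
    by (subst integral_sum; simp add: integrable_sum integrable_on_mult_right integrable_psi_mult)+
  also have "(\<lambda>x. \<Sum>a\<in>?A. \<Sum>b\<in>?A. lookup f a * lookup f b * (psi (real a * x) * psi (real b * x)))
      = (\<lambda>x. (\<Sum>a\<in>?A. lookup f a * psi (real a * x))\<^sup>2)"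
    by (simp add: power2_eq_square sum_product algebra_simps)
  also have "0 \<le> 12 * integral {0..1} (\<lambda>x. (\<Sum>a\<in>?A. lookup f a * psi (real a * x))\<^sup>2)"
    \<comment> \<open>A function that is not integrable has integral 0 by convention, so both cases
      give a non-negative value.\<close>
    by (cases "(\<lambda>x. (\<Sum>a\<in>?A. lookup f a * psi (real a * x))\<^sup>2) integrable_on {0..1}")
      (simp_all add: Henstock_Kurzweil_Integration.integral_nonneg not_integrable_integral)
  finally show ?thesis .
qed

section \<open>Dilation, contraction and restriction of vectors\<close>

lift_definition dil :: "nat \<Rightarrow> vec \<Rightarrow> vec" is
  "\<lambda>r f m. if r dvd m then f (m div r) else 0"
proof -
  fix r :: nat and f :: "nat \<Rightarrow> real"
  assume "finite {m. f m \<noteq> 0}"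
  moreover have "{m. (if r dvd m then f (m div r) else 0) \<noteq> 0} \<subseteq> (*) r ` {m. f m \<noteq> 0}"
    by (auto simp: image_iff split: if_splits) (metis dvd_mult_div_cancel)
  ultimately show "finite {m. (if r dvd m then f (m div r) else 0) \<noteq> 0}"
    using finite_surj by blast
qed

text \<open>For r = 0 the bare formula would be a constant function, without finite support; hence
  the guard.\<close>

lift_definition contr :: "nat \<Rightarrow> vec \<Rightarrow> vec" is
  "\<lambda>r f m. if 0 < r then f (r * m) else 0"
proof -
  fix r :: nat and f :: "nat \<Rightarrow> real"
  assume fin: "finite {m. f m \<noteq> 0}"
  have "finite ((*) r -` {m. f m \<noteq> 0})" if "0 < r"
    using that by (intro finite_vimageI fin) (auto intro: inj_onI)
  then show "finite {m. (if 0 < r then f (r * m) else 0) \<noteq> 0}"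
    by (auto simp: vimage_def)
qed

lift_definition restr :: "(nat \<Rightarrow> bool) \<Rightarrow> vec \<Rightarrow> vec" is
  "\<lambda>P f m. if P m then f m else 0"
proof -
  fix P :: "nat \<Rightarrow> bool" and f :: "nat \<Rightarrow> real"
  assume "finite {m. f m \<noteq> 0}"
  then show "finite {m. (if P m then f m else 0) \<noteq> 0}"
    by (rule rev_finite_subset) auto
qed

lemma lookups:
  "lookup (dil r f) m = (if r dvd m then lookup f (m div r) else 0)"
  "0 < r \<Longrightarrow> lookup (contr r f) m = lookup f (r * m)"
  "lookup (restr P f) m = (if P m then lookup f m else 0)"
  by (transfer, simp)+

lemmas vec_lookup = lookups lookup_add lookup_minus lookup_scaleR_real lookup_single

lemma keys_dil: "0 < r \<Longrightarrow> keys (dil r f) = (*) r ` keys f"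
  by (force simp: in_keys_iff lookups image_iff elim!: dvdE split: if_splits)

lemma keys_contr: "0 < r \<Longrightarrow> keys (contr r f) = {m. r * m \<in> keys f}"
  by (auto simp: in_keys_iff lookups)

lemma keys_restr: "keys (restr P f) = {m \<in> keys f. P m}"
  by (auto simp: in_keys_iff lookups split: if_splits)

lemma lin_dil [simp]:
  assumes "0 < r"
  shows "lin \<phi> (dil r f) = lin (\<lambda>a. \<phi> (r * a)) f"
proof -
  have inj: "inj_on ((*) r) (keys f)" using assms by (auto intro: inj_onI)
  show ?thesis
    unfolding lin_def keys_dil[OF assms] sum.reindex[OF inj] using assms by (simp add: lookups)
qed

lemma dil_linear [simp]:
  "dil r (f + g) = dil r f + dil r g" "dil r (f - g) = dil r f - dil r g"
  "dil r (- f) = - dil r f" "dil r (c *\<^sub>R f) = c *\<^sub>R dil r f" "dil r 0 = 0"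
  by (rule poly_mapping_eqI; simp add: vec_lookup)+

lemma dil_dil [simp]:
  assumes "0 < r"
  shows "dil r (dil s f) = dil (r * s) f"
proof (rule poly_mapping_eqI)
  fix m
  show "lookup (dil r (dil s f)) m = lookup (dil (r * s) f) m"
  proof (cases "r dvd m")
    case True
    then obtain t where "m = r * t" ..
    then show ?thesis using assms by (simp add: lookups)
  next
    case False
    then have "\<not> r * s dvd m" using dvd_mult_left by blast
    then show ?thesis using False by (simp add: lookups)
  qed
qed

lemma dil_1 [simp]: "dil (Suc 0) f = f"
  by (rule poly_mapping_eqI) (simp add: lookups)

lemma dil_single [simp]:
  assumes "0 < r"
  shows "dil r (single a c) = single (r * a) c"
proof (rule poly_mapping_eqI)
  fix m
  show "lookup (dil r (single a c)) m = lookup (single (r * a) c) m"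
  proof (cases "r dvd m")
    case True
    then obtain t where "m = r * t" ..
    then show ?thesis using assms by (simp add: vec_lookup when_def)
  next
    case False
    then have "m \<noteq> r * a" by auto
    then show ?thesis using False by (simp add: vec_lookup when_def)
  qed
qed

lemma dil_contr:
  assumes "0 < r" "\<And>a. a \<in> keys f \<Longrightarrow> r dvd a"
  shows "dil r (contr r f) = f"
  using assms by (intro poly_mapping_eqI) (auto simp: lookups in_keys_iff)

lemma gcd_ker_dil [simp]: "0 < r \<Longrightarrow> gcd_ker (r * a) (r * b) = gcd_ker a b"
  by (simp add: gcd_ker_def gcd_mult_distrib_nat[symmetric] power2_eq_square)

lemma gform_dil [simp]: "0 < r \<Longrightarrow> gform (dil r f) (dil r g) = gform f g"
  by (simp add: gform_def)

text \<open>Key 0 is excluded because the kernel vanishes there: a vector supported at 0 would have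
  Q = 0 without being zero.\<close>

definition int_vec :: "vec \<Rightarrow> bool" where
  "int_vec f \<longleftrightarrow> (\<forall>a. lookup f a \<in> \<int>) \<and> 0 \<notin> keys f"

lemma int_vec_intros [intro]:
  "int_vec f \<Longrightarrow> int_vec g \<Longrightarrow> int_vec (f + g)"
  "int_vec f \<Longrightarrow> int_vec g \<Longrightarrow> int_vec (f - g)"
  "int_vec f \<Longrightarrow> int_vec (- f)"
  "int_vec f \<Longrightarrow> int_vec (real p *\<^sub>R f)"
  "int_vec f \<Longrightarrow> int_vec (restr P f)"
  "int_vec f \<Longrightarrow> 0 < r \<Longrightarrow> int_vec (contr r f)"
  "int_vec f \<Longrightarrow> 0 < r \<Longrightarrow> int_vec (dil r f)"
  by (auto simp: int_vec_def vec_lookup in_keys_iff)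

section \<open>The form split at a prime\<close>

definition cop :: "nat \<Rightarrow> vec \<Rightarrow> bool" where
  "cop p f \<longleftrightarrow> (\<forall>a\<in>keys f. \<not> p dvd a)"

text \<open>A prime that does not divide a leaves the gcd unchanged and only enlarges the
  denominator.\<close>

lemma gform_dil_prime:
  assumes "prime p" "cop p x"
  shows "gform x (dil p y) = gform x y / real p"
proof -
  have "gform x (dil p y) = lin (\<lambda>a. lin (\<lambda>b. gcd_ker a (p * b)) y) x"
    using assms(1) by (simp add: gform_def prime_gt_0_nat)
  also have "\<dots> = lin (\<lambda>a. lin (\<lambda>b. gcd_ker a b / real p) y) x"
  proof (intro lin_cong)
    fix a b assume "a \<in> keys x"
    then have "coprime a p"
      using assms by (metis cop_def coprime_commute prime_imp_coprime)
    then have "gcd a (p * b) = gcd a b"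
      by (simp add: gcd_mult_right_left_cancel)
    then show "gcd_ker a (p * b) = gcd_ker a b / real p"
      by (simp add: gcd_ker_def)
  qed
  finally show ?thesis by (simp add: gform_def)
qed

text \<open>The exponent of p in a is at most k, so \<open>p ^ k\<close> already contributes all of
  it to the gcd.\<close>

lemma gcd_prime_power_mult:
  fixes a b p :: nat
  assumes "prime p" "\<not> p ^ Suc k dvd a" "\<not> p dvd b"
  shows "gcd a (p ^ Suc k * b) = gcd a (p ^ k * b)"
proof -
  have "a \<noteq> 0" using assms(2) by (metis dvd_0_right)
  then obtain c where c: "a = p ^ multiplicity p a * c" "\<not> p dvd c"
    using assms(1) multiplicity_decompose'[of a p] by (metis not_prime_unit)
  define i where "i = multiplicity p a"
  have a: "a = p ^ i * c" using c(1) by (simp add: i_def)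
  have "i < Suc k"
  proof (rule ccontr)
    assume "\<not> i < Suc k"
    then have "p ^ Suc k dvd p ^ i" by (intro le_imp_power_dvd) simp
    then show False using assms(2) a by (metis dvd_mult2)
  qed
  then have ik: "i \<le> k" by simp
  have gen: "gcd a (p ^ l * b) = p ^ i * gcd c b" if "i \<le> l" for l
  proof -
    have "p ^ l = p ^ i * p ^ (l - i)" using that by (simp flip: power_add)
    then have "gcd a (p ^ l * b) = p ^ i * gcd c (p ^ (l - i) * b)"
      by (simp add: a gcd_mult_distrib_nat mult.assoc)
    also have "coprime c (p ^ (l - i))"
      using prime_imp_coprime[OF assms(1) c(2)] by (simp add: coprime_commute)
    then have "gcd c (p ^ (l - i) * b) = gcd c b"
      by (simp add: gcd_mult_right_left_cancel)
    finally show ?thesis .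
  qed
  show ?thesis using gen[of k] gen[of "Suc k"] ik by simp
qed

lemma gform_dil_prime_power:
  assumes "prime p" "\<And>a. a \<in> keys h \<Longrightarrow> \<not> p ^ Suc k dvd a" "cop p y"
  shows "gform h (dil (p ^ Suc k) y) = gform h (dil (p ^ k) y) / real p"
proof -
  have pos: "0 < p" using assms(1) by (rule prime_gt_0_nat)
  have "gform h (dil (p ^ Suc k) y) = lin (\<lambda>a. lin (\<lambda>b. gcd_ker a (p ^ Suc k * b)) y) h"
    using pos by (simp add: gform_def)
  also have "\<dots> = lin (\<lambda>a. lin (\<lambda>b. gcd_ker a (p ^ k * b) / real p) y) h"
  proof (intro lin_cong)
    fix a b assume "a \<in> keys h" "b \<in> keys y"
    then have "gcd a (p ^ Suc k * b) = gcd a (p ^ k * b)"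
      using assms by (intro gcd_prime_power_mult) (auto simp: cop_def)
    then show "gcd_ker a (p ^ Suc k * b) = gcd_ker a (p ^ k * b) / real p"
      by (simp add: gcd_ker_def)
  qed
  also have "\<dots> = gform h (dil (p ^ k) y) / real p"
    using pos by (simp add: gform_def)
  finally show ?thesis .
qed

text \<open>Against multiples of p, the lowest level x pairs like x/p moved up one level. Replacing
  x by this projection keeps the cross term, and the square loses exactly (1 - 1/p^2) Q x.\<close>

lemma Q_bottom:
  assumes "prime p" "cop p x"
  shows "Q (x + dil p g) = (1 - 1 / (real p)\<^sup>2) * Q x + Q (g + (1 / real p) *\<^sub>R x)"
  using assms prime_gt_0_nat[OF assms(1)]
  by (simp add: gform_dil_prime gform_commute[of "dil p g" x] gform_commute[of g x]
      power2_eq_square algebra_simps)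

text \<open>Mirror image of \<open>Q_bottom\<close>: the highest level is replaced by 1/p times
  itself, moved down one level.\<close>

lemma Q_top:
  assumes "prime p" "\<And>a. a \<in> keys h \<Longrightarrow> \<not> p ^ Suc k dvd a" "cop p y"
  shows "Q (h + dil (p ^ Suc k) y)
      = (1 - 1 / (real p)\<^sup>2) * Q y + Q (h + (1 / real p) *\<^sub>R dil (p ^ k) y)"
proof -
  have pos: "0 < p" using assms(1) by (rule prime_gt_0_nat)
  have "Q (h + dil (p ^ Suc k) y) = Q h + 2 * gform h (dil (p ^ Suc k) y) + Q y"
    using pos gform_commute[of "dil (p ^ Suc k) y" h] gform_dil[of "p ^ Suc k" y y]
    by (simp del: gform_dil power_Suc)
  also have "\<dots> = Q h + 2 * (gform h (dil (p ^ k) y) / real p) + Q y"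
    using gform_dil_prime_power[OF assms] by simp
  also have "\<dots> = (1 - 1 / (real p)\<^sup>2) * Q y + Q (h + (1 / real p) *\<^sub>R dil (p ^ k) y)"
    using pos gform_commute[of "dil (p ^ k) y" h]
    by (simp add: power2_eq_square algebra_simps)
  finally show ?thesis .
qed

lemma Q_one_level:
  assumes "prime p" "cop p x"
  shows "Q (x + dil p y) = (1 - 1 / real p) * (Q x + Q y) + Q (x + y) / real p"
  using assms prime_gt_0_nat[OF assms(1)]
  by (simp add: gform_dil_prime gform_commute[of "dil p y" x] gform_commute[of y x]
      add_divide_distrib algebra_simps)

text \<open>The factor s accounts for the prime powers divided out of a part. Strictness of the
  inclusion makes the number of keys drop, which drives the induction.\<close>

definition part :: "vec \<Rightarrow> vec \<Rightarrow> bool" where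
  "part x f \<longleftrightarrow> (\<exists>s>0. (*) s ` keys x \<subset> keys f)"

lemma part_card: "part x f \<Longrightarrow> card (keys x) < card (keys f)"
proof -
  assume "part x f"
  then obtain s where s: "0 < s" "(*) s ` keys x \<subset> keys f" by (auto simp: part_def)
  have "inj_on ((*) s) (keys x)" using s(1) by (auto intro: inj_onI)
  then show ?thesis using psubset_card_mono[OF _ s(2)] by (simp add: card_image)
qed

definition active :: "nat \<Rightarrow> vec \<Rightarrow> bool" where
  "active p f \<longleftrightarrow> (\<exists>a\<in>keys f. \<exists>b\<in>keys f. multiplicity p a \<noteq> multiplicity p b)"

text \<open>In case \<open>more\<close> both extreme levels are peeled off, by
  \<open>Q_bottom\<close> and \<open>Q_top\<close>. The last clause describes a vanishing remainder
  w: if there is a single level in between, that level equals -(x + y)/p; otherwise x has to cancel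
  against the level next to it, so x is p times an integral vector.\<close>

lemma prime_split:
  assumes f: "int_vec f" and p: "prime p" and act: "active p f"
  obtains
    (one) r x y where "0 < r" "f = dil r (x + dil p y)" "int_vec x" "int_vec y"
      "cop p x" "cop p y" "x \<noteq> 0" "y \<noteq> 0" "part x f" "part y f"
      "Q f = (1 - 1 / real p) * (Q x + Q y) + Q (x + y) / real p"
  | (more) r x y w g where "0 < r" "f = dil r (x + dil p g)" "int_vec x" "int_vec y"
      "int_vec g" "int_vec (real p *\<^sub>R w)"
      "cop p x" "cop p y" "x \<noteq> 0" "y \<noteq> 0" "part x f" "part y f"
      "Q f = (1 - 1 / (real p)\<^sup>2) * (Q x + Q y) + Q w"
      "w = 0 \<Longrightarrow> (\<exists>z. int_vec z \<and> x = real p *\<^sub>R z)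
          \<or> (\<exists>z. int_vec z \<and> g = z + dil p y \<and> x + y = - (real p *\<^sub>R z))"
proof -
  have p1: "1 < p" and p0: "0 < p" using p prime_gt_1_nat by (auto simp: prime_gt_0_nat)
  have key0: "a \<noteq> 0" if "a \<in> keys f" for a using f that by (metis int_vec_def)
  have dvd_iff: "p ^ n dvd a \<longleftrightarrow> n \<le> multiplicity p a" if "a \<noteq> 0" for n a
    using that p1 by (intro power_dvd_iff_le_multiplicity) auto
  obtain a b where ab: "a \<in> keys f" "b \<in> keys f" "multiplicity p a < multiplicity p b"
    using act unfolding active_def by (metis linorder_neqE_nat)
  \<comment> \<open>The lowest exponent of p on f; dividing \<open>p ^ i\<close> out leaves a lowest
    level coprime to p.\<close>
  define i where "i = Min (multiplicity p ` keys f)"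
  have i_le: "i \<le> multiplicity p c" if "c \<in> keys f" for c
    using that by (auto simp: i_def)
  have "i \<in> multiplicity p ` keys f"
    unfolding i_def using ab by (intro Min_in) auto
  then obtain a0 where a0: "a0 \<in> keys f" "multiplicity p a0 = i" by auto
  define r where "r = p ^ i"
  have r: "0 < r" using p0 by (simp add: r_def)
  define f' where "f' = contr r f"
  have f_eq: "f = dil r f'"
    unfolding f'_def using r i_le key0 by (intro dil_contr[symmetric]) (auto simp: r_def dvd_iff)
  have f': "int_vec f'" using f r by (auto simp: f'_def)
  have key0': "c \<noteq> 0" if "c \<in> keys f'" for c using f' that by (metis int_vec_def)
  have keys_f: "keys f = (*) r ` keys f'" using f_eq keys_dil[OF r] by metis
  have mult: "multiplicity p (r * c) = i + multiplicity p c" if "c \<noteq> 0" for c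
    using that p r by (simp add: r_def prime_elem_multiplicity_mult_distrib
        multiplicity_same_power)
  obtain a' where a': "a' \<in> keys f'" "\<not> p dvd a'"
  proof -
    obtain c where c: "c \<in> keys f'" "a0 = r * c" using a0(1) keys_f by auto
    then have "multiplicity p c = 0" using mult[of c] key0'[of c] a0(2) by simp
    then show ?thesis using that[of c] c dvd_iff[of c 1] key0'[of c] by auto
  qed
  obtain b' where b': "b' \<in> keys f'" "p dvd b'"
  proof -
    obtain c where c: "c \<in> keys f'" "b = r * c" using ab(2) keys_f by auto
    then have "0 < multiplicity p c"
      using mult[of c] key0'[of c] ab(3) i_le[OF ab(1)] by simp
    then show ?thesis using that[of c] c dvd_iff[of c 1] key0'[of c] by auto
  qed
  \<comment> \<open>The highest exponent left after that division; k = 1 is the case of two adjacent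
    levels.\<close>
  define k where "k = Max (multiplicity p ` keys f')"
  have k_ge: "multiplicity p c \<le> k" if "c \<in> keys f'" for c
    using that by (auto simp: k_def)
  have "k \<in> multiplicity p ` keys f'"
    unfolding k_def using a' by (intro Max_in) auto
  then obtain c0 where c0: "c0 \<in> keys f'" "multiplicity p c0 = k" by auto
  have "1 \<le> k" using k_ge[OF b'(1)] dvd_iff[of b' 1] b' key0'[of b'] by simp
  define x where "x = restr (\<lambda>a. \<not> p dvd a) f'"
  define g where "g = contr p f'"
  have f'_eq: "f' = x + dil p g"
    by (rule poly_mapping_eqI) (auto simp: x_def g_def vec_lookup p0)
  have x: "int_vec x" "cop p x" "x \<noteq> 0"
    using f' a' by (auto simp: x_def cop_def keys_restr lookups in_keys_iff poly_mapping_eq_iff fun_eq_iff)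
  have g: "int_vec g" using f' p0 by (auto simp: g_def)
  have "part x f"
    unfolding part_def
  proof (intro exI conjI)
    have "(*) r ` keys x \<subseteq> keys f" by (auto simp: keys_f x_def keys_restr)
    moreover have "r * b' \<notin> (*) r ` keys x" using r b' by (auto simp: x_def keys_restr)
    moreover have "r * b' \<in> keys f" unfolding keys_f by (rule imageI[OF b'(1)])
    ultimately show "(*) r ` keys x \<subset> keys f" by blast
  qed (rule r)
  \<comment> \<open>The exponent is k - 1 because one factor p is already gone in g.\<close>
  define y where "y = contr (p ^ (k - 1)) g"
  have pk: "p ^ k = p * p ^ (k - 1)" using \<open>1 \<le> k\<close> by (simp flip: power_Suc)
  have y_lookup: "lookup y c = lookup f' (p ^ k * c)" for c
    using p0 by (simp add: y_def g_def lookups pk mult.assoc)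
  have y_keys: "c \<in> keys y \<longleftrightarrow> p ^ k * c \<in> keys f'" for c
    by (simp add: in_keys_iff y_lookup)
  have y: "int_vec y" using g p0 by (auto simp: y_def)
  have "cop p y"
    unfolding cop_def
  proof (intro ballI notI)
    fix c assume c: "c \<in> keys y" "p dvd c"
    then have "p ^ Suc k dvd p ^ k * c" by (simp add: mult.commute)
    then show False
      using c(1) k_ge[of "p ^ k * c"] dvd_iff[of "p ^ k * c" "Suc k"] key0'[of "p ^ k * c"]
      by (auto simp: y_keys)
  qed
  have "p ^ k dvd c0" using c0 dvd_iff[of c0 k] key0'[of c0] by simp
  then obtain c1 where "c0 = p ^ k * c1" by auto
  then have "c1 \<in> keys y" using c0 by (simp add: y_keys)
  then have "y \<noteq> 0" by auto
  have "part y f"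
    unfolding part_def
  proof (intro exI conjI)
    show "0 < r * p ^ k" using r p0 by simp
    have "(*) (r * p ^ k) ` keys y \<subseteq> keys f"
      by (auto simp: keys_f y_keys mult.assoc)
    moreover have "r * a' \<notin> (*) (r * p ^ k) ` keys y"
    proof
      assume "r * a' \<in> (*) (r * p ^ k) ` keys y"
      then have "p ^ k dvd a'" using r by (auto simp: mult.assoc)
      then show False using a'(2) pk dvd_mult_left by metis
    qed
    moreover have "r * a' \<in> keys f" unfolding keys_f by (rule imageI[OF a'(1)])
    ultimately show "(*) (r * p ^ k) ` keys y \<subset> keys f" by blast
  qed
  have Qf: "Q f = Q f'" using f_eq r by (metis gform_dil)
  show ?thesis
  proof (cases "k = 1")
    case True
    then have yg: "y = g" by (auto simp: y_def intro!: poly_mapping_eqI simp: lookups)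
    show ?thesis
    proof (rule one[of r x y])
      show "Q f = (1 - 1 / real p) * (Q x + Q y) + Q (x + y) / real p"
        unfolding Qf yg by (simp only: f'_eq Q_one_level[OF p x(2)])
    qed (use r f_eq f'_eq yg x y \<open>cop p y\<close> \<open>y \<noteq> 0\<close> \<open>part x f\<close> \<open>part y f\<close> in auto)
  next
    case False
    then obtain j where j: "k = Suc (Suc j)" using \<open>1 \<le> k\<close>
      by (metis One_nat_def Suc_le_D not0_implies_Suc)
    define h where "h = restr (\<lambda>a. \<not> p ^ Suc j dvd a) g"
    have g_eq: "g = h + dil (p ^ Suc j) y"
      by (rule poly_mapping_eqI) (auto simp: h_def y_def vec_lookup j p0)
    have h: "int_vec h" using g by (auto simp: h_def)
    \<comment> \<open>The intermediate levels h, with the projections of both extreme levels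
      added.\<close>
    define w where "w = h + (1 / real p) *\<^sub>R x + (1 / real p) *\<^sub>R dil (p ^ j) y"
    have "Q f = (1 - 1 / (real p)\<^sup>2) * Q x + Q (g + (1 / real p) *\<^sub>R x)"
      unfolding Qf by (simp only: f'_eq Q_bottom[OF p x(2)])
    also have "g + (1 / real p) *\<^sub>R x = (h + (1 / real p) *\<^sub>R x) + dil (p ^ Suc j) y"
      by (subst g_eq) (simp add: algebra_simps)
    also have "Q \<dots> = (1 - 1 / (real p)\<^sup>2) * Q y + Q w"
      unfolding w_def
    proof (rule Q_top[OF p _ \<open>cop p y\<close>])
      fix c assume "c \<in> keys (h + (1 / real p) *\<^sub>R x)"
      then have "c \<in> keys h \<or> c \<in> keys x" by (auto simp: in_keys_iff vec_lookup)
      then show "\<not> p ^ Suc j dvd c"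
        using x(2) by (auto simp: h_def keys_restr cop_def dest: dvd_mult_left)
    qed
    finally have Q: "Q f = (1 - 1 / (real p)\<^sup>2) * (Q x + Q y) + Q w"
      by (simp add: distrib_left)
    have "real p *\<^sub>R w = real p *\<^sub>R h + x + dil (p ^ j) y"
      using p0 by (simp add: w_def algebra_simps)
    then have w: "int_vec (real p *\<^sub>R w)" using h x y p0 by (auto intro!: int_vec_intros)
    have w0: "(\<exists>z. int_vec z \<and> x = real p *\<^sub>R z)
          \<or> (\<exists>z. int_vec z \<and> g = z + dil p y \<and> x + y = - (real p *\<^sub>R z))" if "w = 0"
    \<comment> \<open>For j = 0 both projections land on the same level. Otherwise the projection of
      y has no keys coprime to p, so x is cancelled by h alone.\<close>
    proof (cases j)
      case 0
      have "real p *\<^sub>R h + (x + y) = 0"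
        using \<open>real p *\<^sub>R w = real p *\<^sub>R h + x + dil (p ^ j) y\<close> that 0 by (simp add: add.assoc)
      then have "x + y = - (real p *\<^sub>R h)" by (metis add.commute eq_neg_iff_add_eq_0)
      then show ?thesis using h g_eq 0 by auto
    next
      case (Suc j')
      have "x = real p *\<^sub>R (- restr (\<lambda>a. \<not> p dvd a) h)"
      proof (rule poly_mapping_eqI)
        fix c
        show "lookup x c = lookup (real p *\<^sub>R (- restr (\<lambda>a. \<not> p dvd a) h)) c"
        proof (cases "p dvd c")
          case True
          then show ?thesis by (simp add: x_def vec_lookup)
        next
          case False
          then have "\<not> p ^ j dvd c" using Suc by (auto dest: dvd_mult_left)
          then have "0 = lookup h c + lookup x c / real p"
            using arg_cong[OF \<open>w = 0\<close>, of "\<lambda>v. lookup v c"] by (simp add: w_def vec_lookup)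
          then show ?thesis using False p0 by (simp add: vec_lookup field_simps)
        qed
      qed
      then show ?thesis using h by blast
    qed
    show ?thesis
      using more[of r x g y w] r f_eq f'_eq x y g w Q w0 \<open>cop p y\<close> \<open>y \<noteq> 0\<close> \<open>part x f\<close> \<open>part y f\<close>
      by auto
  qed
qed

section \<open>Vectors of small norm\<close>


declare gform_linear [simp del]

lemma int_vec_singletonE:
  assumes "int_vec f" "f \<noteq> 0" "keys f \<subseteq> {m}"
  obtains c where "f = single m c" "c \<in> \<int>" "c \<noteq> 0" "0 < m"
proof (rule that)
  show f: "f = single m (lookup f m)"
    using assms(3) by (intro poly_mapping_eqI) (auto simp: lookup_single when_def in_keys_iff)
  show "lookup f m \<in> \<int>" using assms(1) by (simp add: int_vec_def)
  show "lookup f m \<noteq> 0" using assms(2) f by (metis single_zero)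
  then have "m \<in> keys f" by (simp add: in_keys_iff)
  then show "0 < m" using assms(1) by (cases m) (auto simp: int_vec_def)
qed

lemma Ints_square_ge_1: "c \<in> \<int> \<Longrightarrow> c \<noteq> 0 \<Longrightarrow> 1 \<le> (c::real)\<^sup>2"
proof (elim Ints_cases)
  fix k :: int assume "c = of_int k" "c \<noteq> 0"
  then have "1 \<le> \<bar>k\<bar>" by simp
  then have "1 \<le> k\<^sup>2" by (metis one_le_power power2_abs)
  then show "1 \<le> c\<^sup>2" using \<open>c = of_int k\<close> by (metis of_int_1_le_iff of_int_power)
qed

lemma Ints_square_less_4:
  assumes "c \<in> \<int>" "c \<noteq> 0" "(c::real)\<^sup>2 < 4"
  shows "c = 1 \<or> c = -1"
proof -
  obtain k :: int where k: "c = of_int k" using assms(1) by (elim Ints_cases)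
  have "\<bar>c\<bar> < 2" using assms(3) by (intro power2_less_imp_less[of "\<bar>c\<bar>" 2]) auto
  then have "\<bar>k\<bar> < 2" by (simp add: k)
  then have "k = 1 \<or> k = -1" using assms(2) k by auto
  then show ?thesis using k by auto
qed

text \<open>The factors 1 - 1/p and 1 - 1/p^2 grow with p, so the smallest admissible prime q gives
  a bound for all.\<close>

lemma split_bound_mono:
  assumes "0 < q" "q \<le> p" "0 \<le> s" "s \<le> S"
  shows "F = (1 - 1 / real p) * S + t \<Longrightarrow> (1 - 1 / real q) * s + t \<le> F"
    and "F = (1 - 1 / (real p)\<^sup>2) * S + t \<Longrightarrow> (1 - 1 / (real q)\<^sup>2) * s + t \<le> F"
proof -
  have le: "1 / real p \<le> 1 / real q" "1 / real p \<le> 1"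
    using assms(1,2) by (auto simp: field_simps)
  have "(1 - 1 / real q) * s \<le> (1 - 1 / real p) * S"
    using assms le by (intro mult_mono) auto
  then show "F = (1 - 1 / real p) * S + t \<Longrightarrow> (1 - 1 / real q) * s + t \<le> F" by simp
  have "(1 / real p)\<^sup>2 \<le> (1 / real q)\<^sup>2" "(1 / real p)\<^sup>2 \<le> 1"
    using le by (auto intro!: power_mono power_le_one simp del: power_divide)
  then have "(1 - 1 / (real q)\<^sup>2) * s \<le> (1 - 1 / (real p)\<^sup>2) * S"
    using assms by (intro mult_mono) (auto simp: power_divide)
  then show "F = (1 - 1 / (real p)\<^sup>2) * S + t \<Longrightarrow> (1 - 1 / (real q)\<^sup>2) * s + t \<le> F" by simp
qed

lemma ex_active_prime:
  assumes "int_vec f" "a \<in> keys f" "b \<in> keys f" "a \<noteq> b"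
  obtains p where "prime p" "active p f"
proof -
  have "a \<noteq> 0" "b \<noteq> 0" using assms by (metis int_vec_def)+
  have "\<exists>p. prime p \<and> multiplicity p a \<noteq> multiplicity p b"
    using multiplicity_eq_nat[of a b] \<open>a \<noteq> 0\<close> \<open>b \<noteq> 0\<close> assms(4) by blast
  then show ?thesis using that assms by (auto simp: active_def)
qed

text \<open>Two non-zero parts, each with fewer keys, leave at least 2 (1 - 1/2) = 1 after splitting
  at any prime. A single key contributes the square of a non-zero integer.\<close>

lemma Q_ge_1:
  assumes "int_vec f" "f \<noteq> 0"
  shows "1 \<le> Q f"
  using assms
proof (induction "card (keys f)" arbitrary: f rule: less_induct)
  case less
  have IH: "1 \<le> Q x" if "int_vec x" "x \<noteq> 0" "part x f" for x
    using less.hyps[of x] that part_card by blast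
  show ?case
  proof (cases "\<exists>a\<in>keys f. \<exists>b\<in>keys f. a \<noteq> b")
    case False
    obtain m where m: "m \<in> keys f" using less.prems by (metis equals0I keys_eq_empty)
    then have "keys f \<subseteq> {m}" using False by auto
    with less.prems obtain c where c: "f = single m c" "c \<in> \<int>" "c \<noteq> 0" "0 < m"
      by (rule int_vec_singletonE)
    then have "Q f = c\<^sup>2" by (simp add: gcd_ker_self power2_eq_square)
    then show ?thesis using c by (simp add: Ints_square_ge_1)
  next
    case True
    then obtain p where p: "prime p" "active p f" using less.prems(1) ex_active_prime by metis
    have p2: "2 \<le> p" using p(1) by (rule prime_ge_2_nat)
    from less.prems(1) p show ?thesis
    proof (cases rule: prime_split)
      case (one r x y)
      then have "2 \<le> Q x + Q y" using IH[of x] IH[of y] by auto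
      from split_bound_mono(1)[OF _ p2 _ this one(11)]
      have "1 + Q (x + y) / real p \<le> Q f" by simp
      moreover have "0 \<le> Q (x + y) / real p" using Q_nonneg by (intro divide_nonneg_nonneg) auto
      ultimately show ?thesis by linarith
    next
      case (more r x y w g)
      then have "2 \<le> Q x + Q y" using IH[of x] IH[of y] by auto
      from split_bound_mono(2)[OF _ p2 _ this more(13)]
      have "3 / 2 + Q w \<le> Q f" by (simp add: power2_eq_square)
      then show ?thesis using Q_nonneg[of w] by linarith
    qed
  qed
qed

lemma Q_less_1: "int_vec f \<Longrightarrow> Q f < 1 \<Longrightarrow> f = 0"
  using Q_ge_1 by (metis not_less)

lemma Q_scaled_ge:
  assumes "int_vec (real p *\<^sub>R w)" "w \<noteq> 0" "0 < p"
  shows "1 / (real p)\<^sup>2 \<le> Q w"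
proof -
  have "1 \<le> Q (real p *\<^sub>R w)" using assms by (intro Q_ge_1) auto
  also have "Q (real p *\<^sub>R w) = (real p)\<^sup>2 * Q w"
    by (simp only: gform_linear power2_eq_square mult.assoc)
  finally show ?thesis using assms(3) by (simp add: divide_le_eq mult.commute)
qed

section \<open>Small norms on powers of two, up to sign and dilation\<close>

abbreviation e :: "nat \<Rightarrow> vec" where "e a \<equiv> single a 1"

text \<open>Sign change and dilation preserve Q. The representatives u used below have 1 among their
  keys, so integral dilations suffice.\<close>

definition similar :: "vec \<Rightarrow> vec \<Rightarrow> bool" where
  "similar f u \<longleftrightarrow> (\<exists>r>0. f = dil r u \<or> f = - dil r u)"

lemma similarE:
  assumes "similar f u"
  obtains r \<epsilon> where "0 < r" "\<epsilon> = 1 \<or> \<epsilon> = -1" "f = \<epsilon> *\<^sub>R dil r u"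
proof -
  from assms obtain r where "0 < r" "f = dil r u \<or> f = - dil r u"
    unfolding similar_def by blast
  then show ?thesis using that[of r 1] that[of r "-1"] by auto
qed

lemma similarI:
  assumes "0 < r" "c = 1 \<or> c = -1" "f = c *\<^sub>R dil r u"
  shows "similar f u"
proof -
  have "f = dil r u \<or> f = - dil r u"
    using assms(2)
  proof
    assume "c = 1"
    then show ?thesis using assms(3) scaleR_one[of "dil r u"] by blast
  next
    assume "c = -1"
    then show ?thesis using assms(3) scaleR_minus1_left[of "dil r u"] by blast
  qed
  with assms(1) show ?thesis unfolding similar_def by blast
qed

lemma Q_similar:
  assumes "similar f u"
  shows "Q f = Q u"
proof -
  obtain r where "0 < r" "f = dil r u \<or> f = - dil r u"
    using assms unfolding similar_def by blast
  then show ?thesis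
    by (metis gform_dil gform_linear(5,6) minus_minus)
qed

definition pow2 :: "vec \<Rightarrow> bool" where
  "pow2 f \<longleftrightarrow> (\<forall>a\<in>keys f. \<exists>i. a = 2 ^ i)"

lemma partE:
  assumes "part x f"
  obtains s where "0 < s" "\<And>a. a \<in> keys x \<Longrightarrow> s * a \<in> keys f"
  using assms unfolding part_def psubset_eq image_subset_iff by blast

lemma part_cop:
  assumes "part x f" "cop q f"
  shows "cop q x"
  unfolding cop_def
proof (intro ballI notI)
  fix a assume "a \<in> keys x" "q dvd a"
  then obtain s where "s * a \<in> keys f" "q dvd s * a" using assms(1) by (elim partE) auto
  then show False using assms(2) by (simp add: cop_def)
qed

lemma part_pow2:
  assumes "part x f" "pow2 f"
  shows "pow2 x"
  unfolding pow2_def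
proof
  fix a assume "a \<in> keys x"
  then obtain s where "s * a \<in> keys f" using assms(1) by (elim partE) auto
  then obtain i where "s * a = 2 ^ i" using assms(2) unfolding pow2_def by blast
  then have "a dvd 2 ^ i" by (metis dvd_triv_right)
  then show "\<exists>i. a = 2 ^ i" using divides_primepow_nat[OF two_is_prime_nat] by blast
qed

lemma pow2_copE:
  assumes "int_vec f" "f \<noteq> 0" "pow2 f" "cop 2 f"
  obtains c where "f = single 1 c" "c \<in> \<int>" "c \<noteq> 0"
proof -
  have "keys f \<subseteq> {1}"
  proof
    fix a assume a: "a \<in> keys f"
    then obtain i where "a = 2 ^ i" using assms(3) unfolding pow2_def by blast
    moreover have "\<not> 2 dvd a" using a assms(4) by (simp add: cop_def)
    ultimately show "a \<in> {1}" by (cases i) auto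
  qed
  with assms(1,2) show ?thesis using that by (elim int_vec_singletonE)
qed

lemma pow2_not_activeE:
  assumes "int_vec f" "f \<noteq> 0" "pow2 f" "\<not> active 2 f"
  obtains m c where "f = single m c" "c \<in> \<int>" "c \<noteq> 0" "0 < m"
proof -
  obtain m where m: "m \<in> keys f" using assms(2) by (metis equals0I keys_eq_empty)
  have "keys f \<subseteq> {m}"
  proof
    fix a assume a: "a \<in> keys f"
    obtain i where i: "a = 2 ^ i" using a assms(3) unfolding pow2_def by blast
    obtain j where j: "m = 2 ^ j" using m assms(3) unfolding pow2_def by blast
    have "multiplicity 2 a = multiplicity 2 m" using a m assms(4) unfolding active_def by blast
    then have "i = j" by (simp add: i j multiplicity_same_power)
    then show "a \<in> {m}" by (simp add: i j)
  qed
  with assms(1,2) show ?thesis using that by (elim int_vec_singletonE)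
qed

lemma Q_single_one: "Q (single 1 c) = c\<^sup>2"
  by (simp add: gcd_ker_self power2_eq_square)

definition low_norm :: "vec set" where
  "low_norm = {e 1, e 1 - e 2}"

text \<open>With \<open>low_norm\<close> these represent, up to similarity, all non-zero integral
  vectors on powers of two with Q below 7/4; the values of Q are 1 and 3/2.\<close>

definition mid_norm :: "vec set" where
  "mid_norm = {e 1 - e 4, e 1 - e 2 + e 4}"

text \<open>A part coprime to 2 is a multiple of \<open>e 1\<close> here, so everything reduces to
  two integers c and d. The threshold is 7/4 = 3/2 + 1/4: the lowest and highest parts cost at least
  2 (1 - 1/4), and a non-zero w with 2w integral costs another 1/4.\<close>

lemma pow2_classification:
  assumes f: "int_vec f" "pow2 f" "f \<noteq> 0" and Q: "Q f < 7 / 4"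
  obtains u where "u \<in> low_norm \<union> mid_norm" "similar f u"
proof (cases "active 2 f")
  case False
  with f(1,3,2) obtain m c where m: "f = single m c" "c \<in> \<int>" "c \<noteq> 0" "0 < m"
    by (rule pow2_not_activeE)
  then have "Q f = c\<^sup>2" by (simp add: gcd_ker_self power2_eq_square)
  then have c: "c = 1 \<or> c = -1" using Q m by (intro Ints_square_less_4) auto
  have "f = c *\<^sub>R dil m (e 1)"
    using m(1,4) by (intro poly_mapping_eqI) (simp add: lookup_scaleR_real lookup_single when_def)
  with m(4) c have "similar f (e 1)" by (rule similarI)
  then show ?thesis by (rule that[rotated]) (simp add: low_norm_def)
next
  case True
  have scale: "single a c = c *\<^sub>R e a" for a :: nat and c :: real
    by (rule poly_mapping_eqI) (simp add: vec_lookup when_def)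
  from f(1) two_is_prime_nat True show ?thesis
  proof (cases rule: prime_split)
    case (one r x y)
    obtain c where x: "x = single 1 c" and c_int: "c \<in> \<int>" "c \<noteq> 0"
      using pow2_copE[OF one(3,7) part_pow2[OF one(9) f(2)] one(5)] .
    obtain d where y: "y = single 1 d" and d_int: "d \<in> \<int>" "d \<noteq> 0"
      using pow2_copE[OF one(4,8) part_pow2[OF one(10) f(2)] one(6)] .
    define C where "C = (c + d)\<^sup>2"
    have Qf: "2 * Q f = c\<^sup>2 + d\<^sup>2 + C"
      unfolding C_def
      using one(11) by (simp add: x y Q_single_one[unfolded One_nat_def] single_add[symmetric]
          del: gform_single)
    have ge: "1 \<le> c\<^sup>2" "1 \<le> d\<^sup>2" using c_int d_int Ints_square_ge_1 by auto
    have C: "0 \<le> C" by (simp add: C_def)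
    have "c\<^sup>2 < 4" "d\<^sup>2 < 4" using Qf Q ge C by linarith+
    then have c: "c = 1 \<or> c = -1" and d: "d = 1 \<or> d = -1"
      using Ints_square_less_4 c_int d_int by blast+
    \<comment> \<open>Equality would make 2 Q f at least 1 + 1 + 4 = 6.\<close>
    have "C \<noteq> 4" using Qf Q ge by auto
    then have "c + d \<noteq> 2" "c + d \<noteq> -2" by (auto simp: C_def)
    then have "d = - c" using c d by auto
    then have "x + dil 2 y = c *\<^sub>R (e 1 - e 2)"
      by (simp add: x y scale[of _ c] scale[of _ "-c"] algebra_simps numeral_eq_Suc)
    then have "f = c *\<^sub>R dil r (e 1 - e 2)" using one(2) by (metis dil_linear(4))
    from similarI[OF one(1) c this] show ?thesis by (rule that[rotated]) (simp add: low_norm_def)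
  next
    case (more r x y w g)
    obtain c where x: "x = single 1 c" and c_int: "c \<in> \<int>" "c \<noteq> 0"
      using pow2_copE[OF more(3,9) part_pow2[OF more(11) f(2)] more(7)] .
    obtain d where y: "y = single 1 d" and d_int: "d \<in> \<int>" "d \<noteq> 0"
      using pow2_copE[OF more(4,10) part_pow2[OF more(12) f(2)] more(8)] .
    have Qf: "4 * Q f = 3 * c\<^sup>2 + 3 * d\<^sup>2 + 4 * Q w"
      using more(13) by (simp add: x y Q_single_one[unfolded One_nat_def] del: gform_single)
    have ge: "1 \<le> c\<^sup>2" "1 \<le> d\<^sup>2" "0 \<le> Q w" using c_int d_int Ints_square_ge_1 Q_nonneg by auto
    have "c\<^sup>2 < 4" "d\<^sup>2 < 4" using Qf Q ge by linarith+
    then have c: "c = 1 \<or> c = -1" and d: "d = 1 \<or> d = -1"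
      using Ints_square_less_4 c_int d_int by blast+
    have "w = 0"
    proof (rule ccontr)
      assume "w \<noteq> 0"
      then have "1 / (real 2)\<^sup>2 \<le> Q w" using more(6) by (intro Q_scaled_ge) auto
      then have "1 / 4 \<le> Q w" by simp
      then show False using Qf Q ge by linarith
    qed
    from more(14)[OF this] show ?thesis
    proof (elim disjE exE conjE)
      fix z assume z: "int_vec z" "x = real 2 *\<^sub>R z"
      then have "c = 2 * lookup z 1" using x by (metis lookup_scaleR_real lookup_single_eq of_nat_numeral)
      moreover obtain k :: int where "lookup z 1 = of_int k"
        using z(1) unfolding int_vec_def by (metis Ints_cases)
      ultimately have "2 * k = 1 \<or> 2 * k = -1" using c
        by (metis (mono_tags, opaque_lifting) of_int_1 of_int_eq_iff of_int_minus of_int_mult of_int_numeral)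
      then have False by presburger
      then show ?thesis ..
    next
      fix z assume z: "int_vec z" "g = z + dil 2 y" "x + y = - (real 2 *\<^sub>R z)"
      \<comment> \<open>The middle level is forced to be -(x + y)/2, so y = -x and y = x produce the
        two vectors of \<open>mid_norm\<close>.\<close>
      have z_eq: "z = - ((1 / 2) *\<^sub>R (x + y))" unfolding z(3) by simp
      have f_eq: "x + dil 2 g = x - (1 / 2) *\<^sub>R (dil 2 x + dil 2 y) + dil 4 y"
        unfolding z(2) z_eq by (simp add: algebra_simps)
      consider "d = - c" | "d = c" using c d by auto
      then show ?thesis
      proof cases
        case 1
        then have "y = - x" by (simp add: x y single_uminus)
        then have "x + dil 2 g = x - dil 4 x" unfolding f_eq by simp
        also have "\<dots> = c *\<^sub>R (e 1 - e 4)"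
          by (simp add: x scale[of _ c] algebra_simps numeral_eq_Suc)
        finally have "f = c *\<^sub>R dil r (e 1 - e 4)" using more(2) by (metis dil_linear(4))
        from similarI[OF more(1) c this] show ?thesis by (rule that[rotated]) (simp add: mid_norm_def)
      next
        case 2
        then have "y = x" by (simp add: x y)
        then have "x + dil 2 g = x - dil 2 x + dil 4 x"
          unfolding f_eq \<open>y = x\<close> by (simp only: scaleR_half_double)
        also have "\<dots> = c *\<^sub>R (e 1 - e 2 + e 4)"
          by (simp add: x scale[of _ c] algebra_simps numeral_eq_Suc)
        finally have "f = c *\<^sub>R dil r (e 1 - e 2 + e 4)" using more(2) by (metis dil_linear(4))
        from similarI[OF more(1) c this] show ?thesis by (rule that[rotated]) (simp add: mid_norm_def)
      qed
    qed
  qed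
qed


lemma gcd_ker_values [simp]:
  "gcd_ker (Suc 0) (Suc 0) = 1" "gcd_ker (Suc 0) 2 = 1 / 2" "gcd_ker (Suc 0) 4 = 1 / 4"
  "gcd_ker 2 (Suc 0) = 1 / 2" "gcd_ker 2 2 = 1" "gcd_ker 2 4 = 1 / 2"
  "gcd_ker 4 (Suc 0) = 1 / 4" "gcd_ker 4 2 = 1 / 2" "gcd_ker 4 4 = 1"
  by (simp_all add: gcd_ker_def gcd_non_0_nat)

lemma Q_low_norm: "u \<in> low_norm \<Longrightarrow> Q u = 1"
  by (auto simp: low_norm_def gform_linear)

lemma Q_mid_norm: "u \<in> mid_norm \<Longrightarrow> Q u = 3 / 2"
  by (auto simp: mid_norm_def gform_linear)

lemma one_in_keys_norm: "u \<in> low_norm \<union> mid_norm \<Longrightarrow> 1 \<in> keys u"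
  by (auto simp: low_norm_def mid_norm_def in_keys_iff vec_lookup)

section \<open>Weights and their divisibility by a prime\<close>

definition wsum :: "vec \<Rightarrow> real" where "wsum = lin real"

lemma wsum_linear:
  "wsum (f + g) = wsum f + wsum g" "wsum (f - g) = wsum f - wsum g" "wsum (- f) = - wsum f"
  "wsum (c *\<^sub>R f) = c * wsum f" "wsum (single a c) = c * real a"
  by (simp_all add: wsum_def)

lemma wsum_dil: "0 < r \<Longrightarrow> wsum (dil r f) = real r * wsum f"
  by (simp add: wsum_def)

lemma wsum_Ints: "int_vec f \<Longrightarrow> wsum f \<in> \<int>"
  by (auto simp: wsum_def lin_def int_vec_def intro!: Ints_sum Ints_mult)

definition pdiv :: "nat \<Rightarrow> vec \<Rightarrow> bool" where
  "pdiv p f \<longleftrightarrow> (\<exists>t. wsum f = of_int (int p * t))"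

text \<open>The equation is the vanishing weight of x + \<open>dil p g\<close>: all levels above the
  lowest contribute multiples of p.\<close>

lemma pdiv_bottom:
  assumes "int_vec g" "wsum x + real p * wsum g = 0"
  shows "pdiv p x"
proof -
  obtain t where "wsum g = of_int t" using wsum_Ints[OF assms(1)] by (elim Ints_cases)
  then have "wsum x = of_int (int p * (- t))" using assms(2) by simp
  then show ?thesis unfolding pdiv_def by blast
qed

lemma not_pdivI:
  assumes "prime p" "k < p" "0 < k" "\<not> p dvd r" "\<bar>wsum f\<bar> = real (k * r)"
  shows "\<not> pdiv p f"
proof
  assume "pdiv p f"
  then obtain t where "wsum f = of_int (int p * t)" unfolding pdiv_def by blast
  then have "of_int \<bar>int p * t\<bar> = (of_int (int (k * r)) :: real)"
    using assms(5) by simp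
  then have "\<bar>int p * t\<bar> = int (k * r)" by (simp only: of_int_eq_iff)
  then have "int p dvd int (k * r)" by (metis dvd_abs_iff dvd_triv_left)
  then have "p dvd k * r" by (simp only: int_dvd_int_iff)
  then have "p dvd k" using assms(1,4) by (simp add: prime_dvd_mult_iff)
  then show False using assms(2,3) by (auto dest: dvd_imp_le)
qed

lemma keys_scale: "c \<noteq> 0 \<Longrightarrow> keys (c *\<^sub>R f) = keys (f :: vec)"
  by (auto simp: in_keys_iff lookup_scaleR_real)

text \<open>As 1 is a key of u, the dilation factor is itself a key of f, so p does not divide
  it.\<close>

lemma similar_copE:
  assumes "similar f u" "cop p f" "1 \<in> keys u"
  obtains r \<epsilon> where "0 < r" "\<epsilon> = 1 \<or> \<epsilon> = -1" "f = \<epsilon> *\<^sub>R dil r u" "\<not> p dvd r"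
proof -
  obtain r \<epsilon> where r: "0 < r" "\<epsilon> = 1 \<or> \<epsilon> = -1" "f = \<epsilon> *\<^sub>R dil r u"
    using assms(1) by (rule similarE)
  have "\<epsilon> \<noteq> 0" using r(2) by auto
  then have "keys f = (*) r ` keys u" unfolding r(3) using r(1) by (simp add: keys_scale keys_dil)
  then have "r \<in> keys f" using assms(3) by force
  then have "\<not> p dvd r" using assms(2) by (simp add: cop_def)
  with r show ?thesis by (rule that)
qed

lemma similar_dil:
  assumes "similar f u" "0 < M"
  shows "similar (dil M f) u"
proof -
  obtain r \<epsilon> where r: "0 < r" "\<epsilon> = 1 \<or> \<epsilon> = -1" "f = \<epsilon> *\<^sub>R dil r u"
    using assms(1) by (rule similarE)
  then have "dil M f = \<epsilon> *\<^sub>R dil (M * r) u" using assms(2) by simp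
  then show ?thesis using r(1,2) assms(2) by (intro similarI[of "M * r" \<epsilon>]) auto
qed

text \<open>Divide by the gcd of the keys: an inactive prime has the same exponent in all keys,
  hence also in their gcd.\<close>

lemma normal_form:
  assumes f: "int_vec f" "f \<noteq> 0"
  obtains M f' where "0 < M" "f = dil M f'" "int_vec f'" "f' \<noteq> 0"
    "\<And>q. prime q \<Longrightarrow> \<not> active q f \<Longrightarrow> cop q f'"
proof -
  define M where "M = Gcd (keys f)"
  define f' where "f' = contr M f"
  obtain a where a: "a \<in> keys f" using f(2) by (metis equals0I keys_eq_empty)
  have key0: "b \<noteq> 0" if "b \<in> keys f" for b using f(1) that by (metis int_vec_def)
  have M_dvd: "M dvd b" if "b \<in> keys f" for b using that by (simp add: M_def)
  have M: "0 < M" using M_dvd[OF a] key0[OF a] by (metis dvd_0_left_iff gr0I)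
  have f_eq: "f = dil M f'" unfolding f'_def using M M_dvd by (simp add: dil_contr)
  have keys: "b \<in> keys f' \<longleftrightarrow> M * b \<in> keys f" for b
    using M by (simp add: f'_def keys_contr)
  have "cop q f'" if q: "prime q" "\<not> active q f" for q
    unfolding cop_def
  proof (intro ballI notI)
    fix b assume b: "b \<in> keys f'" "q dvd b"
    have Mb: "M * b \<noteq> 0" using key0 keys b(1) by blast
    have unit: "\<not> is_unit q" using prime_gt_1_nat[OF q(1)] by simp
    have mult_pos: "q ^ Suc (multiplicity q M) dvd M * b"
    proof -
      have "q ^ multiplicity q M dvd M" by (rule multiplicity_dvd)
      then have "q ^ multiplicity q M * q dvd M * b" using b(2) by (rule mult_dvd_mono)
      then show ?thesis by (simp add: mult.commute)
    qed
    have "q ^ Suc (multiplicity q M) dvd c" if c: "c \<in> keys f" for c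
    proof -
      have "multiplicity q c = multiplicity q (M * b)"
        using q(2) c b(1) keys unfolding active_def by blast
      moreover have "Suc (multiplicity q M) \<le> multiplicity q (M * b)"
        using mult_pos Mb unit by (subst (asm) power_dvd_iff_le_multiplicity) auto
      ultimately show ?thesis by (intro multiplicity_dvd') simp
    qed
    then have "q ^ Suc (multiplicity q M) dvd M" unfolding M_def by (rule Gcd_greatest)
    then show False
      using M unit by (subst (asm) power_dvd_iff_le_multiplicity) auto
  qed
  moreover have "f' \<noteq> 0" using f(2) f_eq by auto
  moreover have "int_vec f'" unfolding f'_def using f(1) M by (rule int_vec_intros)
  ultimately show ?thesis using that M f_eq by blast
qed

lemma pow2_if_cop:
  assumes "int_vec f" "\<And>q. prime q \<Longrightarrow> q \<noteq> 2 \<Longrightarrow> cop q f"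
  shows "pow2 f"
  unfolding pow2_def
proof
  fix a assume a: "a \<in> keys f"
  then have "a \<noteq> 0" using assms(1) by (metis int_vec_def)
  then obtain b where b: "a = 2 ^ multiplicity 2 a * b" "\<not> 2 dvd b"
    using multiplicity_decompose'[of a "2::nat"] by auto
  have "b = 1"
  proof (rule ccontr)
    assume "b \<noteq> 1"
    then obtain q where q: "prime q" "q dvd b" using prime_factor_nat by blast
    then have "q \<noteq> 2" using b(2) by blast
    then have "\<not> q dvd a" using assms(2) q(1) a by (simp add: cop_def)
    then show False using b(1) q(2) dvd_mult by metis
  qed
  then show "\<exists>i. a = 2 ^ i" using b(1) by (metis mult.right_neutral)
qed

lemma no_odd_active_classification:
  assumes f: "int_vec f" "f \<noteq> 0" "Q f < 7 / 4"
    and act: "\<And>q. prime q \<Longrightarrow> q \<noteq> 2 \<Longrightarrow> \<not> active q f"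
  obtains u where "u \<in> low_norm \<union> mid_norm" "similar f u"
proof -
  obtain M f' where M: "0 < M" "f = dil M f'" "int_vec f'" "f' \<noteq> 0"
    and cop: "\<And>q. prime q \<Longrightarrow> \<not> active q f \<Longrightarrow> cop q f'"
    using normal_form[OF f(1,2)] by blast
  have "pow2 f'" using M(3) by (rule pow2_if_cop) (rule cop[OF _ act])
  moreover have "Q f' < 7 / 4" using f(3) M(1,2) by simp
  ultimately obtain u where "u \<in> low_norm \<union> mid_norm" "similar f' u"
    using pow2_classification M(3,4) by blast
  then show ?thesis using that similar_dil M(1,2) by blast
qed

lemma odd_prime_ge_3: "prime q \<Longrightarrow> q \<noteq> 2 \<Longrightarrow> 3 \<le> (q::nat)"
  using prime_ge_2_nat[of q] by linarith

text \<open>Once an odd prime is active, Q is at least 2 (1 - 1/3) = 4/3. Below that only powers of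
  two remain, and \<open>mid_norm\<close> is excluded by its value 3/2.\<close>

lemma low_classification:
  assumes f: "int_vec f" "f \<noteq> 0" "Q f < 4 / 3"
  obtains u where "u \<in> low_norm" "similar f u"
proof -
  have act: "\<not> active q f" if q: "prime q" "q \<noteq> 2" for q
  proof
    assume "active q f"
    have q3: "3 \<le> q" using q by (rule odd_prime_ge_3)
    from f(1) q(1) \<open>active q f\<close> show False
    proof (cases rule: prime_split)
      case (one r x y)
      have "2 \<le> Q x + Q y" using Q_ge_1[OF one(3,7)] Q_ge_1[OF one(4,8)] by linarith
      from split_bound_mono(1)[OF _ q3 _ this one(11)]
      have "4 / 3 + Q (x + y) / real q \<le> Q f" by simp
      moreover have "0 \<le> Q (x + y) / real q" using Q_nonneg by (intro divide_nonneg_nonneg) auto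
      ultimately show False using f(3) by linarith
    next
      case (more r x y w g)
      have "2 \<le> Q x + Q y" using Q_ge_1[OF more(3,9)] Q_ge_1[OF more(4,10)] by linarith
      from split_bound_mono(2)[OF _ q3 _ this more(13)]
      have "16 / 9 + Q w \<le> Q f" by simp
      then show False using f(3) Q_nonneg[of w] by linarith
    qed
  qed
  have "Q f < 7 / 4" using f(3) by linarith
  from no_odd_active_classification[OF f(1,2) this act] obtain u
    where u: "u \<in> low_norm \<union> mid_norm" "similar f u" .
  then have "u \<notin> mid_norm" using f(3) Q_similar[OF u(2)] Q_mid_norm[of u] by auto
  then show ?thesis using that u by blast
qed

lemma wsum_low_norm: "u \<in> low_norm \<Longrightarrow> wsum u = 1 \<or> wsum u = -1"
  by (auto simp: low_norm_def wsum_linear)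

lemma wsum_mid_norm: "u \<in> mid_norm \<Longrightarrow> wsum u = 3 \<or> wsum u = -3"
  by (auto simp: mid_norm_def wsum_linear)

text \<open>If no odd prime is active, the weight is 1 or 3 times the dilation factor, up to sign.
  Otherwise the bound 5/3 forces f to be the difference of a vector similar to one in
  \<open>low_norm\<close> and its dilation by q, where q is 3 or 5, and the weight is q - 1 times
  the dilation factor.\<close>

lemma small_norm_not_pdiv:
  assumes f: "int_vec f" "f \<noteq> 0" "Q f < 5 / 3" and p: "prime p" "5 \<le> p" "cop p f"
  shows "\<not> pdiv p f"
proof (cases "\<exists>q. prime q \<and> q \<noteq> 2 \<and> active q f")
  case False
  then have act: "\<not> active q f" if "prime q" "q \<noteq> 2" for q using that by blast
  have "Q f < 7 / 4" using f(3) by linarith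
  from no_odd_active_classification[OF f(1,2) this act] obtain u
    where u: "u \<in> low_norm \<union> mid_norm" "similar f u" .
  obtain r \<epsilon> where r: "0 < r" "\<epsilon> = 1 \<or> \<epsilon> = -1" "f = \<epsilon> *\<^sub>R dil r u" "\<not> p dvd r"
    using similar_copE[OF u(2) p(3) one_in_keys_norm[OF u(1)]] .
  have "\<bar>wsum f\<bar> = real r * \<bar>wsum u\<bar>"
    using r by (auto simp: wsum_linear wsum_dil abs_mult)
  moreover have "\<bar>wsum u\<bar> = real 1 \<or> \<bar>wsum u\<bar> = real 3"
    using u(1) wsum_low_norm[of u] wsum_mid_norm[of u] by auto
  ultimately have "\<bar>wsum f\<bar> = real (1 * r) \<or> \<bar>wsum f\<bar> = real (3 * r)" by auto
  then show ?thesis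
  proof
    assume "\<bar>wsum f\<bar> = real (1 * r)"
    then show ?thesis using p(2) by (intro not_pdivI[OF p(1) _ _ r(4)]) auto
  next
    assume "\<bar>wsum f\<bar> = real (3 * r)"
    then show ?thesis using p(2) by (intro not_pdivI[OF p(1) _ _ r(4)]) auto
  qed
next
  case True
  then obtain q where q: "prime q" "q \<noteq> 2" "active q f" by blast
  have q3: "3 \<le> q" using q(1,2) by (rule odd_prime_ge_3)
  from f(1) q(1,3) show ?thesis
  proof (cases rule: prime_split)
    case (more r x y w g)
    have "2 \<le> Q x + Q y" using Q_ge_1[OF more(3,9)] Q_ge_1[OF more(4,10)] by linarith
    from split_bound_mono(2)[OF _ q3 _ this more(13)]
    have "16 / 9 + Q w \<le> Q f" by simp
    then show ?thesis using f(3) Q_nonneg[of w] by linarith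
  next
    case (one r x y)
    have ge: "1 \<le> Q x" "1 \<le> Q y" using Q_ge_1[OF one(3,7)] Q_ge_1[OF one(4,8)] by auto
    have T: "0 \<le> Q (x + y)" by (rule Q_nonneg)
    \<comment> \<open>From 7 on, the cost 2 (1 - 1/7) = 12/7 exceeds 5/3.\<close>
    have "q < 7"
    proof (rule ccontr)
      assume "\<not> q < 7"
      then have q7: "7 \<le> q" by simp
      have "2 \<le> Q x + Q y" using ge by linarith
      from split_bound_mono(1)[OF _ q7 _ this one(11)]
      have "12 / 7 + Q (x + y) / real q \<le> Q f" by simp
      moreover have "0 \<le> Q (x + y) / real q" using T by (intro divide_nonneg_nonneg) auto
      ultimately show False using f(3) by linarith
    qed
    moreover have "q \<noteq> 4" "q \<noteq> 6" using q(1) by auto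
    ultimately have q35: "q = 3 \<or> q = 5" using q3 by linarith
    have *: "x + y = 0 \<and> Q x < 4 / 3"
      using q35
    proof
      assume "q = 3"
      then have Qf: "3 * Q f = 2 * Q x + 2 * Q y + Q (x + y)" using one(11) by simp
      have "Q (x + y) < 1" using Qf f(3) ge by linarith
      then have "x + y = 0" using one(3,4) by (intro Q_less_1 int_vec_intros)
      then have "y = - x" by (simp add: eq_neg_iff_add_eq_0 add.commute)
      then have "Q y = Q x" by (simp add: gform_linear)
      then show ?thesis using Qf f(3) T \<open>x + y = 0\<close> by linarith
    next
      assume "q = 5"
      then have Qf: "5 * Q f = 4 * Q x + 4 * Q y + Q (x + y)" using one(11) by simp
      have "Q (x + y) < 1" using Qf f(3) ge by linarith
      then have "x + y = 0" using one(3,4) by (intro Q_less_1 int_vec_intros)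
      then have "y = - x" by (simp add: eq_neg_iff_add_eq_0 add.commute)
      then have "Q y = Q x" by (simp add: gform_linear)
      then show ?thesis using Qf f(3) T \<open>x + y = 0\<close> by linarith
    qed
    then have y: "y = - x" by (simp add: eq_neg_iff_add_eq_0 add.commute)
    have q0: "0 < q" using q3 by simp
    have f_eq: "f = dil r x - dil (r * q) x" using one(1,2) y by simp
    \<comment> \<open>The two copies of x sit at different exponents of q, so nothing cancels and
      coprimality to p passes to \<open>dil r x\<close>.\<close>
    have "keys (dil r x) \<subseteq> keys f"
    proof
      fix a assume "a \<in> keys (dil r x)"
      then obtain b where b: "b \<in> keys x" "a = r * b" using one(1) by (auto simp: keys_dil)
      then have "\<not> q dvd b" using one(5) by (simp add: cop_def)
      then have "lookup f a = lookup x b"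
        using b one(1,2) by (simp add: vec_lookup)
      then show "a \<in> keys f" using b(1) by (simp add: in_keys_iff)
    qed
    then have cop: "cop p (dil r x)" using p(3) by (auto simp: cop_def)
    have "int_vec (dil r x)" using one(1,3) by (intro int_vec_intros)
    moreover have "dil r x \<noteq> 0" using one(1,7) by (metis keys_dil image_is_empty keys_eq_empty)
    moreover have "Q (dil r x) < 4 / 3" using * one(1) by simp
    ultimately obtain u where u: "u \<in> low_norm" "similar (dil r x) u"
      by (rule low_classification)
    have "1 \<in> keys u" using one_in_keys_norm u(1) by blast
    with u(2) cop obtain m \<epsilon> where m: "0 < m" "\<epsilon> = 1 \<or> \<epsilon> = -1" "dil r x = \<epsilon> *\<^sub>R dil m u" "\<not> p dvd m"
      by (rule similar_copE)
    have "wsum f = (1 - real q) * wsum (dil r x)"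
      unfolding f_eq using one(1) q0 by (simp add: wsum_linear wsum_dil algebra_simps)
    moreover have "\<bar>wsum (dil r x)\<bar> = real m"
      unfolding m(3) using m(1,2) wsum_low_norm[OF u(1)] by (auto simp: wsum_linear wsum_dil)
    ultimately have "\<bar>wsum f\<bar> = real ((q - 1) * m)"
      using q3 by (simp add: abs_mult of_nat_diff)
    moreover have "q - 1 < p" "0 < q - 1" using q35 p(2) by auto
    ultimately show ?thesis by (intro not_pdivI[OF p(1) _ _ m(4)])
  qed
qed

lemma Q_add_ge_1:
  assumes "int_vec x" "int_vec y" "x + y \<noteq> 0"
  shows "1 \<le> Q (x + y)"
  using assms by (intro Q_ge_1 int_vec_intros)

text \<open>The weight of the lowest part is divisible by p, so this part costs at least 5/3 rather
  than 1, and Q x + Q y >= 8/3.\<close>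

lemma zero_wsum_big_prime:
  assumes f: "int_vec f" "wsum f = 0" and p: "prime p" "5 \<le> p" "active p f"
  shows "7 / 3 \<le> Q f"
proof -
  have ge: "5 / 3 \<le> Q x" if "int_vec x" "x \<noteq> 0" "cop p x" "pdiv p x" for x
  proof (rule ccontr)
    assume "\<not> 5 / 3 \<le> Q x"
    then have "\<not> pdiv p x" using that(1-3) p(1,2) by (intro small_norm_not_pdiv) auto
    then show False using that(4) by simp
  qed
  from f(1) p(1,3) show ?thesis
  proof (cases rule: prime_split)
    case (more r x y w g)
    have "real r * (wsum x + real p * wsum g) = 0"
      using f(2) more(1,2) p(2) by (simp add: wsum_linear wsum_dil algebra_simps)
    then have "wsum x + real p * wsum g = 0" using more(1) by simp
    then have "5 / 3 \<le> Q x" using more(3,5,7,9) by (intro ge pdiv_bottom)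
    then have "8 / 3 \<le> Q x + Q y" using Q_ge_1[OF more(4,10)] by linarith
    from split_bound_mono(2)[OF _ p(2) _ this more(13)]
    have "64 / 25 + Q w \<le> Q f" by simp
    then show ?thesis using Q_nonneg[of w] by linarith
  next
    case (one r x y)
    have "real r * (wsum x + real p * wsum y) = 0"
      using f(2) one(1,2) p(2) by (simp add: wsum_linear wsum_dil algebra_simps)
    then have ws: "wsum x + real p * wsum y = 0" using one(1) by simp
    then have Qx: "5 / 3 \<le> Q x" using one(3-5,7) by (intro ge pdiv_bottom)
    show ?thesis
    proof (cases "x + y = 0")
      case True
      then have "y = - x" by (simp add: eq_neg_iff_add_eq_0 add.commute)
      then have "Q y = Q x" by (simp add: gform_linear)
      then have "10 / 3 \<le> Q x + Q y" using Qx by linarith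
      from split_bound_mono(1)[OF _ p(2) _ this one(11)]
      have "8 / 3 + Q (x + y) / real p \<le> Q f" by simp
      moreover have "0 \<le> Q (x + y) / real p" using Q_nonneg by (intro divide_nonneg_nonneg) auto
      ultimately show ?thesis by linarith
    next
      case False
      \<comment> \<open>The bound is (1 - \<rho>) 8/3 + \<rho> = 8/3 - (5/3) \<rho>, which is
        exactly 7/3 at \<rho> = 1/5; this is where the threshold 5/3 comes from.\<close>
      define \<rho> where "\<rho> = 1 / real p"
      have \<rho>: "0 \<le> \<rho>" "\<rho> \<le> 1 / 5" using p(2) by (auto simp: \<rho>_def field_simps)
      have "1 \<le> Q (x + y)" using one(3,4) False by (rule Q_add_ge_1)
      then have "\<rho> * 1 \<le> \<rho> * Q (x + y)" using \<rho>(1) by (rule mult_left_mono)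
      moreover have "8 / 3 \<le> Q x + Q y" using Qx Q_ge_1[OF one(4,8)] by linarith
      then have "(1 - \<rho>) * (8 / 3) \<le> (1 - \<rho>) * (Q x + Q y)"
        using \<rho> by (intro mult_left_mono) auto
      moreover have "Q f = (1 - \<rho>) * (Q x + Q y) + \<rho> * Q (x + y)"
        using one(11) by (simp add: \<rho>_def)
      ultimately show ?thesis using \<rho>(2) by (simp add: left_diff_distrib)
    qed
  qed
qed

section \<open>Vectors of weight zero\<close>


text \<open>On the vector of a non-degenerate list this is the length of the list, see
  \<open>len_list_vec\<close>.\<close>

definition len :: "vec \<Rightarrow> real" where
  "len f = (\<Sum>a\<in>keys f. \<bar>lookup f a\<bar>)"

lemma len_superset: "finite A \<Longrightarrow> keys f \<subseteq> A \<Longrightarrow> len f = (\<Sum>a\<in>A. \<bar>lookup f a\<bar>)"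
  unfolding len_def by (intro sum.mono_neutral_left) (auto simp: in_keys_iff)

lemma len_add: "len (f + g) \<le> len f + len g"
proof -
  have "keys (f + g) \<subseteq> keys f \<union> keys g" by (rule keys_add)
  then have "len (f + g) = (\<Sum>a\<in>keys f \<union> keys g. \<bar>lookup f a + lookup g a\<bar>)"
    by (subst len_superset[of "keys f \<union> keys g"]) (auto simp: lookup_add)
  also have "\<dots> \<le> (\<Sum>a\<in>keys f \<union> keys g. \<bar>lookup f a\<bar> + \<bar>lookup g a\<bar>)"
    by (intro sum_mono abs_triangle_ineq)
  also have "\<dots> = len f + len g"
    by (simp add: sum.distrib len_superset[of "keys f \<union> keys g"])
  finally show ?thesis .
qed

lemma len_minus: "len (- f) = len f"
  by (simp add: len_def in_keys_iff keys_def)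

lemma len_diff: "len (f - g) \<le> len f + len g"
  using len_add[of f "- g"] by (simp add: len_minus)

lemma len_sign: "c = 1 \<or> c = -1 \<Longrightarrow> len (c *\<^sub>R f) = len f"
  by (auto simp: len_minus)

lemma len_single: "len (e a) = 1"
  by (simp add: len_superset[of "{a}"])

lemma len_dil: "0 < r \<Longrightarrow> len (dil r f) = len f"
proof -
  assume r: "0 < r"
  have inj: "inj_on ((*) r) (keys f)" using r by (auto intro: inj_onI)
  show ?thesis
    unfolding len_def keys_dil[OF r] sum.reindex[OF inj] using r by (simp add: lookups)
qed

lemma sign_match:
  fixes \<epsilon> \<delta> :: real
  assumes "\<delta> * real m = \<epsilon> * real n" "\<epsilon> = 1 \<or> \<epsilon> = -1" "\<delta> = 1 \<or> \<delta> = -1" "0 < m" "0 < n"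
  shows "\<delta> = \<epsilon>" "m = n"
proof -
  have "0 < real m" "0 < real n" using assms(4,5) by auto
  then show "\<delta> = \<epsilon>" using assms(1-3) by auto
  then show "m = n" using assms(1,2) by auto
qed

text \<open>Weight zero makes the coefficient at the lowest level even, so its square is at least 4
  rather than 1.\<close>

lemma zero_wsum_pow2:
  assumes f: "int_vec f" "f \<noteq> 0" "pow2 f" "wsum f = 0"
  shows "7 / 3 \<le> Q f"
proof (cases "active 2 f")
  case False
  with f(1-3) obtain m c where "f = single m c" "c \<noteq> 0" "0 < m" by (rule pow2_not_activeE)
  then show ?thesis using f(4) by (simp add: wsum_linear)
next
  case True
  have even: "4 \<le> c\<^sup>2" if c: "c \<in> \<int>" "c \<noteq> 0" "c + 2 * k = 0" "k \<in> \<int>" for c k :: real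
  proof -
    have "k \<noteq> 0" using c by auto
    then have "1 \<le> k\<^sup>2" using c(4) Ints_square_ge_1 by simp
    moreover have "c = - (2 * k)" using c(3) by linarith
    ultimately show ?thesis by simp
  qed
  from f(1) two_is_prime_nat True show ?thesis
  proof (cases rule: prime_split)
    case (one r x y)
    obtain c where x: "x = single 1 c" and c: "c \<in> \<int>" "c \<noteq> 0"
      using pow2_copE[OF one(3,7) part_pow2[OF one(9) f(3)] one(5)] .
    obtain d where y: "y = single 1 d" and d: "d \<in> \<int>" "d \<noteq> 0"
      using pow2_copE[OF one(4,8) part_pow2[OF one(10) f(3)] one(6)] .
    have "real r * (c + 2 * d) = 0"
      using f(4) one(1,2) x y by (simp add: wsum_linear wsum_dil algebra_simps)
    then have "4 \<le> c\<^sup>2" using one(1) c d by (intro even[of c d]) auto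
    moreover have "1 \<le> d\<^sup>2" using d by (rule Ints_square_ge_1)
    moreover define C where "C = (c + d)\<^sup>2"
    have "2 * Q f = c\<^sup>2 + d\<^sup>2 + C"
      using one(11) unfolding C_def
      by (simp add: x y Q_single_one[unfolded One_nat_def] single_add[symmetric] del: gform_single)
    moreover have "0 \<le> C" by (simp add: C_def)
    ultimately show ?thesis by linarith
  next
    case (more r x y w g)
    obtain c where x: "x = single 1 c" and c: "c \<in> \<int>" "c \<noteq> 0"
      using pow2_copE[OF more(3,9) part_pow2[OF more(11) f(3)] more(7)] .
    have "real r * (c + 2 * wsum g) = 0"
      using f(4) more(1,2) x by (simp add: wsum_linear wsum_dil algebra_simps)
    then have "4 \<le> c\<^sup>2" using more(1) c wsum_Ints[OF more(5)] by (intro even[of c "wsum g"]) auto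
    moreover have "Q x = c\<^sup>2" unfolding x by (rule Q_single_one)
    moreover have "1 \<le> Q y" using more(4,10) by (rule Q_ge_1)
    moreover have "4 * Q f = 3 * Q x + 3 * Q y + 4 * Q w" using more(13) by simp
    moreover have "0 \<le> Q w" by (rule Q_nonneg)
    ultimately show ?thesis by linarith
  qed
qed

lemma Q_parallelogram: "Q (x + y) \<le> 2 * Q x + 2 * Q y"
  using Q_nonneg[of "x - y"] by (simp add: gform_linear algebra_simps)

lemma Q_triple_ge: "int_vec z \<Longrightarrow> z \<noteq> 0 \<Longrightarrow> 9 \<le> Q (real 3 *\<^sub>R z)"
  using Q_ge_1[of z] by (simp add: gform_linear)

text \<open>Vectors similar to one in \<open>low_norm\<close> have weight r up to sign, with r not
  divisible by 3; those from \<open>mid_norm\<close> have weight 3r and survive.\<close>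

lemma pow2_pdiv_3:
  assumes x: "int_vec x" "x \<noteq> 0" "pow2 x" "cop 3 x" "pdiv 3 x" and Q: "Q x < 7 / 4"
  obtains u r \<epsilon> where "u \<in> mid_norm" "0 < r" "\<epsilon> = 1 \<or> \<epsilon> = -1" "x = \<epsilon> *\<^sub>R dil r u"
proof -
  from x(1,3,2) Q obtain u where u: "u \<in> low_norm \<union> mid_norm" "similar x u"
    by (rule pow2_classification)
  obtain r \<epsilon> where r: "0 < r" "\<epsilon> = 1 \<or> \<epsilon> = -1" "x = \<epsilon> *\<^sub>R dil r u" "\<not> 3 dvd r"
    using similar_copE[OF u(2) x(4) one_in_keys_norm[OF u(1)]] .
  have "u \<notin> low_norm"
  proof
    assume "u \<in> low_norm"
    then have "\<bar>wsum x\<bar> = real (1 * r)"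
      using r(1-3) wsum_low_norm[of u] by (auto simp: wsum_linear wsum_dil)
    then have "\<not> pdiv 3 x" using r(4) by (intro not_pdivI[of 3 1 r]) auto
    then show False using x(5) by simp
  qed
  then show ?thesis using that u(1) r(1-3) by blast
qed

text \<open>The alternative \<open>len f \<le> 4\<close> cannot be dropped: the list \<open>[1, -2, -3, 4]\<close> has \<open>Q = 2\<close>.\<close>

lemma zero_wsum_three:
  assumes f: "int_vec f" "wsum f = 0" "active 3 f"
    and cop: "\<And>q. prime q \<Longrightarrow> 5 \<le> q \<Longrightarrow> cop q f"
  shows "2 \<le> Q f \<and> (7 / 3 \<le> Q f \<or> len f \<le> 4)"
proof -
  have pow2: "pow2 x" if x: "int_vec x" "part x f" "cop 3 x" for x
  proof (rule pow2_if_cop[OF x(1)])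
    fix q :: nat assume q: "prime q" "q \<noteq> 2"
    have "q = 3 \<or> 5 \<le> q"
    proof -
      have "3 \<le> q" using q by (rule odd_prime_ge_3)
      moreover have "q \<noteq> 4" using q(1) by auto
      ultimately show ?thesis by linarith
    qed
    then show "cop q x" using x(3) part_cop[OF x(2)] cop q(1) by blast
  qed
  have Qx_ge: "3 / 2 \<le> Q x" if x: "int_vec x" "x \<noteq> 0" "pow2 x" "cop 3 x" "pdiv 3 x" for x
  proof (rule ccontr)
    assume "\<not> 3 / 2 \<le> Q x"
    then have "Q x < 7 / 4" by linarith
    with x obtain u r \<epsilon> where u: "u \<in> mid_norm" "0 < r" "\<epsilon> = 1 \<or> \<epsilon> = -1" "x = \<epsilon> *\<^sub>R dil r u"
      by (rule pow2_pdiv_3)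
    then have "Q x = 3 / 2" using Q_similar[OF similarI[OF u(2-4)]] Q_mid_norm by simp
    then show False using \<open>\<not> 3 / 2 \<le> Q x\<close> by simp
  qed
  have Qx_ge': "7 / 4 \<le> Q x"
    if x: "int_vec x" "x \<noteq> 0" "pow2 x" "cop 3 x" "wsum x = 0" for x
    using zero_wsum_pow2[OF x(1-3,5)] by linarith
  have p3: "prime (3::nat)" by simp
  from f(1) p3 f(3) show ?thesis
  proof (cases rule: prime_split)
    case (more r x y w g)
    have x2: "pow2 x" and y2: "pow2 y" using more pow2 by blast+
    have "real r * (wsum x + real 3 * wsum g) = 0"
      using f(2) more(1,2) by (simp add: wsum_linear wsum_dil algebra_simps)
    then have ws: "wsum x + real 3 * wsum g = 0" using more(1) by simp
    then have "pdiv 3 x" using more(5) by (intro pdiv_bottom)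
    then have Qx: "3 / 2 \<le> Q x" using more(3,9) x2 more(7) by (intro Qx_ge)
    have Qy: "1 \<le> Q y" using more(4,10) by (rule Q_ge_1)
    have Qf: "9 * Q f = 8 * Q x + 8 * Q y + 9 * Q w" using more(13) by simp
    have "7 / 3 \<le> Q f"
    proof (cases "w = 0")
      case False
      \<comment> \<open>Then 9 Q f >= 12 + 8 + 1 = 21, which is exactly 9 times 7/3.\<close>
      have "1 / (real 3)\<^sup>2 \<le> Q w" using more(6) False by (rule Q_scaled_ge) simp
      then have "1 / 9 \<le> Q w" by simp
      then show ?thesis using Qf Qx Qy by linarith
    next
      case True
      then have Qw: "Q w = 0" by (simp add: gform_linear)
      from more(14)[OF True] show ?thesis
      proof (elim disjE exE conjE)
        fix z assume z: "int_vec z" "x = real 3 *\<^sub>R z"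
        then have "z \<noteq> 0" using more(9) by auto
        then have "9 \<le> Q x" unfolding z(2) using z(1) by (intro Q_triple_ge)
        then show ?thesis using Qf Qy Qw by linarith
      next
        fix z assume z: "int_vec z" "g = z + dil 3 y" "x + y = - (real 3 *\<^sub>R z)"
        show ?thesis
        proof (cases "z = 0")
          case True
          then have y: "y = - x" using z(3) by (simp add: eq_neg_iff_add_eq_0 add.commute)
          \<comment> \<open>Here g = \<open>dil 3 y\<close> and y = -x, so the weight equation reads
            (1 - 9) \<open>wsum x\<close> = 0.\<close>
          then have "wsum x = 0"
            using ws True z(2) by (simp add: wsum_linear wsum_dil)
          then have "7 / 4 \<le> Q x" using more(3,9) x2 more(7) by (intro Qx_ge')
          moreover have "Q y = Q x" unfolding y by (simp add: gform_linear)
          ultimately show ?thesis using Qf Qw by linarith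
        next
          case False
          then have "9 \<le> Q (real 3 *\<^sub>R z)" using z(1) by (intro Q_triple_ge)
          also have "\<dots> = Q (x + y)" unfolding z(3) by (simp add: gform_linear)
          also have "\<dots> \<le> 2 * Q x + 2 * Q y" by (rule Q_parallelogram)
          finally show ?thesis using Qf Qw by linarith
        qed
      qed
    qed
    then show ?thesis by linarith
  next
    case (one s x y)
    have x2: "pow2 x" and y2: "pow2 y" using one pow2 by blast+
    have "real s * (wsum x + real 3 * wsum y) = 0"
      using f(2) one(1,2) by (simp add: wsum_linear wsum_dil algebra_simps)
    then have ws: "wsum x + real 3 * wsum y = 0" using one(1) by simp
    then have px: "pdiv 3 x" using one(4) by (intro pdiv_bottom)
    then have Qx: "3 / 2 \<le> Q x" using one(3,7) x2 one(5) by (intro Qx_ge)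
    have Qy: "1 \<le> Q y" using one(4,8) by (rule Q_ge_1)
    have Qf: "3 * Q f = 2 * Q x + 2 * Q y + Q (x + y)" using one(11) by simp
    show ?thesis
    proof (cases "x + y = 0")
      case True
      then have y: "y = - x" by (simp add: eq_neg_iff_add_eq_0 add.commute)
      then have "wsum x = 0" using ws by (simp add: wsum_linear)
      then have "7 / 4 \<le> Q x" using one(3,7) x2 one(5) by (intro Qx_ge')
      moreover have "Q y = Q x" unfolding y by (simp add: gform_linear)
      ultimately show ?thesis using Qf Q_nonneg[of "x + y"] by linarith
    next
      case False
      then have T: "1 \<le> Q (x + y)" using one(3,4) by (intro Q_add_ge_1)
      \<comment> \<open>If 2 Q x + 2 Q y + Q (x + y) < 7, then y is similar to a vector of
        \<open>low_norm\<close>, and either x + y is as well or x is similar to one of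
        \<open>mid_norm\<close>. The weight equation fixes dilation factors and signs, which leaves
        eight cases.\<close>
      have "7 / 3 \<le> Q f \<or> len f \<le> 4"
      proof (rule disjCI)
        assume "\<not> len f \<le> 4"
        show "7 / 3 \<le> Q f"
        proof (rule ccontr)
          assume "\<not> 7 / 3 \<le> Q f"
          then have small: "2 * Q x + 2 * Q y + Q (x + y) < 7" using Qf by linarith
          then have "Q y < 4 / 3 \<or> Q y < 7 / 4" using Qx T by linarith
          then have "Q y < 7 / 4" by linarith
          with one(4) y2 one(8) obtain u where "u \<in> low_norm \<union> mid_norm" "similar y u"
            by (rule pow2_classification)
          moreover have "Q y < 3 / 2" using small Qx T by linarith
          ultimately have u: "u \<in> low_norm" "similar y u"
            using Q_similar[of y u] Q_mid_norm[of u] by auto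
          obtain r \<epsilon> where r: "0 < r" "\<epsilon> = 1 \<or> \<epsilon> = -1" "y = \<epsilon> *\<^sub>R dil r u"
            using u(2) by (rule similarE)
          have Qy1: "Q y = 1" using Q_similar[OF u(2)] Q_low_norm[OF u(1)] by simp
          show False
          proof (cases "Q (x + y) < 3 / 2")
            case True
            have ih: "int_vec (x + y)" using one(3,4) by (intro int_vec_intros)
            have ph: "pow2 (x + y)"
              using x2 y2 keys_add[of x y] unfolding pow2_def by blast
            have "Q (x + y) < 7 / 4" using True by linarith
            with ih ph False obtain v where "v \<in> low_norm \<union> mid_norm" "similar (x + y) v"
              by (rule pow2_classification)
            then have v: "v \<in> low_norm" "similar (x + y) v"
              using Q_similar[of "x + y" v] Q_mid_norm[of v] True by auto
            obtain m \<delta> where m: "0 < m" "\<delta> = 1 \<or> \<delta> = -1" "x + y = \<delta> *\<^sub>R dil m v"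
              using v(2) by (rule similarE)
            \<comment> \<open>The representatives u and v have weight 1 or -1, so the dilation
              factor of x + y is twice that of y.\<close>
            have "wsum (x + y) = - 2 * wsum y" using ws by (simp add: wsum_linear)
            moreover have "wsum (x + y) = \<delta> * real m * wsum v"
              unfolding m(3) using m(1) by (simp add: wsum_linear wsum_dil)
            moreover have "wsum y = \<epsilon> * real r * wsum u"
              unfolding r(3) using r(1) by (simp add: wsum_linear wsum_dil)
            ultimately have eq: "\<delta> * real m * wsum v = - 2 * (\<epsilon> * real r * wsum u)" by simp
            have x_eq: "x = \<epsilon> *\<^sub>R dil r (\<eta> *\<^sub>R dil 2 v - u)"
              if "\<eta> = 1 \<or> \<eta> = -1" "\<delta> * real m = \<eta> * \<epsilon> * real (r * 2)" for \<eta>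
            proof -
              have "\<delta> = \<eta> * \<epsilon>" "m = r * 2"
                using sign_match[OF that(2)] that(1) m(1,2) r(1,2) by auto
              moreover have "x = \<delta> *\<^sub>R dil m v - y" using m(3) by (simp add: eq_diff_eq)
              ultimately show ?thesis using r(1,3) by (simp add: scaleR_diff_right mult.commute)
            qed
            have f_eq: "x + dil 3 y = \<epsilon> *\<^sub>R dil r (\<eta> *\<^sub>R dil 2 v - u + dil 3 u)"
              if "\<eta> = 1 \<or> \<eta> = -1" "\<delta> * real m = \<eta> * \<epsilon> * real (r * 2)" for \<eta>
              unfolding x_eq[OF that] using r(1,3) by (simp add: algebra_simps)
            have f_len: "len f \<le> 4"
              if "x + dil 3 y = \<epsilon> *\<^sub>R dil r k" "len k \<le> 4" for k
              unfolding one(2) that(1) using that(2) r(1,2) one(1) by (simp add: len_sign len_dil)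
            consider "u = e 1" "v = e 1" | "u = e 1" "v = e 1 - e 2"
              | "u = e 1 - e 2" "v = e 1" | "u = e 1 - e 2" "v = e 1 - e 2"
              using u(1) v(1) unfolding low_norm_def by blast
            then show False
            proof cases
              case 1
              have "\<delta> * real m = (-1) * \<epsilon> * real (r * 2)" using eq 1 by (simp add: wsum_linear)
              from f_eq[OF _ this] have "x + dil 3 y = \<epsilon> *\<^sub>R dil r ((-1) *\<^sub>R dil 2 v - u + dil 3 u)"
                by simp
              also have "(-1) *\<^sub>R dil 2 v - u + dil 3 u = e 3 - e 2 - e 1"
                unfolding 1 by (simp add: algebra_simps numeral_eq_Suc)
              finally have "x + dil 3 y = \<epsilon> *\<^sub>R dil r (e 3 - e 2 - e 1)" .
              moreover have "len (e 3 - e 2 - e 1) \<le> 4"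
                using len_diff[of "e 3 - e 2" "e 1"] len_diff[of "e 3" "e 2"] by (simp add: len_single)
              ultimately show False using f_len \<open>\<not> len f \<le> 4\<close> by blast
            next
              case 2
              have "\<delta> * real m = 1 * \<epsilon> * real (r * 2)" using eq 2 by (simp add: wsum_linear)
              from f_eq[OF _ this] have "x + dil 3 y = \<epsilon> *\<^sub>R dil r (1 *\<^sub>R dil 2 v - u + dil 3 u)"
                by simp
              also have "1 *\<^sub>R dil 2 v - u + dil 3 u = e 3 - e 1 + (e 2 - e 4)"
                unfolding 2 by (simp add: algebra_simps numeral_eq_Suc)
              finally have "x + dil 3 y = \<epsilon> *\<^sub>R dil r (e 3 - e 1 + (e 2 - e 4))" .
              moreover have "len (e 3 - e 1 + (e 2 - e 4)) \<le> 4"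
                using len_diff[of "e 3" "e 1"] len_diff[of "e 2" "e 4"]
                  len_add[of "e 3 - e 1" "e 2 - e 4"] by (simp add: len_single)
              ultimately show False using f_len \<open>\<not> len f \<le> 4\<close> by blast
            next
              case 3
              have "\<delta> * real m = 1 * \<epsilon> * real (r * 2)" using eq 3 by (simp add: wsum_linear)
              from x_eq[OF _ this] have "x = \<epsilon> *\<^sub>R dil r (1 *\<^sub>R dil 2 v - u)" by simp
              also have "1 *\<^sub>R dil 2 v - u = 2 *\<^sub>R e 2 - e 1"
                unfolding 3 by (simp add: algebra_simps numeral_eq_Suc scaleR_2)
              finally have "similar x (2 *\<^sub>R e 2 - e 1)" by (intro similarI[OF r(1,2)])
              then have "Q x = Q (2 *\<^sub>R e 2 - e 1)" by (rule Q_similar)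
              also have "\<dots> = 3" by (simp add: gform_linear)
              finally show False using small Qy1 T by linarith
            next
              case 4
              have "\<delta> * real m = (-1) * \<epsilon> * real (r * 2)" using eq 4 by (simp add: wsum_linear)
              from f_eq[OF _ this] have "x + dil 3 y = \<epsilon> *\<^sub>R dil r ((-1) *\<^sub>R dil 2 v - u + dil 3 u)"
                by simp
              also have "(-1) *\<^sub>R dil 2 v - u + dil 3 u = e 3 - e 1 + (e 4 - e 6)"
                unfolding 4 by (simp add: algebra_simps numeral_eq_Suc)
              finally have "x + dil 3 y = \<epsilon> *\<^sub>R dil r (e 3 - e 1 + (e 4 - e 6))" .
              moreover have "len (e 3 - e 1 + (e 4 - e 6)) \<le> 4"
                using len_diff[of "e 3" "e 1"] len_diff[of "e 4" "e 6"]
                  len_add[of "e 3 - e 1" "e 4 - e 6"] by (simp add: len_single)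
              ultimately show False using f_len \<open>\<not> len f \<le> 4\<close> by blast
            qed
          next
            case False
            then have "Q x < 7 / 4" using small Qy1 by linarith
            with one(3,7) x2 one(5) px obtain v m \<delta>
              where v: "v \<in> mid_norm" and m: "0 < m" "\<delta> = 1 \<or> \<delta> = -1" "x = \<delta> *\<^sub>R dil m v"
              by (rule pow2_pdiv_3)
            \<comment> \<open>Now v has weight 3 or -3 and u has weight 1 or -1, so x and y share
              their dilation factor. Then Q (x + y) comes out as 1 or 4, outside the possible
              range.\<close>
            have "wsum x = - 3 * wsum y" using ws by simp
            moreover have "wsum x = \<delta> * real m * wsum v" "wsum y = \<epsilon> * real r * wsum u"
              unfolding m(3) r(3) using m(1) r(1) by (simp_all add: wsum_linear wsum_dil)
            ultimately have eq: "\<delta> * real m * wsum v = - 3 * (\<epsilon> * real r * wsum u)" by simp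
            have T_eq: "Q (x + y) = Q (\<eta> *\<^sub>R v + u)"
              if "\<eta> = 1 \<or> \<eta> = -1" "\<delta> * real m = \<eta> * \<epsilon> * real r" for \<eta>
            proof -
              have "\<delta> = \<eta> * \<epsilon>" "m = r"
                using sign_match[OF that(2)] that(1) m(1,2) r(1,2) by auto
              then have "x + y = \<epsilon> *\<^sub>R dil r (\<eta> *\<^sub>R v + u)"
                unfolding m(3) r(3) by (simp add: scaleR_add_right mult.commute)
              with r(1,2) have "similar (x + y) (\<eta> *\<^sub>R v + u)" by (rule similarI)
              then show ?thesis by (rule Q_similar)
            qed
            have T_bounds: "3 / 2 \<le> Q (x + y)" "Q (x + y) < 4" using False small Qx Qy by linarith+
            consider "u = e 1" "v = e 1 - e 4" | "u = e 1" "v = e 1 - e 2 + e 4"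
              | "u = e 1 - e 2" "v = e 1 - e 4" | "u = e 1 - e 2" "v = e 1 - e 2 + e 4"
              using u(1) v(1) unfolding low_norm_def mid_norm_def by blast
            then show False
            proof cases
              case 1
              have "\<delta> * real m = 1 * \<epsilon> * real r" using eq 1 by (simp add: wsum_linear)
              from T_eq[OF _ this] have "Q (x + y) = Q (1 *\<^sub>R v + u)" by simp
              also have "\<dots> = 4" unfolding 1 gform_linear by simp
              finally show False using T_bounds by simp
            next
              case 2
              have "\<delta> * real m = (-1) * \<epsilon> * real r" using eq 2 by (simp add: wsum_linear)
              from T_eq[OF _ this] have "Q (x + y) = Q ((-1) *\<^sub>R v + u)" by simp
              also have "\<dots> = 1" unfolding 2 gform_linear by simp
              finally show False using T_bounds by simp
            next
              case 3
              have "\<delta> * real m = (-1) * \<epsilon> * real r" using eq 3 by (simp add: wsum_linear)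
              from T_eq[OF _ this] have "Q (x + y) = Q ((-1) *\<^sub>R v + u)" by simp
              also have "\<dots> = 1" unfolding 3 gform_linear by simp
              finally show False using T_bounds by simp
            next
              case 4
              have "\<delta> * real m = 1 * \<epsilon> * real r" using eq 4 by (simp add: wsum_linear)
              from T_eq[OF _ this] have "Q (x + y) = Q (1 *\<^sub>R v + u)" by simp
              also have "\<dots> = 4" unfolding 4 gform_linear by simp
              finally show False using T_bounds by simp
            qed
          qed
        qed
      qed
      moreover have "2 \<le> Q f" using Qf Qx Qy T by linarith
      ultimately show ?thesis by blast
    qed
  qed
qed

theorem zero_wsum_bound:
  assumes f: "int_vec f" "f \<noteq> 0" "wsum f = 0"
  shows "2 \<le> Q f \<and> (7 / 3 \<le> Q f \<or> len f \<le> 4)"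
proof (cases "\<exists>p. prime p \<and> 5 \<le> p \<and> active p f")
  case True
  then have "7 / 3 \<le> Q f" using zero_wsum_big_prime f(1,3) by blast
  then show ?thesis by linarith
next
  case False
  obtain M f' where M: "0 < M" "f = dil M f'" "int_vec f'" "f' \<noteq> 0"
    and cop: "\<And>q. prime q \<Longrightarrow> \<not> active q f \<Longrightarrow> cop q f'"
    using normal_form[OF f(1,2)] by blast
  have cop5: "cop q f'" if "prime q" "5 \<le> q" for q using cop False that by blast
  have eqs: "Q f = Q f'" "len f = len f'" using M(1,2) by (auto simp: len_dil)
  have ws: "wsum f' = 0" using f(3) M(1,2) by (simp add: wsum_dil)
  show ?thesis
  proof (cases "active 3 f'")
    case True
    show ?thesis unfolding eqs using M(3) ws True cop5 by (rule zero_wsum_three)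
  next
    case no3: False
    \<comment> \<open>A second normalization also removes the inactive prime 3; primes from 5 on,
      absent from f', are inactive there and so absent again.\<close>
    obtain M' f'' where M': "0 < M'" "f' = dil M' f''" "int_vec f''" "f'' \<noteq> 0"
      and cop': "\<And>q. prime q \<Longrightarrow> \<not> active q f' \<Longrightarrow> cop q f''"
      using normal_form[OF M(3,4)] by blast
    have "pow2 f''"
    proof (rule pow2_if_cop[OF M'(3)])
      fix q :: nat assume q: "prime q" "q \<noteq> 2"
      have "q = 3 \<or> 5 \<le> q"
      proof -
        have "3 \<le> q" using q by (rule odd_prime_ge_3)
        moreover have "q \<noteq> 4" using q(1) by auto
        ultimately show ?thesis by linarith
      qed
      moreover have "\<not> active q f'" if "5 \<le> q"
      proof
        assume "active q f'"
        then obtain a b where ab: "a \<in> keys f'" "b \<in> keys f'" "multiplicity q a \<noteq> multiplicity q b"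
          unfolding active_def by blast
        have "\<not> q dvd a" "\<not> q dvd b" using cop5[OF q(1) that] ab(1,2) by (auto simp: cop_def)
        then show False using ab(3) by (simp add: not_dvd_imp_multiplicity_0)
      qed
      ultimately show "cop q f''" using cop'[OF q(1)] no3 by blast
    qed
    moreover have "wsum f'' = 0" using ws M'(1,2) by (simp add: wsum_dil)
    ultimately have "7 / 3 \<le> Q f''" using M'(3,4) by (intro zero_wsum_pow2)
    then have "7 / 3 \<le> Q f" using eqs(1) M'(1,2) by simp
    then show ?thesis by linarith
  qed
qed

section \<open>Norms of lists\<close>


text \<open>A negative entry -a is recorded as coefficient -1 at key a, because \<open>psi\<close>
  is odd away from the integers; equal entries accumulate.\<close>

definition list_vec :: "int list \<Rightarrow> vec" where
  "list_vec as = (\<Sum>a\<leftarrow>as. single (nat \<bar>a\<bar>) (of_int (sgn a)))"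

lemma list_vec_simps [simp]:
  "list_vec [] = 0"
  "list_vec (a # as) = single (nat \<bar>a\<bar>) (of_int (sgn a)) + list_vec as"
  by (simp_all add: list_vec_def)

lemma int_vec_list_vec: "0 \<notin> set as \<Longrightarrow> int_vec (list_vec as)"
  by (induction as) (auto simp: int_vec_def vec_lookup in_keys_iff when_def)

lemma wsum_list_vec: "wsum (list_vec as) = of_int (sum_list as)"
proof (induction as)
  case Nil
  then show ?case by (simp add: wsum_def)
next
  case (Cons a as)
  have "of_int (sgn a) * real (nat \<bar>a\<bar>) = (of_int a :: real)"
    by (cases a "0 :: int" rule: linorder_cases) simp_all
  then show ?case using Cons by (simp add: wsum_linear)
qed

lemma gform_list_vec:
  "gform (list_vec as) (list_vec bs) = (\<Sum>a\<leftarrow>as. \<Sum>b\<leftarrow>bs. gcd_ker_int a b)"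
proof -
  have *: "gform (single (nat \<bar>a\<bar>) (of_int (sgn a))) (list_vec bs) = (\<Sum>b\<leftarrow>bs. gcd_ker_int a b)" for a
    by (induction bs) (simp_all add: gform_linear gcd_ker_int_conv)
  show ?thesis by (induction as) (simp_all add: gform_linear *)
qed

lemma list_norm_Q: "0 \<notin> set as \<Longrightarrow> list_norm as = Q (list_vec as) / 12"
  by (subst list_norm_eq) (auto simp: gform_list_vec)

lemma len_add_single:
  assumes "0 \<le> c * lookup f m"
  shows "len (single m c + f) = \<bar>c\<bar> + len f"
proof -
  let ?A = "insert m (keys f)"
  have "keys (single m c + f) \<subseteq> ?A" using keys_add[of "single m c" f] by (auto split: if_splits)
  then have "len (single m c + f) = (\<Sum>k\<in>?A. \<bar>lookup (single m c + f) k\<bar>)"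
    by (intro len_superset) auto
  also have "\<dots> = (\<Sum>k\<in>?A. (if k = m then \<bar>c\<bar> else 0) + \<bar>lookup f k\<bar>)"
  proof (rule sum.cong[OF refl])
    fix k
    have "\<bar>c + lookup f m\<bar> = \<bar>c\<bar> + \<bar>lookup f m\<bar>"
      using assms by (auto simp: zero_le_mult_iff)
    then show "\<bar>lookup (single m c + f) k\<bar> = (if k = m then \<bar>c\<bar> else 0) + \<bar>lookup f k\<bar>"
      by (auto simp: lookup_add lookup_single when_def)
  qed
  also have "\<dots> = \<bar>c\<bar> + (\<Sum>k\<in>?A. \<bar>lookup f k\<bar>)"
    by (simp add: sum.distrib)
  also have "(\<Sum>k\<in>?A. \<bar>lookup f k\<bar>) = len f"
    by (intro len_superset[symmetric]) auto
  finally show ?thesis .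
qed

text \<open>All contributions at key |a| have the sign of a. This is how non-degeneracy prevents
  cancellation, so that \<open>len\<close> counts entries.\<close>

lemma list_vec_same_sign:
  "- a \<notin> set as \<Longrightarrow> 0 \<le> of_int (sgn a) * lookup (list_vec as) (nat \<bar>a\<bar>)"
proof (induction as)
  case (Cons b as)
  have "0 \<le> (of_int (sgn a) * (of_int (sgn b) when nat \<bar>b\<bar> = nat \<bar>a\<bar>) :: real)"
    using Cons.prems by (auto simp: when_def sgn_if)
  then show ?case using Cons by (simp add: lookup_add lookup_single distrib_left)
qed simp

lemma len_list_vec:
  "0 \<notin> set as \<Longrightarrow> \<not> degenerate as \<Longrightarrow> len (list_vec as) = real (length as)"
proof (induction as)
  case Nil
  then show ?case by (simp add: len_def)
next
  case (Cons a as)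
  have "- a \<notin> set as" "\<not> degenerate as" using Cons.prems by (auto simp: degenerate_def)
  moreover have "\<bar>of_int (sgn a)\<bar> = (1::real)" using Cons.prems by (auto simp: sgn_if)
  ultimately show ?case
    using Cons list_vec_same_sign[of a as] by (simp add: len_add_single)
qed

lemma nondegenerate_vec:
  assumes "as \<in> nondegenerate_lists n" "1 \<le> n"
  shows "int_vec (list_vec as)" "list_vec as \<noteq> 0" "len (list_vec as) = real n"
    "list_norm as = Q (list_vec as) / 12"
proof -
  have as: "length as = n" "0 \<notin> set as" "\<not> degenerate as"
    using assms(1) by (auto simp: nondegenerate_lists_def)
  then show "int_vec (list_vec as)" "list_norm as = Q (list_vec as) / 12"
    and l: "len (list_vec as) = real n"
    by (simp_all add: int_vec_list_vec list_norm_Q len_list_vec)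
  show "list_vec as \<noteq> 0"
  proof
    assume "list_vec as = 0"
    then show False using l assms(2) by (simp add: len_def)
  qed
qed

text \<open>Below Q = 4/3 only similarity classes of length 1 and 2 remain.\<close>

lemma list_norm_ge:
  assumes as: "as \<in> nondegenerate_lists n" "1 \<le> n"
  shows "1 / 12 \<le> list_norm as" "3 \<le> n \<Longrightarrow> 1 / 9 \<le> list_norm as"
proof -
  note f = nondegenerate_vec[OF as]
  show "1 / 12 \<le> list_norm as" using Q_ge_1[OF f(1,2)] f(4) by simp
  show "1 / 9 \<le> list_norm as" if "3 \<le> n"
  proof (rule ccontr)
    assume "\<not> 1 / 9 \<le> list_norm as"
    then have "Q (list_vec as) < 4 / 3" using f(4) by simp
    with f(1,2) obtain u where u: "u \<in> low_norm" "similar (list_vec as) u"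
      by (rule low_classification)
    obtain r \<epsilon> where r: "0 < r" "\<epsilon> = 1 \<or> \<epsilon> = -1" "list_vec as = \<epsilon> *\<^sub>R dil r u"
      using u(2) by (rule similarE)
    have "len (list_vec as) = len u" unfolding r(3) using r(1,2) by (simp only: len_sign len_dil)
    moreover have "len u \<le> 2"
      using u(1) len_diff[of "e 1" "e 2"] unfolding low_norm_def by (auto simp: len_single)
    ultimately show False using f(3) that by simp
  qed
qed

lemma list_norm_zero_sum_ge:
  assumes as: "as \<in> nondegenerate_lists n" "1 \<le> n" "sum_list as = 0"
  shows "1 / 6 \<le> list_norm as" "5 \<le> n \<Longrightarrow> 7 / 36 \<le> list_norm as"
proof -
  note f = nondegenerate_vec[OF as(1,2)]
  have "wsum (list_vec as) = 0" using as(3) by (simp add: wsum_list_vec)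
  from zero_wsum_bound[OF f(1,2) this] f(3,4)
  show "1 / 6 \<le> list_norm as" "5 \<le> n \<Longrightarrow> 7 / 36 \<le> list_norm as" by auto
qed

text \<open>Witnesses that the minimum 1/12 is attained for lengths 1 and 2.\<close>

lemma list_norm_examples: "list_norm [1] = 1 / 12" "list_norm [1, -2] = 1 / 12"
  by (simp_all add: list_norm_Q gform_linear)

lemma G_ge: "1 \<le> n \<Longrightarrow> ereal (if 3 \<le> n then 1 / 9 else 1 / 12) \<le> G n"
  unfolding G_def
proof (rule INF_greatest)
  fix as assume "1 \<le> n" "as \<in> nondegenerate_lists n"
  then show "ereal (if 3 \<le> n then 1 / 9 else 1 / 12) \<le> ereal (list_norm as)"
    using list_norm_ge[of as n] unfolding ereal_less_eq(3) by (cases "3 \<le> n") simp_all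
qed

lemma G_le: "n = 1 \<or> n = 2 \<Longrightarrow> G n \<le> ereal (1 / 12)"
proof -
  assume "n = 1 \<or> n = 2"
  then have "[1] \<in> nondegenerate_lists n \<or> [1, -2] \<in> nondegenerate_lists n"
    by (auto simp: nondegenerate_lists_def degenerate_def)
  then show ?thesis unfolding G_def by (auto intro: INF_lower2 simp: list_norm_examples)
qed

lemma Gt_ge: "1 \<le> n \<Longrightarrow> ereal (if 5 \<le> n then 7 / 36 else 1 / 6) \<le> Gt n"
  unfolding Gt_def Gt_dim_def
\<comment> \<open>For a lower bound on the supremum the empty family of subspaces suffices.\<close>
proof (rule SUP_upper2[of "{}"])
  assume n: "1 \<le> n"
  show "ereal (if 5 \<le> n then 7 / 36 else 1 / 6) \<le> (INF as\<in>{as \<in> nondegenerate_lists n.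
      sum_list as = 0 \<and> list_point as \<notin> \<Union>{}}. ereal (list_norm as))"
  proof (rule INF_greatest)
    fix as assume "as \<in> {as \<in> nondegenerate_lists n. sum_list as = 0 \<and> list_point as \<notin> \<Union>{}}"
    then show "ereal (if 5 \<le> n then 7 / 36 else 1 / 6) \<le> ereal (list_norm as)"
      using list_norm_zero_sum_ge[of as n] n unfolding ereal_less_eq(3)
      by (cases "5 \<le> n") simp_all
  qed
qed simp

text \<open>A subspace of dimension 0 contains only the origin, which is not the point of a
  non-empty list of non-zero entries, so no family excludes such a list.\<close>

lemma Gt_le:
  assumes as: "as \<in> nondegenerate_lists n" "1 \<le> n" "sum_list as = 0"
  shows "Gt n \<le> ereal (list_norm as)"
  unfolding Gt_def Gt_dim_def
proof (intro SUP_least INF_lower CollectI conjI as(1,3))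
  fix \<V> assume V: "\<V> \<in> {\<V>. finite \<V> \<and> \<V> \<subseteq> subspaces_upto n 0}"
  show "list_point as \<notin> \<Union>\<V>"
  proof
    assume "list_point as \<in> \<Union>\<V>"
    then have "list_point as = 0" using V subspaces_upto_0 by blast
    then have "lookup (list_point as) 0 = 0" by simp
    moreover have "length as = n" "\<forall>a\<in>set as. a \<noteq> 0"
      using as(1) by (auto simp: nondegenerate_lists_def)
    ultimately show False
      using as(2) by (auto simp: list_point_def nth_default_def split: if_splits)
  qed
qed

lemma replicate_nondegenerate: "replicate n 1 \<in> nondegenerate_lists n"
  by (auto simp: nondegenerate_lists_def degenerate_def)

text \<open>The list \<open>replicate n 1\<close> makes the infimum finite, so adding \<epsilon> is
  a strict increase.\<close>

lemma G_approx:
  assumes "1 \<le> n" "0 < \<epsilon>"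
  obtains as where "as \<in> nondegenerate_lists n" "ereal (list_norm as) \<le> G n + ereal \<epsilon>"
proof -
  have "G n \<le> ereal (list_norm (replicate n 1))"
    unfolding G_def by (intro INF_lower replicate_nondegenerate)
  moreover have "0 \<le> G n"
    using G_ge[OF assms(1)] by (rule order_trans[rotated]) auto
  ultimately have "\<bar>G n\<bar> \<noteq> \<infinity>" by auto
  then have "G n < G n + ereal \<epsilon>" using assms(2) by (cases "G n") auto
  then obtain as where "as \<in> nondegenerate_lists n" "ereal (list_norm as) < G n + ereal \<epsilon>"
    unfolding G_def INF_less_iff by blast
  then show ?thesis using that by force
qed

section \<open>Upper bound for the dimension-restricted infimum\<close>


text \<open>The ambient type is infinite-dimensional, where \<open>card\<close> and
  \<open>dim\<close> alone do not give finiteness; it comes from the inclusion in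
  \<open>real_space n\<close>.\<close>

lemma subspace_finite_basis:
  assumes "V \<in> subspaces_upto n d"
  obtains B where "B \<subseteq> V" "independent B" "V = span B" "finite B" "card B \<le> d"
proof -
  have V: "subspace V" "V \<subseteq> real_space n" "dim V \<le> d"
    using assms by (auto simp: subspaces_upto_def)
  obtain B where B: "B \<subseteq> V" "independent B" "V \<subseteq> span B" "card B = dim V"
    using basis_exists by blast
  have "B \<subseteq> span ((\<lambda>i. single i (1::real)) ` {..<n})"
    using B(1) V(2) unfolding real_space_span by blast
  then have "finite B"
    using independent_span_bound[of "(\<lambda>i. single i (1::real)) ` {..<n}" B] B(2) by simp
  moreover have "V = span B" using B(1,3) V(1) by (intro equalityI span_minimal)
  ultimately show ?thesis using that B V(3) by auto
qed

lemma independent_card_le_subspaces_upto: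
  assumes "V \<in> subspaces_upto n d" "A \<subseteq> V" "independent A"
  shows "card A \<le> d"
proof -
  obtain B where B: "V = span B" "finite B" "card B \<le> d"
    using subspace_finite_basis[OF assms(1)] by blast
  then have "card A \<le> card B" using independent_span_bound[of B A] assms(2,3) by simp
  with B(3) show ?thesis by simp
qed

text \<open>A linear functional that vanishes on V and is 1 at \<open>A c\<close> turns membership
  into a polynomial equation in T whose coefficient of degree c is non-zero.\<close>

lemma moment_curve_finite:
  fixes A :: "nat \<Rightarrow> vec"
  assumes "V \<in> subspaces_upto n d" "c \<le> m" "A c \<notin> V"
  shows "finite {T::real. (\<Sum>c\<le>m. T ^ c *\<^sub>R A c) \<in> V}"
proof -
  obtain B where B: "independent B" "V = span B" "finite B"
    using subspace_finite_basis[OF assms(1)] by blast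
  have "independent (insert (A c) B)"
    using B assms(3) by (simp add: independent_insert)
  then obtain g :: "vec \<Rightarrow> real" where g: "linear g"
      "\<forall>x\<in>insert (A c) B. g x = (if x = A c then 1 else 0)"
    using linear_independent_extend[of "insert (A c) B" "\<lambda>x. if x = A c then 1 else 0"] by blast
  have notB: "A c \<notin> B" using assms(3) B(2) span_base by blast
  have g0: "g x = 0" if "x \<in> V" for x
  proof (rule linear_eq_0_on_span[OF g(1)])
    show "x \<in> span B" using that B(2) by simp
    fix y assume "y \<in> B"
    then show "g y = 0" using g(2) notB by auto
  qed
  have "finite {T::real. (\<Sum>c\<le>m. g (A c) * T ^ c) = 0}"
    using g(2) assms(2) by (subst polyfun_finite_roots) auto
  moreover have "{T. (\<Sum>c\<le>m. T ^ c *\<^sub>R A c) \<in> V} \<subseteq> {T. (\<Sum>c\<le>m. g (A c) * T ^ c) = 0}"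
  proof
    fix T assume "T \<in> {T. (\<Sum>c\<le>m. T ^ c *\<^sub>R A c) \<in> V}"
    then have "g (\<Sum>c\<le>m. T ^ c *\<^sub>R A c) = 0" using g0 by blast
    then show "T \<in> {T. (\<Sum>c\<le>m. g (A c) * T ^ c) = 0}"
      by (simp add: linear_sum[OF g(1)] linear_cmul[OF g(1)] mult.commute)
  qed
  ultimately show ?thesis by (rule rev_finite_subset)
qed

lemma gcd_ker_int_commute: "gcd_ker_int a b = gcd_ker_int b a"
  by (simp add: gcd_ker_int_def gcd.commute mult.commute)

lemma gcd_ker_int_le:
  assumes "a \<noteq> 0" "b \<noteq> 0"
  shows "\<bar>gcd_ker_int a b\<bar> \<le> \<bar>of_int a\<bar> / \<bar>of_int b\<bar>"
proof -
  have "gcd a b \<le> \<bar>a\<bar>" using assms(1) gcd_le1_int[of "\<bar>a\<bar>" b] by simp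
  then have "(of_int (gcd a b) :: real) \<le> \<bar>of_int a\<bar>" by linarith
  then have "(of_int (gcd a b))\<^sup>2 \<le> \<bar>of_int a :: real\<bar>\<^sup>2"
    by (intro power_mono) auto
  then have "(of_int (gcd a b))\<^sup>2 / \<bar>of_int a * of_int b :: real\<bar>
      \<le> \<bar>of_int a\<bar>\<^sup>2 / \<bar>of_int a * of_int b\<bar>"
    by (intro divide_right_mono) auto
  also have "\<dots> = \<bar>of_int a\<bar> / \<bar>of_int b\<bar>"
    using assms by (simp add: power2_eq_square abs_mult del: abs_mult_self_eq power2_abs)
  finally show ?thesis by (simp add: gcd_ker_int_def)
qed

lemma gcd_ker_int_scale: "c \<noteq> 0 \<Longrightarrow> gcd_ker_int (c * a) (c * b) = gcd_ker_int a b"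
proof -
  assume c: "c \<noteq> 0"
  have "gcd (c * a) (c * b) = \<bar>c\<bar> * gcd a b" by (simp add: gcd_mult_distrib_int)
  then have "(of_int (gcd (c * a) (c * b)) :: real)\<^sup>2 = (of_int c)\<^sup>2 * (of_int (gcd a b))\<^sup>2"
    by (simp add: power_mult_distrib)
  then show ?thesis using c by (simp add: gcd_ker_int_def power2_eq_square)
qed

text \<open>For i < j the kernel is at most |a|/|b| times T^(i - j), hence of order 1/T; for i = j
  the common power of T cancels.\<close>

lemma gcd_ker_int_powers_tendsto:
  assumes "a \<noteq> 0" "b \<noteq> 0"
  shows "(\<lambda>T. gcd_ker_int (int T ^ i * a) (int T ^ j * b))
    \<longlonglongrightarrow> (if i = j then gcd_ker_int a b else 0)"
proof -
  have less: "(\<lambda>T. gcd_ker_int (int T ^ i * a) (int T ^ j * b)) \<longlonglongrightarrow> 0"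
    if "i < j" "a \<noteq> 0" "b \<noteq> 0" for i j a b
  proof (rule Lim_null_comparison)
    show "\<forall>\<^sub>F T in sequentially. norm (gcd_ker_int (int T ^ i * a) (int T ^ j * b))
        \<le> \<bar>of_int a\<bar> / \<bar>of_int b\<bar> * (1 / real T)"
      using eventually_gt_at_top[of 0]
    proof eventually_elim
      fix T :: nat assume T: "0 < T"
      have "\<bar>gcd_ker_int (int T ^ i * a) (int T ^ j * b)\<bar>
          \<le> \<bar>of_int (int T ^ i * a)\<bar> / \<bar>of_int (int T ^ j * b)\<bar>"
        using that T by (intro gcd_ker_int_le) auto
      also have "\<dots> = \<bar>of_int a\<bar> / \<bar>of_int b\<bar> * (real T ^ i / real T ^ j)"
        by (simp add: abs_mult mult.commute)
      also have "\<dots> \<le> \<bar>of_int a\<bar> / \<bar>of_int b\<bar> * (1 / real T)"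
      proof (rule mult_left_mono)
        have "real T ^ i * real T \<le> real T ^ j"
          using T that(1) power_increasing[of "Suc i" j "real T"] by (simp add: mult.commute)
        then show "real T ^ i / real T ^ j \<le> 1 / real T"
          using T by (simp add: field_simps)
      qed simp
      finally show "norm (gcd_ker_int (int T ^ i * a) (int T ^ j * b))
          \<le> \<bar>of_int a\<bar> / \<bar>of_int b\<bar> * (1 / real T)" by simp
    qed
    show "(\<lambda>T. \<bar>of_int a\<bar> / \<bar>of_int b\<bar> * (1 / real T)) \<longlonglongrightarrow> 0"
      by (rule tendsto_mult_right_zero[OF lim_1_over_n])
  qed
  consider "i < j" | "j < i" | "i = j" by linarith
  then show ?thesis
  proof cases
    case 1
    then show ?thesis using less[OF 1 assms] by simp
  next
    case 2
    then show ?thesis using less[OF 2 assms(2,1)] by (simp add: gcd_ker_int_commute)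
  next
    case 3
    have "\<forall>\<^sub>F T in sequentially. gcd_ker_int (int T ^ i * a) (int T ^ j * b) = gcd_ker_int a b"
      using eventually_gt_at_top[of 0] by eventually_elim (simp add: 3 gcd_ker_int_scale)
    then show ?thesis using 3 by (simp add: tendsto_eventually)
  qed
qed

lemma tendsto_sum_list_map:
  fixes f :: "'a \<Rightarrow> 'b \<Rightarrow> real"
  assumes "\<And>x. x \<in> set xs \<Longrightarrow> (f x \<longlongrightarrow> g x) F"
  shows "((\<lambda>t. \<Sum>x\<leftarrow>xs. f x t) \<longlongrightarrow> (\<Sum>x\<leftarrow>xs. g x)) F"
  using assms by (induction xs) (auto intro: tendsto_add)

lemma sum_list_concat_map: "sum_list (map f (concat xss)) = (\<Sum>xs\<leftarrow>xss. sum_list (map f xs))"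
  for f :: "'a \<Rightarrow> 'b::comm_monoid_add"
  by (induction xss) auto

lemma lookup_list_point:
  "lookup (list_point as) i = (if i < length as then of_int (as ! i) else 0)"
  by (simp add: list_point_def nth_default_def)

text \<open>
  Scaling the \<open>c\<close>-th list by \<open>T\<^sup>c\<close> makes the cross terms of the norm vanish as \<open>T\<close> grows, while
  the resulting points lie on a moment curve, which meets a subspace of dimension at most
  \<open>d\<close> only finitely often.
\<close>

lemma G_dim_le_blocks:
  fixes bs :: "int list list"
  assumes len: "length bs = d + 1" and n: "n = sum_list (map length bs)"
    and bs: "\<And>b. b \<in> set bs \<Longrightarrow> b \<in> nondegenerate_lists (length b) \<and> b \<noteq> []"
  shows "G_dim n d \<le> ereal (\<Sum>b\<leftarrow>bs. list_norm b)"
proof -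
  \<comment> \<open>Each entry is tagged with the index of its block, which is the exponent of T it
    will receive.\<close>
  define ps where "ps = concat (map (\<lambda>c. map (Pair c) (bs ! c)) [0..<d + 1])"
  define asT where "asT T = map (\<lambda>(c, a). int T ^ c * a) ps" for T :: nat
  \<comment> \<open>Coefficient vectors of the moment curve: the point of \<open>asT T\<close> is
    the sum of \<open>A c\<close> weighted by the c-th power of T.\<close>
  define A where "A c = list_point (map (\<lambda>(c', a). if c' = c then a else 0) ps)" for c
  have ps_set: "c \<le> d \<and> a \<in> set (bs ! c)" if "(c, a) \<in> set ps" for c a
    using that by (auto simp: ps_def)
  have nz: "a \<noteq> 0" if "(c, a) \<in> set ps" for c a
  proof -
    have "bs ! c \<in> set bs" using ps_set[OF that] len by simp
    then show ?thesis using bs ps_set[OF that] unfolding nondegenerate_lists_def by blast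
  qed
  have len_ps: "length ps = n"
  proof -
    have "length ps = sum_list (map (\<lambda>c. length (bs ! c)) [0..<d + 1])"
      by (simp add: ps_def length_concat comp_def del: upt_Suc)
    also have "map (\<lambda>c. length (bs ! c)) [0..<d + 1] = map length bs"
      using len by (intro nth_equalityI) (auto simp del: upt_Suc)
    finally show ?thesis using n by simp
  qed
  have bs_map: "map (\<lambda>c. h (bs ! c)) [0..<d + 1] = map h bs" for h :: "int list \<Rightarrow> real"
    using len by (intro nth_equalityI) (auto simp del: upt_Suc)
  have if_out: "(\<Sum>a\<leftarrow>l. if P then h a else 0) = (if P then \<Sum>a\<leftarrow>l. h a else 0)"
    for l :: "int list" and h :: "int \<Rightarrow> real" and P
    by simp
  have pick: "(\<Sum>c'\<leftarrow>[0..<d + 1]. if c = c' then h c' else 0) = h c" if "c < d + 1"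
    for c and h :: "nat \<Rightarrow> real"
    using that by (simp add: sum_list_distinct_conv_sum_set del: upt_Suc)
  have limit: "(\<lambda>T. list_norm (asT T)) \<longlonglongrightarrow> (\<Sum>b\<leftarrow>bs. list_norm b)"
  proof -
    have "(\<lambda>T. (\<Sum>(c, a)\<leftarrow>ps. \<Sum>(c', a')\<leftarrow>ps. gcd_ker_int (int T ^ c * a) (int T ^ c' * a')) / 12)
        \<longlonglongrightarrow> (\<Sum>(c, a)\<leftarrow>ps. \<Sum>(c', a')\<leftarrow>ps. if c = c' then gcd_ker_int a a' else 0) / 12"
      by (intro tendsto_divide tendsto_const tendsto_sum_list_map)
        (auto simp: case_prod_beta intro!: tendsto_sum_list_map gcd_ker_int_powers_tendsto
          dest: nz)
    moreover have "\<forall>\<^sub>F T in sequentially. (\<Sum>(c, a)\<leftarrow>ps. \<Sum>(c', a')\<leftarrow>ps.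
        gcd_ker_int (int T ^ c * a) (int T ^ c' * a')) / 12 = list_norm (asT T)"
      using eventually_gt_at_top[of 0]
    proof eventually_elim
      fix T :: nat assume "0 < T"
      then have "\<forall>a\<in>set (asT T). a \<noteq> 0" by (auto simp: asT_def dest: nz)
      then show "(\<Sum>(c, a)\<leftarrow>ps. \<Sum>(c', a')\<leftarrow>ps. gcd_ker_int (int T ^ c * a) (int T ^ c' * a')) / 12
          = list_norm (asT T)"
        by (simp add: list_norm_eq asT_def comp_def case_prod_unfold)
    qed
    ultimately have "(\<lambda>T. list_norm (asT T))
        \<longlonglongrightarrow> (\<Sum>(c, a)\<leftarrow>ps. \<Sum>(c', a')\<leftarrow>ps. if c = c' then gcd_ker_int a a' else 0) / 12"
      using Lim_transform_eventually by fast
    also have "(\<Sum>(c, a)\<leftarrow>ps. \<Sum>(c', a')\<leftarrow>ps. if c = c' then gcd_ker_int a a' else 0)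
        = (\<Sum>c\<leftarrow>[0..<d + 1]. \<Sum>a\<leftarrow>bs ! c. \<Sum>c'\<leftarrow>[0..<d + 1]. if c = c' then
            (\<Sum>a'\<leftarrow>bs ! c'. gcd_ker_int a a') else 0)"
      unfolding ps_def sum_list_concat_map map_map comp_def
      by (simp add: if_out del: upt_Suc)
    also have "\<dots> = (\<Sum>c\<leftarrow>[0..<d + 1]. \<Sum>a\<leftarrow>bs ! c. \<Sum>a'\<leftarrow>bs ! c. gcd_ker_int a a')"
      by (rule arg_cong[where f = sum_list], rule map_cong[OF refl],
          rule arg_cong[where f = sum_list], rule map_cong[OF refl], rule pick)
        (simp del: upt_Suc)
    also have "\<dots> = (\<Sum>b\<leftarrow>bs. \<Sum>a\<leftarrow>b. \<Sum>a'\<leftarrow>b. gcd_ker_int a a')"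
      using bs_map[of "\<lambda>b. \<Sum>a\<leftarrow>b. \<Sum>a'\<leftarrow>b. gcd_ker_int a a'"] by (rule arg_cong)
    also have "\<dots> / 12 = (\<Sum>b\<leftarrow>bs. (\<Sum>a\<leftarrow>b. \<Sum>a'\<leftarrow>b. gcd_ker_int a a') / 12)"
      by (induction bs) (auto simp: add_divide_distrib)
    also have "\<dots> = (\<Sum>b\<leftarrow>bs. list_norm b)"
      using bs by (intro arg_cong[where f = sum_list] map_cong refl list_norm_eq[symmetric])
        (auto simp: nondegenerate_lists_def)
    finally show ?thesis .
  qed
  have nondeg: "\<forall>\<^sub>F T in sequentially. asT T \<in> nondegenerate_lists n"
  proof -
    \<comment> \<open>Once T exceeds every absolute value of an entry, scaled entries with different
      exponents have different absolute values, so a degenerate pair would have to lie in one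
      block.\<close>
    define M where "M = Max (insert 0 ((\<lambda>(c, a). nat \<bar>a\<bar>) ` set ps))"
    have M: "nat \<bar>a\<bar> \<le> M" if "(c, a) \<in> set ps" for c a
      unfolding M_def using that by (intro Max_ge) (auto intro!: image_eqI[of _ _ "(c, a)"])
    show ?thesis
      using eventually_gt_at_top[of M]
    proof eventually_elim
      fix T :: nat assume T: "M < T"
      have less: False if "(c, a) \<in> set ps" "(c', a') \<in> set ps" "c < c'"
          "\<bar>int T ^ c * a\<bar> = \<bar>int T ^ c' * a'\<bar>" for c a c' a'
      proof -
        have "int T ^ c * \<bar>a\<bar> = int T ^ c * (int T ^ (c' - c) * \<bar>a'\<bar>)"
          using that(3,4) by (simp add: abs_mult mult.assoc[symmetric] flip: power_add)
        then have "\<bar>a\<bar> = int T ^ (c' - c) * \<bar>a'\<bar>" using T by simp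
        moreover have "int T * 1 \<le> int T ^ (c' - c) * \<bar>a'\<bar>"
          using T that(3) nz[OF that(2)] power_increasing[of 1 "c' - c" "int T"]
          by (intro mult_mono) auto
        ultimately show False using M[OF that(1)] T by simp
      qed
      have "False" if "(c, a) \<in> set ps" "(c', a') \<in> set ps" "int T ^ c' * a' = - (int T ^ c * a)"
        for c a c' a'
      proof (cases "c = c'")
        case True
        then have "a' = - a" using that(3) T by (simp flip: mult_minus_right)
        moreover have "\<not> degenerate (bs ! c)"
          using bs[of "bs ! c"] ps_set[OF that(1)] len by (simp add: nondegenerate_lists_def)
        ultimately show False
          using ps_set[OF that(1)] ps_set[OF that(2)] True unfolding degenerate_def by blast
      next
        case False
        then show False using less[OF that(1,2)] less[OF that(2,1)] that(3) by (cases "c < c'") auto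
      qed
      then have "\<not> degenerate (asT T)" unfolding degenerate_def asT_def by fastforce
      then show "asT T \<in> nondegenerate_lists n"
        using T by (auto simp: nondegenerate_lists_def asT_def len_ps dest: nz)
    qed
  qed
  have avoid: "\<forall>\<^sub>F T in sequentially. list_point (asT T) \<notin> V" if V: "V \<in> subspaces_upto n d" for V
  proof -
    have delta: "(\<Sum>x\<le>d. h x * (if c = x then t else 0)) = h c * t" if "c \<le> d"
      for h :: "nat \<Rightarrow> real" and c t
    proof -
      have "(\<Sum>x\<le>d. h x * (if c = x then t else 0)) = (\<Sum>x\<le>d. if c = x then h x * t else 0)"
        by (intro sum.cong) auto
      then show ?thesis using that by simp
    qed
    have look: "lookup (A c) i = (if c' = c then of_int a else 0)"
      if "i < n" "ps ! i = (c', a)" for i c c' a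
      using that by (simp add: A_def lookup_list_point len_ps)
    have point: "list_point (asT T) = (\<Sum>c\<le>d. real T ^ c *\<^sub>R A c)" for T
    proof (rule poly_mapping_eqI)
      fix i
      show "lookup (list_point (asT T)) i = lookup (\<Sum>c\<le>d. real T ^ c *\<^sub>R A c) i"
      proof (cases "i < n")
        case True
        obtain c a where ca: "ps ! i = (c, a)" by force
        then have "c \<le> d" using True len_ps nth_mem ps_set by metis
        then show ?thesis
          using True ca by (simp add: lookup_list_point asT_def len_ps lookup_sum
              lookup_scaleR_real look delta)
      next
        case False
        then show ?thesis
          by (simp add: lookup_list_point asT_def A_def len_ps lookup_sum lookup_scaleR_real)
      qed
    qed
    have index: "\<exists>i a. i < n \<and> ps ! i = (c, a) \<and> a \<noteq> 0" if "c \<le> d" for c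
    proof -
      have "bs ! c \<noteq> []" using bs[of "bs ! c"] that len by simp
      then obtain a where "a \<in> set (bs ! c)" by (meson last_in_set)
      moreover have "c \<in> set [0..<d + 1]" using that by (simp del: upt_Suc)
      ultimately have "(c, a) \<in> set ps"
        unfolding ps_def set_concat set_map image_image by (intro UN_I[of c] imageI)
      then show ?thesis using nz len_ps by (metis in_set_conv_nth)
    qed
    have inj: "inj_on A {..d}"
    proof (rule inj_onI)
      fix c c' assume "c \<in> {..d}" "c' \<in> {..d}" "A c = A c'"
      moreover obtain i a where i: "i < n" "ps ! i = (c, a)" "a \<noteq> 0"
        using index[of c] \<open>c \<in> {..d}\<close> by auto
      ultimately show "c = c'" using look[OF i(1,2), of c] look[OF i(1,2), of c'] by (auto split: if_splits)
    qed
    \<comment> \<open>The vectors \<open>A c\<close> have disjoint non-empty supports, so these d +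
      1 vectors cannot all lie in V.\<close>
    have indep: "independent (A ` {..d})"
    proof (rule independent_if_scalars_zero)
      fix f x assume 0: "(\<Sum>y\<in>A ` {..d}. f y *\<^sub>R y) = 0" and "x \<in> A ` {..d}"
      then obtain c where c: "x = A c" "c \<le> d" by auto
      obtain i a where i: "i < n" "ps ! i = (c, a)" "a \<noteq> 0" using index[OF c(2)] by blast
      have "0 = lookup (\<Sum>c'\<le>d. f (A c') *\<^sub>R A c') i"
        using 0 by (simp add: sum.reindex[OF inj])
      also have "\<dots> = f (A c) * of_int a"
        using c(2) by (simp add: lookup_sum lookup_scaleR_real look[OF i(1,2)] delta)
      finally show "f x = 0" using c i(3) by simp
    qed simp
    have card: "card (A ` {..d}) = Suc d" using inj by (simp add: card_image)
    have "\<not> A ` {..d} \<subseteq> V"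
    proof
      assume "A ` {..d} \<subseteq> V"
      from independent_card_le_subspaces_upto[OF V this indep] card show False by simp
    qed
    then obtain c where "c \<le> d" "A c \<notin> V" by auto
    then have "finite {T::real. (\<Sum>c\<le>d. T ^ c *\<^sub>R A c) \<in> V}" using V by (intro moment_curve_finite)
    then have "finite (real -` {T. (\<Sum>c\<le>d. T ^ c *\<^sub>R A c) \<in> V})"
      by (intro finite_vimageI) (auto intro: inj_onI)
    then have "\<forall>\<^sub>F T in cofinite. T \<notin> real -` {T. (\<Sum>c\<le>d. T ^ c *\<^sub>R A c) \<in> V}"
      by (simp add: eventually_cofinite)
    then show ?thesis by (simp add: cofinite_eq_sequentially point)
  qed
  have "length xs \<le> sum_list (map length xs)" if "\<And>b. b \<in> set xs \<Longrightarrow> b \<noteq> []"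
    for xs :: "int list list"
    using that
  proof (induction xs)
    case (Cons a xs)
    have "1 \<le> length a" using Cons.prems[of a] by (cases a) auto
    moreover have "length xs \<le> sum_list (map length xs)" using Cons by simp
    ultimately show ?case by simp
  qed simp
  then have "length bs \<le> n" using bs n by blast
  then have "d < n" using len by simp
  then show ?thesis
    unfolding G_dim_def
  proof (simp, intro SUP_least)
    fix \<V> assume "\<V> \<in> {\<V>. finite \<V> \<and> \<V> \<subseteq> subspaces_upto n d}"
    then have V: "finite \<V>" "\<V> \<subseteq> subspaces_upto n d" by auto
    have "\<forall>\<^sub>F T in sequentially. \<forall>V\<in>\<V>. list_point (asT T) \<notin> V"
      using V avoid by (intro eventually_ball_finite) auto
    with nondeg have "\<forall>\<^sub>F T in sequentially.
        (INF as\<in>{as \<in> nondegenerate_lists n. \<forall>V\<in>\<V>. list_point as \<notin> V}. ereal (list_norm as))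
        \<le> ereal (list_norm (asT T))"
      by eventually_elim (rule INF_lower, simp)
    moreover have "(\<lambda>T. ereal (list_norm (asT T))) \<longlonglongrightarrow> ereal (\<Sum>b\<leftarrow>bs. list_norm b)"
      using limit by simp
    ultimately show "(INF as\<in>{as \<in> nondegenerate_lists n. \<forall>V\<in>\<V>. list_point as \<notin> V}.
        ereal (list_norm as)) \<le> ereal (\<Sum>b\<leftarrow>bs. list_norm b)"
      by (intro tendsto_lowerbound[of "\<lambda>T. ereal (list_norm (asT T))"]) auto
  qed
qed

section \<open>Clusters\<close>


lemma ereal_sum_list: "ereal (\<Sum>x\<leftarrow>xs. f x) = (\<Sum>x\<leftarrow>xs. ereal (f x))"
  by (induction xs) (simp_all flip: plus_ereal.simps(1))

text \<open>Lists of the prescribed lengths, each within \<epsilon>/(d + 1) of its infimum, are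
  combined by \<open>G_dim_le_blocks\<close>.\<close>

lemma G_dim_le:
  assumes "ls \<in> compositions n (d + 1)"
  shows "G_dim n d \<le> (\<Sum>l\<leftarrow>ls. G l)"
proof (rule ereal_le_epsilon2)
  fix \<epsilon> :: real assume "0 < \<epsilon>"
  define \<epsilon>' where "\<epsilon>' = \<epsilon> / (d + 1)"
  have "0 < \<epsilon>'" using \<open>0 < \<epsilon>\<close> by (simp add: \<epsilon>'_def)
  have ls: "length ls = d + 1" "sum_list ls = n" "\<And>l. l \<in> set ls \<Longrightarrow> 1 \<le> l"
    using assms by (auto simp: compositions_def)
  have "\<forall>l\<in>set ls. \<exists>as. as \<in> nondegenerate_lists l \<and> ereal (list_norm as) \<le> G l + ereal \<epsilon>'"
  proof
    fix l assume "l \<in> set ls"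
    then have "1 \<le> l" by (rule ls(3))
    then obtain as where "as \<in> nondegenerate_lists l" "ereal (list_norm as) \<le> G l + ereal \<epsilon>'"
      using \<open>0 < \<epsilon>'\<close> by (rule G_approx)
    then show "\<exists>as. as \<in> nondegenerate_lists l \<and> ereal (list_norm as) \<le> G l + ereal \<epsilon>'" by blast
  qed
  then obtain b where b: "\<And>l. l \<in> set ls \<Longrightarrow> b l \<in> nondegenerate_lists l"
      "\<And>l. l \<in> set ls \<Longrightarrow> ereal (list_norm (b l)) \<le> G l + ereal \<epsilon>'"
    using bchoice by (metis (no_types, lifting))
  have len_b: "length (b l) = l" if "l \<in> set ls" for l
    using b(1)[OF that] by (simp add: nondegenerate_lists_def)
  have "G_dim n d \<le> ereal (\<Sum>b\<leftarrow>map b ls. list_norm b)"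
  proof (rule G_dim_le_blocks)
    show "length (map b ls) = d + 1" using ls(1) by simp
    have "map length (map b ls) = ls" using len_b by (simp add: map_idI)
    then show "n = sum_list (map length (map b ls))" using ls(2) by simp
    fix c assume "c \<in> set (map b ls)"
    then obtain l where l: "l \<in> set ls" "c = b l" by auto
    then have "length c = l" "1 \<le> l" using len_b ls(3) by auto
    moreover have "c \<in> nondegenerate_lists l" using b(1) l by simp
    ultimately show "c \<in> nondegenerate_lists (length c) \<and> c \<noteq> []" by auto
  qed
  also have "\<dots> = (\<Sum>l\<leftarrow>ls. ereal (list_norm (b l)))"
    unfolding ereal_sum_list by (simp add: comp_def)
  also have "\<dots> \<le> (\<Sum>l\<leftarrow>ls. G l + ereal \<epsilon>')"
    by (intro sum_list_mono b(2))
  also have "\<dots> = (\<Sum>l\<leftarrow>ls. G l) + (\<Sum>l\<leftarrow>ls. ereal \<epsilon>')"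
    by (rule sum_list_addf)
  also have "(\<Sum>l\<leftarrow>ls. ereal \<epsilon>') = ereal \<epsilon>"
    unfolding ereal_sum_list[symmetric] by (simp add: sum_list_triv ls(1) \<epsilon>'_def)
  finally show "G_dim n d \<le> (\<Sum>l\<leftarrow>ls. G l) + ereal \<epsilon>" .
qed

section \<open>Finitely many ratios inside a cluster\<close>

definition ratios :: "real \<Rightarrow> real set" where
  "ratios \<delta> = (\<lambda>(p, q). of_int p / of_int q) ` ({-\<lceil>1 / \<delta>\<rceil>..\<lceil>1 / \<delta>\<rceil>} \<times> {-\<lceil>1 / \<delta>\<rceil>..\<lceil>1 / \<delta>\<rceil>})"

lemma finite_ratios: "finite (ratios \<delta>)"
  by (simp add: ratios_def)

text \<open>If a/b is a'/b' in lowest terms, the kernel is 1/(a' b'), so |a'| and |b'| are at most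
  1/\<delta>.\<close>

lemma ratio_in_ratios:
  assumes "a \<noteq> 0" "b \<noteq> 0" "0 < \<delta>" "\<delta> \<le> \<bar>gcd_ker_int a b\<bar>"
  shows "of_int a / of_int b \<in> ratios \<delta>"
proof -
  define g where "g = gcd a b"
  obtain a' b' where ab: "a = g * a'" "b = g * b'"
    unfolding g_def by (meson dvdE gcd_dvd1 gcd_dvd2)
  have "g \<noteq> 0" using assms(1) by (simp add: g_def)
  have "a' \<noteq> 0" "b' \<noteq> 0" using ab assms(1,2) by auto
  have "gcd_ker_int a b = 1 / (of_int a' * of_int b')"
    using \<open>g \<noteq> 0\<close> unfolding gcd_ker_int_def g_def[symmetric] by (simp add: ab power2_eq_square)
  then have "\<delta> \<le> 1 / (\<bar>of_int a'\<bar> * \<bar>of_int b'\<bar>)"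
    using assms(4) by (simp add: abs_mult)
  then have "\<delta> * (\<bar>of_int a'\<bar> * \<bar>of_int b'\<bar>) \<le> 1"
    using \<open>a' \<noteq> 0\<close> \<open>b' \<noteq> 0\<close> by (subst (asm) pos_le_divide_eq) auto
  then have prod: "\<bar>of_int a'\<bar> * \<bar>of_int b'\<bar> \<le> 1 / \<delta>"
    using assms(3) by (simp add: field_simps)
  have one: "1 \<le> \<bar>of_int a' :: real\<bar>" "1 \<le> \<bar>of_int b' :: real\<bar>"
    using \<open>a' \<noteq> 0\<close> \<open>b' \<noteq> 0\<close> by linarith+
  have "\<bar>of_int a'\<bar> * 1 \<le> \<bar>of_int a'\<bar> * \<bar>of_int b' :: real\<bar>"
    using one by (intro mult_left_mono) auto
  moreover have "1 * \<bar>of_int b'\<bar> \<le> \<bar>of_int a'\<bar> * \<bar>of_int b' :: real\<bar>"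
    using one by (intro mult_right_mono) auto
  ultimately have "\<bar>of_int a'\<bar> \<le> 1 / \<delta>" "\<bar>of_int b'\<bar> \<le> 1 / \<delta>" using prod by linarith+
  then have "\<bar>a'\<bar> \<le> \<lceil>1 / \<delta>\<rceil>" "\<bar>b'\<bar> \<le> \<lceil>1 / \<delta>\<rceil>" by linarith+
  moreover have "of_int a / of_int b = (of_int a' / of_int b' :: real)"
    using \<open>g \<noteq> 0\<close> by (simp add: ab)
  ultimately show ?thesis unfolding ratios_def by (intro image_eqI[of _ _ "(a', b')"]) auto
qed

fun ratio_products :: "real \<Rightarrow> nat \<Rightarrow> real set" where
  "ratio_products \<delta> 0 = {1}"
| "ratio_products \<delta> (Suc m) = (\<lambda>(x, y). x * y) ` (ratio_products \<delta> m \<times> ratios \<delta>)"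

lemma ratio_products_mult:
  "x \<in> ratio_products \<delta> m \<Longrightarrow> y \<in> ratios \<delta> \<Longrightarrow> x * y \<in> ratio_products \<delta> (Suc m)"
  by force

lemma finite_ratio_products: "finite (ratio_products \<delta> m)"
  by (induction m) (auto simp: finite_ratios)

text \<open>The first component sends an index to the representative of its cluster, the second
  gives the ratio of the two entries. Paths need at most n * n edges, and taking extensional
  functions makes the set finite.\<close>

definition cluster_data :: "real \<Rightarrow> nat \<Rightarrow> ((nat \<Rightarrow> nat) \<times> (nat \<Rightarrow> real)) set" where
  "cluster_data \<delta> n = ({..<n} \<rightarrow>\<^sub>E {..<n}) \<times> ({..<n} \<rightarrow>\<^sub>E (\<Union>m\<le>n * n. ratio_products \<delta> m))"

lemma finite_cluster_data: "finite (cluster_data \<delta> n)"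
  unfolding cluster_data_def
  by (intro finite_cartesian_product finite_PiE) (auto simp: finite_ratio_products)

text \<open>
  The clusters are the connected components of the graph joining indices whose entries have
  a kernel value of at least \<open>\<delta>\<close>; adjacent entries have one of finitely many ratios.
\<close>

lemma clusters:
  assumes "length as = n" "0 \<notin> set as" "0 < \<delta>"
  obtains rep \<rho> where "(rep, \<rho>) \<in> cluster_data \<delta> n"
    "\<And>i. i < n \<Longrightarrow> of_int (as ! i) = \<rho> i * of_int (as ! rep i)"
    "\<And>i j. i < n \<Longrightarrow> j < n \<Longrightarrow> rep i \<noteq> rep j \<Longrightarrow> \<bar>gcd_ker_int (as ! i) (as ! j)\<bar> \<le> \<delta>"
proof -
  have nz: "as ! i \<noteq> 0" if "i < n" for i using assms(1,2) that by (metis nth_mem)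
  define E where "E = {(i, j). i < n \<and> j < n \<and> \<delta> \<le> \<bar>gcd_ker_int (as ! i) (as ! j)\<bar>}"
  have E_sub: "E \<subseteq> {..<n} \<times> {..<n}" by (auto simp: E_def)
  have "finite E" by (rule finite_subset[OF E_sub]) simp
  have "card E \<le> n * n" using card_mono[OF _ E_sub] by (simp add: card_cartesian_product)
  have "sym E" by (auto simp: E_def sym_def gcd_ker_int_commute)
  then have symE: "sym (E\<^sup>*)" by (rule sym_rtrancl)
  have chain: "j < n \<and> of_int (as ! i) / of_int (as ! j) \<in> ratio_products \<delta> m"
    if "(i, j) \<in> E ^^ m" "i < n" for i j m
    using that
  proof (induction m arbitrary: j)
    case 0
    then show ?case using nz by simp
  next
    case (Suc m)
    then obtain k where k: "(i, k) \<in> E ^^ m" "(k, j) \<in> E" by auto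
    then have kj: "k < n" "j < n" "\<delta> \<le> \<bar>gcd_ker_int (as ! k) (as ! j)\<bar>" by (auto simp: E_def)
    have "of_int (as ! i) / of_int (as ! k) \<in> ratio_products \<delta> m"
      using Suc k by blast
    moreover have "of_int (as ! k) / of_int (as ! j) \<in> ratios \<delta>"
      using kj nz assms(3) by (intro ratio_in_ratios) auto
    ultimately have "(of_int (as ! i) / of_int (as ! k)) * (of_int (as ! k) / of_int (as ! j))
        \<in> ratio_products \<delta> (Suc m)"
      by (rule ratio_products_mult)
    then show ?case using nz[OF kj(1)] kj(2) by simp
  qed
  \<comment> \<open>The least connected index is canonical: connected indices get the same
    representative.\<close>
  define R where "R i = (LEAST j. (i, j) \<in> E\<^sup>*)" for i
  have R: "(i, R i) \<in> E\<^sup>*" "R i \<le> i" for i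
    unfolding R_def by (rule LeastI[of _ i], simp) (rule Least_le, simp)
  have R_eq: "R i = R j" if "(i, j) \<in> E\<^sup>*" for i j
  proof -
    have "(i, k) \<in> E\<^sup>* \<longleftrightarrow> (j, k) \<in> E\<^sup>*" for k
      using that symE by (meson rtrancl_trans symD)
    then show ?thesis by (simp add: R_def)
  qed
  have ratio: "of_int (as ! i) / of_int (as ! R i) \<in> (\<Union>m\<le>n * n. ratio_products \<delta> m)"
    if "i < n" for i
  proof -
    obtain m where "m \<le> card E" "(i, R i) \<in> E ^^ m"
      using R(1)[of i] unfolding rtrancl_finite_eq_relpow[OF \<open>finite E\<close>] by blast
    then show ?thesis using chain that \<open>card E \<le> n * n\<close> by (meson UN_I atMost_iff order_trans)
  qed
  show ?thesis
  proof (rule that[of "restrict R {..<n}" "restrict (\<lambda>i. of_int (as ! i) / of_int (as ! R i)) {..<n}"])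
    show "(restrict R {..<n}, restrict (\<lambda>i. of_int (as ! i) / of_int (as ! R i)) {..<n})
        \<in> cluster_data \<delta> n"
      unfolding cluster_data_def using ratio R(2) by (auto intro: le_less_trans)
  next
    fix i assume "i < n"
    moreover have "R i < n" using R(2)[of i] \<open>i < n\<close> by simp
    ultimately show "real_of_int (as ! i) = restrict (\<lambda>i. of_int (as ! i) / of_int (as ! R i)) {..<n} i
        * of_int (as ! restrict R {..<n} i)"
      using nz by simp
  next
    fix i j assume "i < n" "j < n" "restrict R {..<n} i \<noteq> restrict R {..<n} j"
    then have "(i, j) \<notin> E" using R_eq[of i j] by auto
    then show "\<bar>gcd_ker_int (as ! i) (as ! j)\<bar> \<le> \<delta>"
      using \<open>i < n\<close> \<open>j < n\<close> by (auto simp: E_def)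
  qed
qed

section \<open>Subspaces cut out by cluster data\<close>

definition cluster_space :: "nat \<Rightarrow> (nat \<Rightarrow> nat) \<Rightarrow> (nat \<Rightarrow> real) \<Rightarrow> vec set" where
  "cluster_space n rep \<rho> =
    {v \<in> real_space n. \<forall>i<n. lookup v i = \<rho> i * lookup v (rep i)}"

definition zero_sum_space :: "nat \<Rightarrow> (nat \<Rightarrow> nat) \<Rightarrow> (nat \<Rightarrow> real) \<Rightarrow> vec set" where
  "zero_sum_space n rep \<rho> = {v \<in> cluster_space n rep \<rho>. (\<Sum>i<n. lookup v i) = 0}"

lemma subspace_cluster_space: "subspace (cluster_space n rep \<rho>)"
proof -
  have "subspace (real_space n)" by (simp add: real_space_span)
  then show ?thesis
    unfolding cluster_space_def subspace_def by (auto simp: vec_lookup algebra_simps)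
qed

lemma subspace_zero_sum_space: "subspace (zero_sum_space n rep \<rho>)"
  using subspace_cluster_space[of n rep \<rho>] unfolding zero_sum_space_def subspace_def
  by (auto simp: vec_lookup sum.distrib simp flip: sum_distrib_left)

definition cluster_vec :: "nat \<Rightarrow> (nat \<Rightarrow> nat) \<Rightarrow> (nat \<Rightarrow> real) \<Rightarrow> nat \<Rightarrow> vec" where
  "cluster_vec n rep \<rho> c = (\<Sum>i<n. single i (if rep i = c then \<rho> i else 0))"

lemma lookup_cluster_vec:
  "lookup (cluster_vec n rep \<rho> c) k = (if k < n \<and> rep k = c then \<rho> k else 0)"
proof -
  have "lookup (cluster_vec n rep \<rho> c) k
      = (\<Sum>i<n. if i = k then (if rep i = c then \<rho> i else 0) else 0)"
    unfolding cluster_vec_def lookup_sum lookup_single when_def by (intro sum.cong) auto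
  then show ?thesis by simp
qed

lemma cluster_space_expand:
  assumes "v \<in> cluster_space n rep \<rho>"
  shows "v = (\<Sum>c\<in>rep ` {..<n}. lookup v c *\<^sub>R cluster_vec n rep \<rho> c)"
proof (rule poly_mapping_eqI)
  fix k
  have "lookup (\<Sum>c\<in>rep ` {..<n}. lookup v c *\<^sub>R cluster_vec n rep \<rho> c) k
      = (\<Sum>c\<in>rep ` {..<n}. if k < n \<and> rep k = c then lookup v c * \<rho> k else 0)"
    unfolding lookup_sum lookup_scaleR_real lookup_cluster_vec by (intro sum.cong) auto
  also have "\<dots> = lookup v k"
  proof (cases "k < n")
    case True
    then have "(\<Sum>c\<in>rep ` {..<n}. if k < n \<and> rep k = c then lookup v c * \<rho> k else 0)
        = lookup v (rep k) * \<rho> k" by simp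
    then show ?thesis using True assms by (simp add: cluster_space_def mult.commute)
  next
    case False
    then show ?thesis using assms by (auto simp: cluster_space_def real_space_def in_keys_iff)
  qed
  finally show "lookup v k = lookup (\<Sum>c\<in>rep ` {..<n}. lookup v c *\<^sub>R cluster_vec n rep \<rho> c) k" ..
qed

lemma dim_cluster_space: "dim (cluster_space n rep \<rho>) \<le> card (rep ` {..<n})"
proof -
  let ?B = "cluster_vec n rep \<rho> ` (rep ` {..<n})"
  have "cluster_space n rep \<rho> \<subseteq> span ?B"
  proof
    fix v assume "v \<in> cluster_space n rep \<rho>"
    then have "v = (\<Sum>c\<in>rep ` {..<n}. lookup v c *\<^sub>R cluster_vec n rep \<rho> c)"
      by (rule cluster_space_expand)
    also have "\<dots> \<in> span ?B" by (intro span_sum span_scale span_base) auto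
    finally show "v \<in> span ?B" .
  qed
  then have "dim (cluster_space n rep \<rho>) \<le> card ?B" by (intro dim_le_card) auto
  also have "\<dots> \<le> card (rep ` {..<n})" by (intro card_image_le) simp
  finally show ?thesis .
qed

text \<open>With \<sigma> c the sum of \<rho> over cluster c, the condition says that the sum of
  \<open>lookup v c * \<sigma> c\<close> over all representatives is 0. If some \<sigma> c is
  non-zero, the coordinate at c is determined by the others and one dimension is lost.\<close>

lemma dim_zero_sum_space:
  shows "dim (zero_sum_space n rep \<rho>) \<le> card (rep ` {..<n})"
    and "c \<in> rep ` {..<n} \<Longrightarrow> (\<Sum>i | i < n \<and> rep i = c. \<rho> i) \<noteq> 0 \<Longrightarrow>
      dim (zero_sum_space n rep \<rho>) < card (rep ` {..<n})"
proof -
  let ?C = "rep ` {..<n}" and ?b = "cluster_vec n rep \<rho>"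
  define \<sigma> where "\<sigma> c = (\<Sum>i | i < n \<and> rep i = c. \<rho> i)" for c
  have "zero_sum_space n rep \<rho> \<subseteq> span (?b ` ?C)"
  proof
    fix v assume "v \<in> zero_sum_space n rep \<rho>"
    then have "v = (\<Sum>c\<in>?C. lookup v c *\<^sub>R ?b c)"
      by (intro cluster_space_expand) (simp add: zero_sum_space_def)
    also have "\<dots> \<in> span (?b ` ?C)" by (intro span_sum span_scale span_base) auto
    finally show "v \<in> span (?b ` ?C)" .
  qed
  then have "dim (zero_sum_space n rep \<rho>) \<le> card (?b ` ?C)" by (intro dim_le_card) auto
  also have "\<dots> \<le> card ?C" by (intro card_image_le) simp
  finally show "dim (zero_sum_space n rep \<rho>) \<le> card ?C" .
  show "dim (zero_sum_space n rep \<rho>) < card ?C"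
    if c: "c \<in> ?C" "(\<Sum>i | i < n \<and> rep i = c. \<rho> i) \<noteq> 0"
  proof -
    have \<sigma>c: "\<sigma> c \<noteq> 0" using c(2) by (simp add: \<sigma>_def)
    \<comment> \<open>Each remaining spanning vector is corrected by a multiple of
      \<open>?b c\<close> so that its coordinates sum to 0.\<close>
    define B where "B = (\<lambda>c'. ?b c' - (\<sigma> c' / \<sigma> c) *\<^sub>R ?b c) ` (?C - {c})"
    have "zero_sum_space n rep \<rho> \<subseteq> span B"
    proof
      fix v assume v: "v \<in> zero_sum_space n rep \<rho>"
      then have exp: "v = (\<Sum>c\<in>?C. lookup v c *\<^sub>R ?b c)"
        by (intro cluster_space_expand) (simp add: zero_sum_space_def)
      have "0 = (\<Sum>i<n. lookup v i)" using v by (simp add: zero_sum_space_def)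
      also have "\<dots> = (\<Sum>i<n. \<rho> i * lookup v (rep i))"
        using v by (intro sum.cong) (auto simp: zero_sum_space_def cluster_space_def)
      also have "\<dots> = (\<Sum>c'\<in>?C. \<Sum>i | i \<in> {..<n} \<and> rep i = c'. \<rho> i * lookup v (rep i))"
        by (rule sum.image_gen) simp
      also have "\<dots> = (\<Sum>c'\<in>?C. lookup v c' * \<sigma> c')"
        by (simp add: \<sigma>_def sum_distrib_left mult.commute)
      finally have "(\<Sum>c'\<in>?C. lookup v c' * \<sigma> c') = 0" ..
      then have "lookup v c * \<sigma> c = - (\<Sum>c'\<in>?C - {c}. lookup v c' * \<sigma> c')"
        using c(1) by (simp add: sum.remove)
      then have vc: "lookup v c = - (\<Sum>c'\<in>?C - {c}. lookup v c' * \<sigma> c') / \<sigma> c"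
        using \<sigma>c by (simp add: field_simps)
      have "v = lookup v c *\<^sub>R ?b c + (\<Sum>c'\<in>?C - {c}. lookup v c' *\<^sub>R ?b c')"
        using exp c(1) by (metis (no_types, lifting) finite_imageI finite_lessThan sum.remove)
      also have "lookup v c *\<^sub>R ?b c = - (\<Sum>c'\<in>?C - {c}. (lookup v c' * (\<sigma> c' / \<sigma> c)) *\<^sub>R ?b c)"
        unfolding vc by (simp add: sum_divide_distrib flip: scaleR_sum_left scaleR_minus_left)
      also have "\<dots> + (\<Sum>c'\<in>?C - {c}. lookup v c' *\<^sub>R ?b c')
          = (\<Sum>c'\<in>?C - {c}. lookup v c' *\<^sub>R (?b c' - (\<sigma> c' / \<sigma> c) *\<^sub>R ?b c))"
        by (simp add: scaleR_diff_right sum_subtractf)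
      also have "\<dots> \<in> span B" by (intro span_sum span_scale span_base) (auto simp: B_def)
      finally show "v \<in> span B" .
    qed
    then have "dim (zero_sum_space n rep \<rho>) \<le> card B" by (intro dim_le_card) (auto simp: B_def)
    also have "\<dots> \<le> card (?C - {c})" unfolding B_def by (intro card_image_le) simp
    also have "\<dots> < card ?C" using c(1) by (intro card_Diff1_less) auto
    finally show ?thesis .
  qed
qed

lemma list_point_cluster_space:
  assumes "length as = n" "rep ` {..<n} \<subseteq> {..<n}"
    "\<And>i. i < n \<Longrightarrow> of_int (as ! i) = \<rho> i * of_int (as ! rep i)"
  shows "list_point as \<in> cluster_space n rep \<rho>"
proof -
  have "list_point as \<in> real_space n"
    using assms(1) by (auto simp: real_space_def in_keys_iff lookup_list_point split: if_splits)
  moreover have "rep i < n" if "i < n" for i using assms(2) that by auto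
  ultimately show ?thesis
    using assms(1,3) by (auto simp: cluster_space_def lookup_list_point)
qed

section \<open>Lower bounds\<close>


text \<open>There may be more clusters than blocks wanted. Surplus clusters are merged into the last
  block; with exactly k clusters nothing is merged.\<close>

lemma ex_coarsening:
  assumes "finite C" "1 \<le> k" "k \<le> card C"
  obtains h :: "'a \<Rightarrow> nat" where "h ` C = {..<k}" "card C = k \<longrightarrow> inj_on h C"
proof -
  obtain g where g: "bij_betw g C {0..<card C}" using ex_bij_betw_finite_nat[OF assms(1)] ..
  define h where "h x = min (k - 1) (g x)" for x
  have "h ` C = (\<lambda>m. min (k - 1) m) ` {0..<card C}"
    using g by (simp add: h_def bij_betw_def flip: image_image)
  also have "\<dots> = {..<k}"
  proof
    show "{..<k} \<subseteq> (\<lambda>m. min (k - 1) m) ` {0..<card C}"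
      using assms(3) by (auto intro!: image_eqI[of x _ x for x])
  qed (use assms(2) in auto)
  finally have "h ` C = {..<k}" .
  moreover have "inj_on h C" if "card C = k"
  proof (rule inj_onI)
    fix x y assume xy: "x \<in> C" "y \<in> C" "h x = h y"
    then have "g x < k" "g y < k" using g that by (auto simp: bij_betw_def)
    then have "g x = g y" using xy(3) by (simp add: h_def)
    then show "x = y" using g xy(1,2) by (auto simp: bij_betw_def inj_on_def)
  qed
  ultimately show ?thesis using that by blast
qed

lemma sum_list_filter_nth:
  fixes h :: "'a \<Rightarrow> 'b::comm_monoid_add"
  shows "(\<Sum>a\<leftarrow>map ((!) as) (filter P [0..<n]). h a) = (\<Sum>i | i < n \<and> P i. h (as ! i))"
proof -
  have "{i \<in> {0..<n}. P i} = {i. i < n \<and> P i}" by auto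
  then show ?thesis by (simp add: comp_def sum_list_distinct_conv_sum_set)
qed

text \<open>At most n * n cross terms are dropped, each of absolute value at most \<delta>; the 12
  is the one of \<open>list_norm_eq\<close>.\<close>

lemma list_norm_partition:
  assumes as: "length as = n" "0 \<notin> set as" and \<kappa>: "\<kappa> ` {..<n} = {..<k}"
    and cross: "\<And>i j. i < n \<Longrightarrow> j < n \<Longrightarrow> \<kappa> i \<noteq> \<kappa> j \<Longrightarrow> \<bar>gcd_ker_int (as ! i) (as ! j)\<bar> \<le> \<delta>"
    and \<delta>: "0 \<le> \<delta>"
  shows "(\<Sum>c<k. list_norm (map ((!) as) (filter (\<lambda>i. \<kappa> i = c) [0..<n])))
    \<le> list_norm as + real n * real n * \<delta> / 12"
proof -
  let ?I = "\<lambda>c. {i. i < n \<and> \<kappa> i = c}"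
  define K where "K i j = gcd_ker_int (as ! i) (as ! j)" for i j
  have block: "12 * list_norm (map ((!) as) (filter (\<lambda>i. \<kappa> i = c) [0..<n])) = (\<Sum>i\<in>?I c. \<Sum>j\<in>?I c. K i j)"
    for c
  proof -
    have "\<forall>a\<in>set (map ((!) as) (filter (\<lambda>i. \<kappa> i = c) [0..<n])). a \<noteq> 0"
      using as by (auto simp: in_set_conv_nth)
    from list_norm_eq[OF this] show ?thesis by (simp only: sum_list_filter_nth K_def)
  qed
  have "12 * list_norm as = (\<Sum>i<n. \<Sum>j<n. K i j)"
    using as by (subst list_norm_eq) (auto simp: K_def sum_list_sum_nth atLeast0LessThan)
  also have "\<dots> \<ge> (\<Sum>i<n. (\<Sum>j\<in>?I (\<kappa> i). K i j) - real n * \<delta>)"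
  proof (rule sum_mono)
    fix i assume i: "i \<in> {..<n}"
    have "(\<Sum>j\<in>?I (\<kappa> i). K i j) = (\<Sum>j<n. if \<kappa> j = \<kappa> i then K i j else 0)"
      by (subst sum.inter_filter[symmetric]) (auto intro: sum.cong)
    also have "\<dots> \<le> (\<Sum>j<n. K i j + \<delta>)"
    proof (rule sum_mono)
      fix j assume "j \<in> {..<n}"
      then show "(if \<kappa> j = \<kappa> i then K i j else 0) \<le> K i j + \<delta>"
        using cross[of i j] i \<delta> by (auto simp: K_def)
    qed
    also have "\<dots> = (\<Sum>j<n. K i j) + real n * \<delta>" by (simp add: sum.distrib)
    finally show "(\<Sum>j\<in>?I (\<kappa> i). K i j) - real n * \<delta> \<le> (\<Sum>j<n. K i j)" by simp
  qed
  finally have "(\<Sum>i<n. \<Sum>j\<in>?I (\<kappa> i). K i j) \<le> 12 * list_norm as + real n * real n * \<delta>"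
    by (simp add: sum_subtractf)
  also have "(\<Sum>i<n. \<Sum>j\<in>?I (\<kappa> i). K i j)
      = (\<Sum>c\<in>\<kappa> ` {..<n}. \<Sum>i | i \<in> {..<n} \<and> \<kappa> i = c. \<Sum>j\<in>?I (\<kappa> i). K i j)"
    by (rule sum.image_gen) simp
  also have "\<dots> = (\<Sum>c<k. \<Sum>i\<in>?I c. \<Sum>j\<in>?I c. K i j)"
    unfolding \<kappa> by simp
  also have "\<dots> = 12 * (\<Sum>c<k. list_norm (map ((!) as) (filter (\<lambda>i. \<kappa> i = c) [0..<n])))"
    by (simp only: sum_distrib_left block)
  finally show ?thesis by simp
qed

text \<open>Blocks are unions of clusters, so kernel values between different blocks stay small. The
  last conclusion serves the zero-sum case: with exactly k clusters every block is a single
  cluster.\<close>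

lemma cluster_blocks:
  fixes rep :: "nat \<Rightarrow> nat"
  assumes as: "as \<in> nondegenerate_lists n"
    and cross: "\<And>i j. i < n \<Longrightarrow> j < n \<Longrightarrow> rep i \<noteq> rep j \<Longrightarrow> \<bar>gcd_ker_int (as ! i) (as ! j)\<bar> \<le> \<delta>"
    and k: "1 \<le> k" "k \<le> card (rep ` {..<n})" and \<delta>: "0 \<le> \<delta>"
  obtains bs where "map length bs \<in> compositions n k"
    "\<forall>b\<in>set bs. b \<in> nondegenerate_lists (length b) \<and> 1 \<le> length b"
    "(\<Sum>b\<leftarrow>bs. list_norm b) \<le> list_norm as + real n * real n * \<delta> / 12"
    "card (rep ` {..<n}) = k \<longrightarrow> (\<forall>b\<in>set bs.
      \<exists>c\<in>rep ` {..<n}. sum_list b = (\<Sum>i | i < n \<and> rep i = c. as ! i))"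
proof -
  have len: "length as = n" and nz: "0 \<notin> set as" and nd: "\<not> degenerate as"
    using as by (auto simp: nondegenerate_lists_def)
  have "finite (rep ` {..<n})" by simp
  from ex_coarsening[OF this k] obtain h :: "nat \<Rightarrow> nat" where h: "h ` rep ` {..<n} = {..<k}"
    "card (rep ` {..<n}) = k \<longrightarrow> inj_on h (rep ` {..<n})" .
  define \<kappa> where "\<kappa> i = h (rep i)" for i
  have \<kappa>: "\<kappa> ` {..<n} = {..<k}" using h(1) by (simp add: \<kappa>_def image_image)
  define blk where "blk c = map ((!) as) (filter (\<lambda>i. \<kappa> i = c) [0..<n])" for c
  have blk_set: "set (blk c) \<subseteq> set as" for c using len by (auto simp: blk_def)
  have blk_len: "length (blk c) = card {i. i < n \<and> \<kappa> i = c}" for c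
  proof -
    have "length (blk c) = card (set (filter (\<lambda>i. \<kappa> i = c) [0..<n]))"
      unfolding blk_def length_map by (rule distinct_card[symmetric]) simp
    also have "set (filter (\<lambda>i. \<kappa> i = c) [0..<n]) = {i. i < n \<and> \<kappa> i = c}" by auto
    finally show ?thesis .
  qed
  have blk_pos: "1 \<le> length (blk c)" if "c < k" for c
  proof -
    have "c \<in> \<kappa> ` {..<n}" using that unfolding \<kappa> by simp
    then have "card {i. i < n \<and> \<kappa> i = c} \<noteq> 0" by auto
    then show ?thesis using blk_len[of c] by linarith
  qed
  show ?thesis
  proof (rule that[of "map blk [0..<k]"])
    have "sum_list (map length (map blk [0..<k])) = (\<Sum>c<k. card {i. i < n \<and> \<kappa> i = c})"
      by (simp add: comp_def blk_len sum_list_distinct_conv_sum_set atLeast0LessThan)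
    also have "\<dots> = (\<Sum>c\<in>\<kappa> ` {..<n}. \<Sum>i | i \<in> {..<n} \<and> \<kappa> i = c. 1)"
      unfolding \<kappa> by simp
    also have "\<dots> = (\<Sum>i<n. 1)" by (rule sum.image_gen[symmetric]) simp
    finally have "sum_list (map length (map blk [0..<k])) = n" by simp
    then show "map length (map blk [0..<k]) \<in> compositions n k"
      using blk_pos by (auto simp: compositions_def)
    show "\<forall>b\<in>set (map blk [0..<k]). b \<in> nondegenerate_lists (length b) \<and> 1 \<le> length b"
    proof
      fix b assume b: "b \<in> set (map blk [0..<k])"
      obtain c where c: "b = blk c" "c < k" using b by auto
      have "0 \<notin> set b" "\<not> degenerate b"
        using nz nd blk_set[of c] unfolding c(1) degenerate_def by blast+
      then show "b \<in> nondegenerate_lists (length b) \<and> 1 \<le> length b"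
        using blk_pos[OF c(2)] c(1) by (auto simp: nondegenerate_lists_def)
    qed
    have "(\<Sum>b\<leftarrow>map blk [0..<k]. list_norm b) = (\<Sum>c<k. list_norm (blk c))"
      by (simp add: comp_def sum_list_distinct_conv_sum_set atLeast0LessThan)
    also have "\<dots> \<le> list_norm as + real n * real n * \<delta> / 12"
      unfolding blk_def
    proof (rule list_norm_partition[OF len nz \<kappa> _ \<delta>])
      fix i j assume "i < n" "j < n" "\<kappa> i \<noteq> \<kappa> j"
      then show "\<bar>gcd_ker_int (as ! i) (as ! j)\<bar> \<le> \<delta>" by (intro cross) (auto simp: \<kappa>_def)
    qed
    finally show "(\<Sum>b\<leftarrow>map blk [0..<k]. list_norm b) \<le> list_norm as + real n * real n * \<delta> / 12" .
    show "card (rep ` {..<n}) = k \<longrightarrow> (\<forall>b\<in>set (map blk [0..<k]).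
      \<exists>c\<in>rep ` {..<n}. sum_list b = (\<Sum>i | i < n \<and> rep i = c. as ! i))"
    proof (intro impI ballI)
      fix b assume card: "card (rep ` {..<n}) = k" and b: "b \<in> set (map blk [0..<k])"
      obtain c' where c': "b = blk c'" "c' < k" using b by auto
      then have "c' \<in> h ` rep ` {..<n}" unfolding h(1) by simp
      then obtain c where c: "c \<in> rep ` {..<n}" "h c = c'" by blast
      have "sum_list b = (\<Sum>a\<leftarrow>blk c'. a)" by (simp add: c'(1))
      also have "\<dots> = (\<Sum>i | i < n \<and> \<kappa> i = c'. as ! i)"
        unfolding blk_def by (rule sum_list_filter_nth)
      also have "{i. i < n \<and> \<kappa> i = c'} = {i. i < n \<and> rep i = c}"
        using h(2) card c unfolding \<kappa>_def inj_on_def by auto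
      finally show "\<exists>c\<in>rep ` {..<n}. sum_list b = (\<Sum>i | i < n \<and> rep i = c. as ! i)"
        using c(1) by blast
    qed
  qed
qed

text \<open>The family may depend on \<epsilon>, since finer clusters need more subspaces.\<close>

lemma SUP_ge_epsilon:
  fixes x :: ereal
  assumes "\<And>\<epsilon>::real. 0 < \<epsilon> \<Longrightarrow> \<exists>\<V>\<in>S. \<forall>as\<in>A \<V>. x \<le> f as + ereal \<epsilon>"
  shows "x \<le> (SUP \<V>\<in>S. INF as\<in>A \<V>. f as)"
proof (rule ereal_le_epsilon2)
  fix \<epsilon> :: real assume "0 < \<epsilon>"
  then obtain \<V> where V: "\<V> \<in> S" "\<forall>as\<in>A \<V>. x \<le> f as + ereal \<epsilon>" using assms by blast
  have "x - ereal \<epsilon> \<le> (INF as\<in>A \<V>. f as)"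
    using V(2) by (intro INF_greatest) (simp add: ereal_minus_le)
  also have "\<dots> \<le> (SUP \<V>\<in>S. INF as\<in>A \<V>. f as)" using V(1) by (rule SUP_upper)
  finally show "x \<le> (SUP \<V>\<in>S. INF as\<in>A \<V>. f as) + ereal \<epsilon>"
    by (simp add: ereal_minus_le)
qed

lemma sum_G_le:
  assumes "\<And>b. b \<in> set bs \<Longrightarrow> b \<in> nondegenerate_lists (length b)"
    and "(\<Sum>b\<leftarrow>bs. list_norm b) \<le> x"
  shows "(\<Sum>l\<leftarrow>map length bs. G l) \<le> ereal x"
proof -
  have "(\<Sum>l\<leftarrow>map length bs. G l) = (\<Sum>b\<leftarrow>bs. G (length b))" by (simp add: comp_def)
  also have "\<dots> \<le> (\<Sum>b\<leftarrow>bs. ereal (list_norm b))"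
    using assms(1) unfolding G_def by (intro sum_list_mono INF_lower)
  also have "\<dots> = ereal (\<Sum>b\<leftarrow>bs. list_norm b)" by (rule ereal_sum_list[symmetric])
  also have "\<dots> \<le> ereal x" using assms(2) by simp
  finally show ?thesis .
qed

lemma cluster_error:
  fixes \<epsilon> :: real
  assumes "1 \<le> n" "\<delta> = 12 * \<epsilon> / (real n * real n)"
  shows "real n * real n * \<delta> / 12 = \<epsilon>"
  using assms by simp

lemma cluster_data_repD: "(rep, \<rho>) \<in> cluster_data \<delta> n \<Longrightarrow> rep ` {..<n} \<subseteq> {..<n}"
  by (auto simp: cluster_data_def)

lemma G_dim_ge:
  assumes "d < n"
  shows "Min ((\<lambda>ls. \<Sum>l\<leftarrow>ls. G l) ` compositions n (d + 1)) \<le> G_dim n d" (is "?m \<le> _")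
proof -
  have "?m \<le> (SUP \<V>\<in>{\<V>. finite \<V> \<and> \<V> \<subseteq> subspaces_upto n d}.
      INF as\<in>{as \<in> nondegenerate_lists n. list_point as \<notin> \<Union>\<V>}. ereal (list_norm as))"
  proof (rule SUP_ge_epsilon)
    fix \<epsilon> :: real assume "0 < \<epsilon>"
    \<comment> \<open>Chosen so that the partition error \<open>n * n * \<delta> / 12\<close> equals
      \<epsilon>.\<close>
    define \<delta> where "\<delta> = 12 * \<epsilon> / (real n * real n)"
    have \<delta>: "0 < \<delta>" using \<open>0 < \<epsilon>\<close> assms by (simp add: \<delta>_def)
    \<comment> \<open>A list outside these spaces still lies in the space of its own cluster data,
      which therefore has dimension above d; this forces at least d + 1 clusters.\<close>
    define \<V> where "\<V> = {V \<in> (\<lambda>(rep, \<rho>). cluster_space n rep \<rho>) ` cluster_data \<delta> n. dim V \<le> d}"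
    have "finite \<V>" unfolding \<V>_def by (simp add: finite_cluster_data)
    moreover have "\<V> \<subseteq> subspaces_upto n d"
      unfolding \<V>_def subspaces_upto_def using subspace_cluster_space
      by (auto simp: cluster_space_def)
    moreover have "?m \<le> ereal (list_norm as) + ereal \<epsilon>"
      if "as \<in> {as \<in> nondegenerate_lists n. list_point as \<notin> \<Union>\<V>}" for as
    proof -
      have as: "as \<in> nondegenerate_lists n" "list_point as \<notin> \<Union>\<V>" using that by auto
      have len: "length as = n" and nz: "0 \<notin> set as"
        using as(1) by (auto simp: nondegenerate_lists_def)
      obtain rep \<rho> where rep: "(rep, \<rho>) \<in> cluster_data \<delta> n"
        "\<And>i. i < n \<Longrightarrow> of_int (as ! i) = \<rho> i * of_int (as ! rep i)"
        and cross: "\<And>i j. i < n \<Longrightarrow> j < n \<Longrightarrow> rep i \<noteq> rep j \<Longrightarrow>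
          \<bar>gcd_ker_int (as ! i) (as ! j)\<bar> \<le> \<delta>"
        using clusters[OF len nz \<delta>] by blast
      have "list_point as \<in> cluster_space n rep \<rho>"
        using len cluster_data_repD[OF rep(1)] rep(2) by (rule list_point_cluster_space)
      then have "\<not> dim (cluster_space n rep \<rho>) \<le> d"
        using as(2) rep(1) unfolding \<V>_def by auto
      then have card: "d + 1 \<le> card (rep ` {..<n})" using dim_cluster_space[of n rep \<rho>] by linarith
      have "1 \<le> d + 1" "0 \<le> \<delta>" using \<delta> by auto
      from cluster_blocks[OF as(1) cross this(1) card this(2)] obtain bs where bs: "map length bs \<in> compositions n (d + 1)"
        "\<forall>b\<in>set bs. b \<in> nondegenerate_lists (length b) \<and> 1 \<le> length b"
        "(\<Sum>b\<leftarrow>bs. list_norm b) \<le> list_norm as + real n * real n * \<delta> / 12"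
        "card (rep ` {..<n}) = d + 1 \<longrightarrow> (\<forall>b\<in>set bs.
          \<exists>c\<in>rep ` {..<n}. sum_list b = (\<Sum>i | i < n \<and> rep i = c. as ! i))" .
      have "?m \<le> (\<Sum>l\<leftarrow>map length bs. G l)"
        using bs(1) by (intro Min_le finite_imageI finite_compositions imageI)
      also have "\<dots> \<le> ereal (list_norm as + real n * real n * \<delta> / 12)"
        using bs(2,3) by (intro sum_G_le) auto
      also have "\<dots> = ereal (list_norm as) + ereal \<epsilon>"
        using cluster_error[OF _ \<delta>_def] assms by simp
      finally show ?thesis .
    qed
    ultimately show "\<exists>\<V>\<in>{\<V>. finite \<V> \<and> \<V> \<subseteq> subspaces_upto n d}.
        \<forall>as\<in>{as \<in> nondegenerate_lists n. list_point as \<notin> \<Union>\<V>}. ?m \<le> ereal (list_norm as) + ereal \<epsilon>"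
      by blast
  qed
  then show ?thesis using assms by (simp add: G_dim_def)
qed

lemma Gt_dim_ge:
  assumes "d + 2 \<le> n"
  shows "min (G_dim n (d + 1)) (Min ((\<lambda>ls. \<Sum>l\<leftarrow>ls. Gt l) ` compositions n (d + 1))) \<le> Gt_dim n d"
    (is "?m \<le> _")
  unfolding Gt_dim_def
proof (rule SUP_ge_epsilon)
  fix \<epsilon> :: real assume "0 < \<epsilon>"
  define \<delta> where "\<delta> = 12 * \<epsilon> / (real n * real n)"
  have \<delta>: "0 < \<delta>" using \<open>0 < \<epsilon>\<close> assms by (simp add: \<delta>_def)
  define \<V> where "\<V> = {V \<in> (\<lambda>(rep, \<rho>). zero_sum_space n rep \<rho>) ` cluster_data \<delta> n. dim V \<le> d}"
  have "finite \<V>" unfolding \<V>_def by (simp add: finite_cluster_data)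
  moreover have "\<V> \<subseteq> subspaces_upto n d"
    unfolding \<V>_def subspaces_upto_def using subspace_zero_sum_space
    by (auto simp: zero_sum_space_def cluster_space_def)
  moreover have "?m \<le> ereal (list_norm as) + ereal \<epsilon>"
    if "as \<in> {as \<in> nondegenerate_lists n. sum_list as = 0 \<and> list_point as \<notin> \<Union>\<V>}" for as
  proof -
    have as: "as \<in> nondegenerate_lists n" "list_point as \<notin> \<Union>\<V>" "sum_list as = 0"
      using that by auto
    have len: "length as = n" and nz: "0 \<notin> set as"
      using as(1) by (auto simp: nondegenerate_lists_def)
    have err: "ereal (list_norm as + real n * real n * \<delta> / 12) = ereal (list_norm as) + ereal \<epsilon>"
      using cluster_error[OF _ \<delta>_def] assms by simp
    obtain rep \<rho> where rep: "(rep, \<rho>) \<in> cluster_data \<delta> n"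
      "\<And>i. i < n \<Longrightarrow> of_int (as ! i) = \<rho> i * of_int (as ! rep i)"
      and cross: "\<And>i j. i < n \<Longrightarrow> j < n \<Longrightarrow> rep i \<noteq> rep j \<Longrightarrow>
        \<bar>gcd_ker_int (as ! i) (as ! j)\<bar> \<le> \<delta>"
      using clusters[OF len nz \<delta>] by blast
    have "list_point as \<in> cluster_space n rep \<rho>"
      using len cluster_data_repD[OF rep(1)] rep(2) by (rule list_point_cluster_space)
    moreover have "(\<Sum>i<n. lookup (list_point as) i) = of_int (sum_list as)"
      using len by (simp add: lookup_list_point sum_list_sum_nth atLeast0LessThan)
    ultimately have "list_point as \<in> zero_sum_space n rep \<rho>"
      using as(3) by (simp add: zero_sum_space_def)
    then have dim: "d < dim (zero_sum_space n rep \<rho>)"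
      using as(2) rep(1) unfolding \<V>_def by auto
    consider "d + 2 \<le> card (rep ` {..<n})" | "card (rep ` {..<n}) = d + 1"
      using dim dim_zero_sum_space(1)[of n rep \<rho>] by linarith
    then show ?thesis
    proof cases
      case 1
      have "1 \<le> d + 2" "0 \<le> \<delta>" using \<delta> by auto
      from cluster_blocks[OF as(1) cross this(1) 1 this(2)] obtain bs where bs: "map length bs \<in> compositions n (d + 2)"
        "\<forall>b\<in>set bs. b \<in> nondegenerate_lists (length b) \<and> 1 \<le> length b"
        "(\<Sum>b\<leftarrow>bs. list_norm b) \<le> list_norm as + real n * real n * \<delta> / 12"
        "card (rep ` {..<n}) = d + 2 \<longrightarrow> (\<forall>b\<in>set bs.
          \<exists>c\<in>rep ` {..<n}. sum_list b = (\<Sum>i | i < n \<and> rep i = c. as ! i))" .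
      \<comment> \<open>With at least d + 2 clusters, \<open>G_dim_le\<close> is used as an upper
        bound: \<open>G_dim n (d + 1)\<close> lies below the sum of G over the d + 2 block
        lengths.\<close>
      have "?m \<le> G_dim n (d + 1)" by simp
      also have "\<dots> \<le> (\<Sum>l\<leftarrow>map length bs. G l)"
        using bs(1) by (intro G_dim_le) simp
      also have "\<dots> \<le> ereal (list_norm as + real n * real n * \<delta> / 12)"
        using bs(2,3) by (intro sum_G_le) auto
      finally show ?thesis unfolding err .
    next
      case 2
      have "1 \<le> d + 1" "d + 1 \<le> card (rep ` {..<n})" "0 \<le> \<delta>" using \<delta> 2 by auto
      from cluster_blocks[OF as(1) cross this] obtain bs where bs: "map length bs \<in> compositions n (d + 1)"
        "\<forall>b\<in>set bs. b \<in> nondegenerate_lists (length b) \<and> 1 \<le> length b"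
        "(\<Sum>b\<leftarrow>bs. list_norm b) \<le> list_norm as + real n * real n * \<delta> / 12"
        "card (rep ` {..<n}) = d + 1 \<longrightarrow> (\<forall>b\<in>set bs.
          \<exists>c\<in>rep ` {..<n}. sum_list b = (\<Sum>i | i < n \<and> rep i = c. as ! i))" .
      have sum0: "sum_list b = 0" if "b \<in> set bs" for b
      proof -
        obtain c where c: "c \<in> rep ` {..<n}" "sum_list b = (\<Sum>i | i < n \<and> rep i = c. as ! i)"
          using bs(4) 2 \<open>b \<in> set bs\<close> by blast
        \<comment> \<open>A non-zero value would push the dimension of the zero-sum space below d +
          1, against \<open>dim\<close>.\<close>
        have "(\<Sum>i | i < n \<and> rep i = c. \<rho> i) = 0"
          using dim_zero_sum_space(2)[OF c(1)] dim 2 by fastforce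
        moreover have "real_of_int (sum_list b) = (\<Sum>i | i < n \<and> rep i = c. \<rho> i * of_int (as ! c))"
          unfolding c(2) of_int_sum by (intro sum.cong) (auto simp: rep(2))
        ultimately have "real_of_int (sum_list b) = 0" by (simp flip: sum_distrib_right)
        then show ?thesis by simp
      qed
      have "?m \<le> Min ((\<lambda>ls. \<Sum>l\<leftarrow>ls. Gt l) ` compositions n (d + 1))" by simp
      also have "\<dots> \<le> (\<Sum>l\<leftarrow>map length bs. Gt l)"
        using bs(1) by (intro Min_le finite_imageI finite_compositions imageI)
      also have "\<dots> = (\<Sum>b\<leftarrow>bs. Gt (length b))" by (simp add: comp_def)
      also have "\<dots> \<le> (\<Sum>b\<leftarrow>bs. ereal (list_norm b))"
        using bs(2) sum0 by (intro sum_list_mono Gt_le) auto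
      also have "\<dots> = ereal (\<Sum>b\<leftarrow>bs. list_norm b)" by (rule ereal_sum_list[symmetric])
      also have "\<dots> \<le> ereal (list_norm as + real n * real n * \<delta> / 12)" using bs(3) by simp
      finally show ?thesis unfolding err .
    qed
  qed
  ultimately show "\<exists>\<V>\<in>{\<V>. finite \<V> \<and> \<V> \<subseteq> subspaces_upto n d}.
      \<forall>as\<in>{as \<in> nondegenerate_lists n. sum_list as = 0 \<and> list_point as \<notin> \<Union>\<V>}.
        ?m \<le> ereal (list_norm as) + ereal \<epsilon>"
    by blast
qed

theorem G_dim_eq:
  assumes "d < n"
  shows "G_dim n d = Min ((\<lambda>ls. \<Sum>l\<leftarrow>ls. G l) ` compositions n (d + 1))"
proof (rule antisym[OF _ G_dim_ge[OF assms]])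
  show "G_dim n d \<le> Min ((\<lambda>ls. \<Sum>l\<leftarrow>ls. G l) ` compositions n (d + 1))"
    using finite_compositions compositions_nonempty[OF assms] G_dim_le by (subst Min_ge_iff) auto
qed

section \<open>Numerical consequences\<close>

lemma Min_compositions_ge:
  assumes "k < n" "\<And>ls. ls \<in> compositions n (k + 1) \<Longrightarrow> x \<le> (\<Sum>l\<leftarrow>ls. h l)"
  shows "(x::ereal) \<le> Min ((\<lambda>ls. \<Sum>l\<leftarrow>ls. h l) ` compositions n (k + 1))"
  using finite_compositions compositions_nonempty[OF assms(1)] assms(2) by (subst Min_ge_iff) auto

lemma sum_list_ereal_ge:
  fixes \<gamma> :: "nat \<Rightarrow> real" and h :: "nat \<Rightarrow> ereal"
  assumes "ls \<in> compositions n k" "\<And>l. 1 \<le> l \<Longrightarrow> ereal (\<gamma> l) \<le> h l" "x \<le> (\<Sum>l\<leftarrow>ls. \<gamma> l)"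
  shows "ereal x \<le> (\<Sum>l\<leftarrow>ls. h l)"
proof -
  have "ereal x \<le> (\<Sum>l\<leftarrow>ls. ereal (\<gamma> l))"
    unfolding ereal_sum_list[symmetric] using assms(3) by simp
  also have "\<dots> \<le> (\<Sum>l\<leftarrow>ls. h l)"
    using assms(1,2) by (intro sum_list_mono) (auto simp: compositions_def)
  finally show ?thesis .
qed

lemma G_dim_small:
  assumes "d + 1 \<le> n" "n \<le> 2 * d + 2"
  shows "G_dim n d = ereal ((real d + 1) / 12)"
proof (rule antisym)
  \<comment> \<open>The numbers of twos and ones solve x + y = d + 1 and 2x + y = n; for both
    lengths G is at most 1/12.\<close>
  define ls where "ls = replicate (n - d - 1) (2::nat) @ replicate (2 * d + 2 - n) 1"
  have "ls \<in> compositions n (d + 1)"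
    using assms by (auto simp: ls_def compositions_def sum_list_replicate)
  then have "G_dim n d \<le> (\<Sum>l\<leftarrow>ls. G l)" by (rule G_dim_le)
  also have "\<dots> \<le> (\<Sum>l\<leftarrow>ls. ereal (1 / 12))"
    by (intro sum_list_mono G_le) (auto simp: ls_def)
  also have "\<dots> = ereal ((real d + 1) / 12)"
    using \<open>ls \<in> compositions n (d + 1)\<close> unfolding ereal_sum_list[symmetric]
    by (simp add: sum_list_triv compositions_def)
  finally show "G_dim n d \<le> ereal ((real d + 1) / 12)" .
  have "ereal ((real d + 1) / 12) \<le> (\<Sum>l\<leftarrow>ls. G l)" if "ls \<in> compositions n (d + 1)" for ls
    using that
  proof (rule sum_list_ereal_ge[where \<gamma> = "\<lambda>l. 1 / 12"])
    fix l :: nat assume "1 \<le> l"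
    from G_ge[OF this] show "ereal (1 / 12) \<le> G l"
      by (rule order_trans[rotated]) (simp add: ereal_less_eq(3) del: times_divide_eq_right)
  qed (use that in \<open>simp add: sum_list_triv compositions_def\<close>)
  then show "ereal ((real d + 1) / 12) \<le> G_dim n d"
    unfolding G_dim_eq[OF Suc_le_lessD[OF assms(1)[unfolded Suc_eq_plus1[symmetric]]]]
    using assms(1) by (intro Min_compositions_ge) auto
qed

text \<open>Since n > 2 (d + 1), some part is at least 3, which adds 1/9 - 1/12 = 1/36 to the
  baseline of 1/12 per part.\<close>

lemma G_dim_large:
  assumes "2 * d + 3 \<le> n"
  shows "ereal (real d / 12 + 1 / 9) \<le> G_dim n d"
proof -
  define \<gamma> :: "nat \<Rightarrow> real" where "\<gamma> l = (if 3 \<le> l then 1 / 9 else 1 / 12)" for l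
  have sum_ge: "real (length ls) / 12 + (if \<exists>l\<in>set ls. 3 \<le> l then 1 / 36 else 0) \<le> (\<Sum>l\<leftarrow>ls. \<gamma> l)" for ls
  proof (induction ls)
    case (Cons l ls)
    then show ?case by (cases "3 \<le> l"; cases "\<exists>l\<in>set ls. 3 \<le> l") (simp_all add: \<gamma>_def add_divide_distrib)
  qed simp
  have small: "sum_list ls \<le> 2 * length ls" if "\<And>l. l \<in> set ls \<Longrightarrow> \<not> 3 \<le> l" for ls :: "nat list"
    using that
  proof (induction ls)
    case (Cons l ls)
    have "l \<le> 2" using Cons.prems[of l] by simp
    moreover have "sum_list ls \<le> 2 * length ls" using Cons by simp
    ultimately show ?case by simp
  qed simp
  have dn: "d < n" using assms by simp
  have "ereal (real d / 12 + 1 / 9) \<le> (\<Sum>l\<leftarrow>ls. G l)" if ls: "ls \<in> compositions n (d + 1)" for ls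
  proof (rule sum_list_ereal_ge[OF ls])
    show "ereal (\<gamma> l) \<le> G l" if "1 \<le> l" for l
      unfolding \<gamma>_def using that by (rule G_ge)
    have "length ls = d + 1" "sum_list ls = n" using ls by (auto simp: compositions_def)
    then have "\<exists>l\<in>set ls. 3 \<le> l" using small[of ls] assms by fastforce
    then show "real d / 12 + 1 / 9 \<le> (\<Sum>l\<leftarrow>ls. \<gamma> l)"
      using sum_ge[of ls] \<open>length ls = d + 1\<close> by (simp add: add_divide_distrib)
  qed
  then show ?thesis unfolding G_dim_eq[OF dn] using dn by (intro Min_compositions_ge)
qed

lemma sum_Gt_ge:
  assumes "ls \<in> compositions n (d + 1)"
  shows "ereal ((real d + 1) / 6) \<le> (\<Sum>l\<leftarrow>ls. Gt l)"
  using assms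
proof (rule sum_list_ereal_ge[where \<gamma> = "\<lambda>l. 1 / 6"])
  fix l :: nat assume "1 \<le> l"
  from Gt_ge[OF this] show "ereal (1 / 6) \<le> Gt l"
    by (rule order_trans[rotated]) (simp add: ereal_less_eq(3) del: times_divide_eq_right)
qed (use assms in \<open>simp add: sum_list_triv compositions_def\<close>)

text \<open>The term \<open>G_dim n (d + 1)\<close> equals (d + 2)/12, and the sum over zero-sum
  clusters, at least (d + 1)/6, is no smaller.\<close>

lemma Gt_dim_small:
  assumes "d + 2 \<le> n" "n \<le> 2 * d + 4"
  shows "ereal ((real d + 2) / 12) \<le> Gt_dim n d"
proof -
  have "ereal ((real d + 2) / 12) \<le> G_dim n (d + 1)"
    using G_dim_small[of "d + 1" n] assms by (simp add: add.commute)
  moreover have "ereal ((real d + 2) / 12) \<le> (\<Sum>l\<leftarrow>ls. Gt l)" if "ls \<in> compositions n (d + 1)" for ls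
    using sum_Gt_ge[OF that] by (rule order_trans[rotated]) simp
  then have "ereal ((real d + 2) / 12) \<le> Min ((\<lambda>ls. \<Sum>l\<leftarrow>ls. Gt l) ` compositions n (d + 1))"
    using assms(1) by (intro Min_compositions_ge) auto
  ultimately have "ereal ((real d + 2) / 12)
      \<le> min (G_dim n (d + 1)) (Min ((\<lambda>ls. \<Sum>l\<leftarrow>ls. Gt l) ` compositions n (d + 1)))"
    by (rule min.boundedI)
  also have "\<dots> \<le> Gt_dim n d" using assms(1) by (rule Gt_dim_ge)
  finally show ?thesis .
qed

text \<open>The first term gives (d + 1)/12 + 1/9, which is the claim. For d >= 1 the second follows
  from (d + 1)/6; only d = 0, with one cluster of length n >= 5, relies on the bound 7/36.\<close>

lemma Gt_dim_large:
  assumes "2 * d + 5 \<le> n"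
  shows "ereal (real d / 12 + 7 / 36) \<le> Gt_dim n d"
proof -
  have "ereal (real d / 12 + 7 / 36) = ereal (real (d + 1) / 12 + 1 / 9)"
    by (simp add: field_simps)
  also have "\<dots> \<le> G_dim n (d + 1)" using assms by (intro G_dim_large) simp
  finally have 1: "ereal (real d / 12 + 7 / 36) \<le> G_dim n (d + 1)" .
  have "ereal (real d / 12 + 7 / 36) \<le> (\<Sum>l\<leftarrow>ls. Gt l)" if ls: "ls \<in> compositions n (d + 1)" for ls
  proof (cases "d = 0")
    case True
    then obtain l where "ls = [l]" using ls by (auto simp: compositions_def length_Suc_conv)
    then have "ls = [n]" using ls by (simp add: compositions_def)
    then show ?thesis using Gt_ge[of n] assms True by simp
  next
    case False
    then have "real d / 12 + 7 / 36 \<le> (real d + 1) / 6" by (simp add: field_simps)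
    then show ?thesis using sum_Gt_ge[OF ls] by (meson ereal_less_eq(3) order_trans)
  qed
  then have "ereal (real d / 12 + 7 / 36) \<le> Min ((\<lambda>ls. \<Sum>l\<leftarrow>ls. Gt l) ` compositions n (d + 1))"
    using assms by (intro Min_compositions_ge) auto
  with 1 have "ereal (real d / 12 + 7 / 36)
      \<le> min (G_dim n (d + 1)) (Min ((\<lambda>ls. \<Sum>l\<leftarrow>ls. Gt l) ` compositions n (d + 1)))"
    by (rule min.boundedI)
  also have "\<dots> \<le> Gt_dim n d" using assms by (intro Gt_dim_ge) simp
  finally show ?thesis .
qed

theorem theorem1p3:
  fixes n d :: nat
  shows
    "(d + 1 \<le> n \<longrightarrow>
        G_dim n d = Min ((\<lambda>ls. \<Sum>l\<leftarrow>ls. G l) ` compositions n (d + 1)))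
     \<and> (d + 2 \<le> n \<longrightarrow>
        Gt_dim n d \<ge> min (G_dim n (d + 1))
                        (Min ((\<lambda>ls. \<Sum>l\<leftarrow>ls. Gt l) ` compositions n (d + 1))))
     \<and> (d + 1 \<le> n \<and> n \<le> 2 * d + 2 \<longrightarrow> G_dim n d = ereal ((real d + 1) / 12))
     \<and> (2 * d + 3 \<le> n \<longrightarrow> G_dim n d \<ge> ereal (real d / 12 + 1 / 9))
     \<and> (d + 2 \<le> n \<and> n \<le> 2 * d + 4 \<longrightarrow> Gt_dim n d \<ge> ereal ((real d + 2) / 12))
     \<and> (2 * d + 5 \<le> n \<longrightarrow> Gt_dim n d \<ge> ereal (real d / 12 + 7 / 36))"
  by (intro conjI impI G_dim_eq Gt_dim_ge G_dim_small G_dim_large Gt_dim_small Gt_dim_large) auto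

end
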